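(* Let $1<p\le 2$. There is a constant $C_p$ such that for every positive function $\phi\in L^{1,\infty}(\Omega,d\mu)$ and every $f\in\mathcal{S}(\mathbb{H}^n)$, $$\left(\int_{\Omega}\left(\int_{\mathbb{C}^n}|\mathcal{F}(f)(a,w)|^2\,dw\right)^{p/2}|\lambda|^{np/2}\,\phi(a)^{2-p}\,d\mu(a)\right)^{1/p}\le C_p\,\big(\|\phi\|_{1,\infty}\big)^{\frac2p-1}\,\|f\|_{L^p(\mathbb{H}^n)}.$$
   Context: Let $n\ge 1$. The Heisenberg group $\mathbb{H}^n=\mathbb{C}^n\times\mathbb{R}$ has group law $(z,t)(w,s)=(z+w,\,t+s+\tfrac12\operatorname{Im}(z\cdot\overline{w}))$ (so $(z,t)^{-1}=(-z,-t)$) and Haar measure $dz\,dt$ (Lebesgue measure); $L^p(\mathbb{H}^n)$ is taken with respect to it, and $\mathcal{S}(\mathbb{H}^n)$ is the Schwartz space of $\mathbb{C}^n\times\mathbb{R}\cong\mathbb{R}^{2n+1}$. Write $\mathbb{R}^*=\mathbb{R}\setminus\{0\}$. Laguerre functions: for $\lambda\in\mathbb{R}^*$ and $k\in\{0,1,2,\dots\}$, $\varphi^{n-1}_{k,\lambda}(z)=L^{n-1}_k\big(\tfrac12|\lambda||z|^2\big)e^{-\frac14|\lambda||z|^2}$, where $L_k^{\delta}(t)=\frac{t^{-\delta}e^t}{k!}\big(\frac{d}{dt}\big)^k(e^{-t}t^{k+\delta})$ is the Laguerre polynomial of type $\delta$ and degree $k$. Heisenberg fan: $\Omega=\bigcup_{k\ge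 0}R_k\cup R_\infty\subset\mathbb{R}^2$, where $R_k=\{(\lambda,(2k+n)|\lambda|):\lambda\in\mathbb{R}^*\}$ and $R_\infty=\{(0,\tau):\tau\ge 0\}$. Throughout, $a=(\lambda,(2k+n)|\lambda|)$ denotes a point of $R_k$ (and $\lambda$ its first coordinate); put $e_a(z,t)=e^{i\lambda t}\varphi^{n-1}_{k,\lambda}(z)$ and $c_{n,k}=\frac{k!\,(n-1)!}{(k+n-1)!}$. Normalized Strichartz Fourier transform: for $f\in L^1\cap L^2(\mathbb{H}^n)$, $a\in R_k$, $w\in\mathbb{C}^n$, $$\mathcal{F}(f)(a,w)=c_{n,k}\int_{\mathbb{H}^n}f(z,t)\,e_a\big((z,t)^{-1}(w,0)\big)\,dz\,dt.$$ (Values on $R_\infty$ are irrelevant here, since $R_\infty$ is a null set for the measures below.) The measures $\nu_2$ and $\mu$ on $\Omega$ are $$\int_\Omega\phi\,d\nu_2=(2\pi)^{-2n-1}\int_{-\infty}^\infty\Big(\sum_{k=0}^\infty c_{n,k}^{-2}\,\phi(\lambda,(2k+n)|\lambda|)\Big)|\lambda|^{2n}\,d\lambda,\qquad d\mu(a)=|\lambda|^{-n}\,d\nu_2(a).$$ The weak-$L^1$ (Lorentz) space $L^{1,\infty}(\Omega,d\mu)$ consists of the measurable $\phi$ with $\|\phi\|_{1,\infty}=\sup_{t>0}t\,\phi^*(t)=\sup_{s>0}s\,\mu\{a\in\Omega:|\phi(a)|>s\}<\infty$, where $\phi^*$ is the decreasing rearrangement. *)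

theory Defs
  imports "HOL-Analysis.Analysis" "HOL-Computational_Algebra.Polynomial"
begin

section \<open>Extended powers, Lebesgue and weak Lebesgue spaces\<close>

text \<open>Powers of extended nonnegative reals, meant for exponents \<open>r \<ge> 0\<close>.\<close>

definition enn_powr :: "ennreal \<Rightarrow> real \<Rightarrow> ennreal" where
  "enn_powr x r =
     (if r = 0 then 1 else if x = \<infinity> then \<infinity> else ennreal (enn2real x powr r))"

definition Lp_norm :: "real \<Rightarrow> 'a measure \<Rightarrow> ('a \<Rightarrow> complex) \<Rightarrow> ennreal" where
  "Lp_norm p M f = enn_powr (\<integral>\<^sup>+ x. ennreal (cmod (f x) powr p) \<partial>M) (1 / p)"

definition weak_L1_norm :: "'a measure \<Rightarrow> ('a \<Rightarrow> real) \<Rightarrow> ennreal" where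
  "weak_L1_norm M \<phi> =
     (SUP s\<in>{0<..}. ennreal s * emeasure M {a \<in> space M. s < \<bar>\<phi> a\<bar>})"

definition weak_L1 :: "'a measure \<Rightarrow> ('a \<Rightarrow> real) set" where
  "weak_L1 M = {\<phi> \<in> borel_measurable M. weak_L1_norm M \<phi> < \<infinity>}"


section \<open>Schwartz functions\<close>

primrec partial_derivs ::
  "'a list \<Rightarrow> ('a::euclidean_space \<Rightarrow> complex) \<Rightarrow> 'a \<Rightarrow> complex" where
  "partial_derivs [] f = f"
| "partial_derivs (b # bs) f = (\<lambda>x. frechet_derivative (partial_derivs bs f) (at x) b)"

text \<open>Smoothness amounts to differentiability of all iterated partial derivatives; \<open>\<alpha>\<close> is the
  multi-index of the monomial weight.\<close>

definition schwartz :: "('a::euclidean_space \<Rightarrow> complex) \<Rightarrow> bool" where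
  "schwartz f \<longleftrightarrow>
     (\<forall>bs. set bs \<subseteq> Basis \<longrightarrow>
        (\<forall>x. partial_derivs bs f differentiable (at x)) \<and>
        (\<forall>\<alpha>::'a \<Rightarrow> nat.
           bounded (range (\<lambda>x. (\<Prod>b\<in>Basis. (x \<bullet> b) ^ \<alpha> b) *\<^sub>R partial_derivs bs f x))))"


section \<open>The Heisenberg group\<close>

type_synonym 'n heis = "(complex ^ 'n) \<times> real"

definition heis_mult :: "'n::finite heis \<Rightarrow> 'n heis \<Rightarrow> 'n heis" where
  "heis_mult x y =
     (fst x + fst y,
      snd x + snd y + 1/2 * Im (\<Sum>j\<in>UNIV. fst x $ j * cnj (fst y $ j)))"

definition heis_inv :: "'n::finite heis \<Rightarrow> 'n heis" where
  "heis_inv x = (- fst x, - snd x)"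

lemma heis_mult_inv: "heis_mult (heis_inv x) x = (0, 0)" "heis_mult x (heis_inv x) = (0, 0)"
  by (simp_all add: heis_mult_def heis_inv_def sum_negf complex_mult_cnj)


section \<open>Laguerre polynomials and Laguerre functions\<close>

text \<open>The Rodrigues formula determines a polynomial; stating it for \<open>t > 0\<close> and then taking the
  polynomial gives the right value at \<open>t = 0\<close>, where the formula involves a division by zero.\<close>

definition laguerre :: "nat \<Rightarrow> nat \<Rightarrow> real poly" where
  "laguerre \<delta> k = (THE P. \<forall>t>0.
     poly P t = exp t / (t ^ \<delta> * fact k) * (deriv ^^ k) (\<lambda>s. exp (- s) * s ^ (k + \<delta>)) t)"

lemma deriv_exp_minus_poly:
  "deriv (\<lambda>s::real. exp (- s) * poly q s) = (\<lambda>s. exp (- s) * poly (pderiv q - q) s)"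
proof
  fix s :: real
  have "((\<lambda>s. exp (- s) * poly q s) has_real_derivative exp (- s) * poly (pderiv q - q) s) (at s)"
    by (auto intro!: derivative_eq_intros simp: algebra_simps)
  then show "deriv (\<lambda>s. exp (- s) * poly q s) s = exp (- s) * poly (pderiv q - q) s"
    by (rule DERIV_imp_deriv)
qed

lemma deriv_exp_minus_monom:
  "\<exists>q. (deriv ^^ m) (\<lambda>s::real. exp (- s) * s ^ (m + j))
        = (\<lambda>s. exp (- s) * poly (monom 1 j * q) s)"
proof -
  have "\<exists>q. (deriv ^^ m) (\<lambda>s::real. exp (- s) * s ^ N)
          = (\<lambda>s. exp (- s) * poly (monom 1 (N - m) * q) s)" if "m \<le> N" for N
    using that
  proof (induction m)
    case 0
    show ?case by (rule exI[of _ 1]) (simp add: poly_monom)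
  next
    case (Suc m)
    then obtain q where q: "(deriv ^^ m) (\<lambda>s::real. exp (- s) * s ^ N)
          = (\<lambda>s. exp (- s) * poly (monom 1 (N - m) * q) s)" by auto
    define i where "i = N - Suc m"
    have i: "N - m = Suc i" using Suc.prems by (simp add: i_def)
    have dvd1: "monom 1 i dvd (monom 1 (Suc i) :: real poly)"
      by (simp add: monom_1_dvd_iff)
    have dvd2: "monom 1 i dvd pderiv (monom 1 (Suc i) :: real poly)"
      by (auto simp: pderiv_monom dvd_def smult_monom mult_monom
          intro!: exI[of _ "[:1 + real i:]"])
    have "monom 1 i dvd pderiv (monom 1 (Suc i) * q) - monom 1 (Suc i) * q"
      using dvd1 dvd2 by (simp add: pderiv_mult dvd_add dvd_diff)
    then obtain r where r: "pderiv (monom 1 (Suc i) * q) - monom 1 (Suc i) * q = monom 1 i * r"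
      by (rule dvdE)
    show ?case
      by (rule exI[of _ r]) (simp add: q i deriv_exp_minus_poly r i_def [symmetric] del: poly_mult poly_diff)
  qed
  from this[of "m + j"] show ?thesis by simp
qed

lemma laguerre_rodrigues:
  assumes "t > 0"
  shows "poly (laguerre \<delta> k) t =
           exp t / (t ^ \<delta> * fact k) * (deriv ^^ k) (\<lambda>s. exp (- s) * s ^ (k + \<delta>)) t"
proof -
  let ?R = "\<lambda>t. exp t / (t ^ \<delta> * fact k) * (deriv ^^ k) (\<lambda>s::real. exp (- s) * s ^ (k + \<delta>)) t"
  obtain q where q: "(deriv ^^ k) (\<lambda>s::real. exp (- s) * s ^ (k + \<delta>))
      = (\<lambda>s. exp (- s) * poly (monom 1 \<delta> * q) s)"
    using deriv_exp_minus_monom by blast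
  have ex: "\<forall>t>0. poly (smult (1 / fact k) q) t = ?R t"
    unfolding q by (simp add: poly_monom exp_minus field_simps)
  have uniq: "P = Q" if "\<forall>t>0. poly P t = ?R t" "\<forall>t>0. poly Q t = ?R t" for P Q
  proof (rule ccontr)
    assume "P \<noteq> Q"
    then have "finite {t. poly (P - Q) t = 0}" by (intro poly_roots_finite) simp
    moreover have "{0<..} \<subseteq> {t. poly (P - Q) t = 0}" using that by auto
    ultimately show False using infinite_Ioi finite_subset by blast
  qed
  have "\<forall>t>0. poly (laguerre \<delta> k) t = ?R t"
    unfolding laguerre_def by (rule theI[of _ "smult (1 / fact k) q"]) (use ex uniq in blast)+
  with assms show ?thesis by blast
qed

text \<open>The Laguerre function of type \<open>n - 1\<close> on \<open>\<complex>\<^sup>n\<close>.\<close>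

definition laguerre_fun :: "nat \<Rightarrow> real \<Rightarrow> complex ^ 'n::finite \<Rightarrow> real" where
  "laguerre_fun k l z =
     poly (laguerre (CARD('n) - 1) k) (1/2 * \<bar>l\<bar> * (norm z)\<^sup>2) * exp (- (1/4 * \<bar>l\<bar> * (norm z)\<^sup>2))"


section \<open>The Heisenberg fan and its measures\<close>

definition fan_ray :: "nat \<Rightarrow> nat \<Rightarrow> (real \<times> real) set" where
  "fan_ray n k = {(l, (2 * real k + real n) * \<bar>l\<bar>) |l. l \<noteq> 0}"

definition fan_ray_inf :: "(real \<times> real) set" where
  "fan_ray_inf = {(0, \<tau>) |\<tau>. \<tau> \<ge> 0}"

definition heis_fan :: "nat \<Rightarrow> (real \<times> real) set" where
  "heis_fan n = (\<Union>k. fan_ray n k) \<union> fan_ray_inf"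

definition fan_index :: "nat \<Rightarrow> real \<times> real \<Rightarrow> nat" where
  "fan_index n a = (THE k. a \<in> fan_ray n k)"

lemma fan_index_ray:
  assumes "a \<in> fan_ray n k"
  shows "fan_index n a = k"
  unfolding fan_index_def by (rule the_equality) (use assms in \<open>auto simp: fan_ray_def\<close>)

definition fan_coeff :: "nat \<Rightarrow> nat \<Rightarrow> real" where
  "fan_coeff n k = fact k * fact (n - 1) / fact (k + n - 1)"

definition fan_nu2 :: "nat \<Rightarrow> (real \<times> real) measure" where
  "fan_nu2 n = measure_of (heis_fan n) (sets (restrict_space borel (heis_fan n)))
     (\<lambda>A. ennreal (1 / (2 * pi) ^ (2 * n + 1)) *
        (\<integral>\<^sup>+ l. (\<Sum>k. ennreal (1 / (fan_coeff n k)\<^sup>2) *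
                     indicator A (l, (2 * real k + real n) * \<bar>l\<bar>)) *
               ennreal (\<bar>l\<bar> ^ (2 * n)) \<partial>lborel))"

definition fan_mu :: "nat \<Rightarrow> (real \<times> real) measure" where
  "fan_mu n = density (fan_nu2 n) (\<lambda>a. ennreal (1 / \<bar>fst a\<bar> ^ n))"

text \<open>\<^term>\<open>fan_nu2\<close> is given above by its values on Borel subsets of the fan. It is indeed a measure,
  and it integrates functions by the expected formula.\<close>

context
  fixes n :: nat
begin

private definition fan_point :: "nat \<times> real \<Rightarrow> real \<times> real" where
  "fan_point x = (snd x, (2 * real (fst x) + real n) * \<bar>snd x\<bar>)"

private definition fan_weight :: "nat \<times> real \<Rightarrow> ennreal" where
  "fan_weight x = ennreal (1 / (2 * pi) ^ (2 * n + 1)) *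
     (ennreal (1 / (fan_coeff n (fst x))\<^sup>2) * ennreal (\<bar>snd x\<bar> ^ (2 * n)))"

private definition fan_aux :: "(real \<times> real) measure" where
  "fan_aux = distr (density (count_space UNIV \<Otimes>\<^sub>M lborel) fan_weight)
     (restrict_space borel (heis_fan n)) fan_point"

private lemma fan_point_in: "fan_point x \<in> heis_fan n"
proof (cases "snd x = 0")
  case True
  then show ?thesis by (auto simp: fan_point_def heis_fan_def fan_ray_inf_def)
next
  case False
  then have "fan_point x \<in> fan_ray n (fst x)" by (auto simp: fan_point_def fan_ray_def)
  then show ?thesis by (auto simp: heis_fan_def)
qed

private lemma fan_point_measurable [measurable]:
  "fan_point \<in> measurable (count_space UNIV \<Otimes>\<^sub>M lborel) (restrict_space borel (heis_fan n))"
proof (rule measurable_restrict_space2)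
  show "fan_point \<in> space (count_space UNIV \<Otimes>\<^sub>M lborel) \<rightarrow> heis_fan n"
    using fan_point_in by auto
  show "fan_point \<in> borel_measurable (count_space UNIV \<Otimes>\<^sub>M lborel)"
    unfolding fan_point_def by measurable
qed

private lemma fan_weight_measurable [measurable]:
  "fan_weight \<in> borel_measurable (count_space UNIV \<Otimes>\<^sub>M lborel)"
  unfolding fan_weight_def by measurable

private lemma nn_integral_fan_aux:
  assumes "\<phi> \<in> borel_measurable (restrict_space borel (heis_fan n))"
  shows "(\<integral>\<^sup>+ a. \<phi> a \<partial>fan_aux) = ennreal (1 / (2 * pi) ^ (2 * n + 1)) *
        (\<integral>\<^sup>+ l. (\<Sum>k. ennreal (1 / (fan_coeff n k)\<^sup>2) * \<phi> (l, (2 * real k + real n) * \<bar>l\<bar>)) *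
               ennreal (\<bar>l\<bar> ^ (2 * n)) \<partial>lborel)"
proof -
  note assms [measurable]
  interpret pair_sigma_finite "count_space (UNIV :: nat set)" "lborel :: real measure"
    by (intro pair_sigma_finite.intro sigma_finite_measure_count_space lborel.sigma_finite_measure_axioms)
  have meas: "(\<lambda>x. \<phi> (fan_point x)) \<in> borel_measurable (count_space UNIV \<Otimes>\<^sub>M lborel)"
    by measurable
  have meas_k [measurable]:
    "(\<lambda>l. \<phi> (l, (2 * real k + real n) * \<bar>l\<bar>)) \<in> borel_measurable lborel" for k
  proof -
    have "(\<lambda>l::real. (k, l)) \<in> measurable lborel (count_space UNIV \<Otimes>\<^sub>M lborel)" by simp
    from measurable_compose[OF this meas] show ?thesis by (simp add: fan_point_def)
  qed
  have "(\<integral>\<^sup>+ a. \<phi> a \<partial>fan_aux)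
      = (\<integral>\<^sup>+ x. fan_weight x * \<phi> (fan_point x) \<partial>(count_space UNIV \<Otimes>\<^sub>M lborel))"
    unfolding fan_aux_def using assms by (simp add: nn_integral_distr nn_integral_density)
  also have "\<dots> = (\<integral>\<^sup>+ l. (\<integral>\<^sup>+ k. fan_weight (k, l) * \<phi> (fan_point (k, l)) \<partial>count_space UNIV) \<partial>lborel)"
    by (rule nn_integral_snd [symmetric]) measurable
  also have "\<dots> = (\<integral>\<^sup>+ l. ennreal (1 / (2 * pi) ^ (2 * n + 1)) *
        ((\<Sum>k. ennreal (1 / (fan_coeff n k)\<^sup>2) * \<phi> (l, (2 * real k + real n) * \<bar>l\<bar>)) *
               ennreal (\<bar>l\<bar> ^ (2 * n))) \<partial>lborel)"
    by (simp add: nn_integral_count_space_nat fan_weight_def fan_point_def mult_ac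
        flip: ennreal_suminf_cmult ennreal_suminf_multc)
  also have "\<dots> = ennreal (1 / (2 * pi) ^ (2 * n + 1)) *
        (\<integral>\<^sup>+ l. (\<Sum>k. ennreal (1 / (fan_coeff n k)\<^sup>2) * \<phi> (l, (2 * real k + real n) * \<bar>l\<bar>)) *
               ennreal (\<bar>l\<bar> ^ (2 * n)) \<partial>lborel)"
    by (rule nn_integral_cmult) measurable
  finally show ?thesis .
qed

private lemma fan_nu2_eq_aux: "fan_nu2 n = fan_aux"
proof -
  have sp: "space fan_aux = heis_fan n" and
       se: "sets fan_aux = sets (restrict_space borel (heis_fan n))"
    by (simp_all add: fan_aux_def space_restrict_space)
  have "fan_nu2 n = measure_of (space fan_aux) (sets fan_aux) (emeasure fan_aux)"
    unfolding fan_nu2_def sp se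
  proof (rule measure_of_eq)
    show "sets (restrict_space borel (heis_fan n)) \<subseteq> Pow (heis_fan n)"
      using sets.space_closed[of "restrict_space borel (heis_fan n)"]
      by (simp add: space_restrict_space)
    fix A assume "A \<in> sigma_sets (heis_fan n) (sets (restrict_space borel (heis_fan n)))"
    then have A: "A \<in> sets (restrict_space borel (heis_fan n))"
      using sets.sigma_sets_eq[of "restrict_space borel (heis_fan n)"]
      by (simp add: space_restrict_space)
    have "emeasure fan_aux A = (\<integral>\<^sup>+ a. indicator A a \<partial>fan_aux)"
      using A se by simp
    also have "\<dots> = ennreal (1 / (2 * pi) ^ (2 * n + 1)) *
        (\<integral>\<^sup>+ l. (\<Sum>k. ennreal (1 / (fan_coeff n k)\<^sup>2) *
                     indicator A (l, (2 * real k + real n) * \<bar>l\<bar>)) *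
               ennreal (\<bar>l\<bar> ^ (2 * n)) \<partial>lborel)"
      using A by (intro nn_integral_fan_aux) simp
    finally show "ennreal (1 / (2 * pi) ^ (2 * n + 1)) *
        (\<integral>\<^sup>+ l. (\<Sum>k. ennreal (1 / (fan_coeff n k)\<^sup>2) *
                     indicator A (l, (2 * real k + real n) * \<bar>l\<bar>)) *
               ennreal (\<bar>l\<bar> ^ (2 * n)) \<partial>lborel) = emeasure fan_aux A" ..
  qed
  then show ?thesis by (simp add: measure_of_of_measure)
qed

lemma sets_fan_nu2: "sets (fan_nu2 n) = sets (restrict_space borel (heis_fan n))"
  by (simp add: fan_nu2_eq_aux fan_aux_def)

lemma space_fan_nu2: "space (fan_nu2 n) = heis_fan n"
  by (simp add: fan_nu2_eq_aux fan_aux_def space_restrict_space)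

lemma nn_integral_fan_nu2:
  assumes "\<phi> \<in> borel_measurable (fan_nu2 n)"
  shows "(\<integral>\<^sup>+ a. \<phi> a \<partial>fan_nu2 n) = ennreal (1 / (2 * pi) ^ (2 * n + 1)) *
        (\<integral>\<^sup>+ l. (\<Sum>k. ennreal (1 / (fan_coeff n k)\<^sup>2) * \<phi> (l, (2 * real k + real n) * \<bar>l\<bar>)) *
               ennreal (\<bar>l\<bar> ^ (2 * n)) \<partial>lborel)"
  using nn_integral_fan_aux[of \<phi>] assms measurable_cong_sets[OF sets_fan_nu2 refl, of borel]
  unfolding fan_nu2_eq_aux by blast

end


section \<open>The normalized Strichartz Fourier transform\<close>

definition fan_fun :: "real \<times> real \<Rightarrow> 'n::finite heis \<Rightarrow> complex" where
  "fan_fun a x = exp (\<i> * of_real (fst a * snd x)) *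
     of_real (laguerre_fun (fan_index CARD('n) a) (fst a) (fst x))"

text \<open>On the null set \<^const>\<open>fan_ray_inf\<close> the transform is given the arbitrary value 0.\<close>

definition strichartz_fourier ::
  "('n::finite heis \<Rightarrow> complex) \<Rightarrow> real \<times> real \<Rightarrow> complex ^ 'n \<Rightarrow> complex" where
  "strichartz_fourier f a w =
     (if fst a = 0 then 0
      else of_real (fan_coeff CARD('n) (fan_index CARD('n) a)) *
        (LINT x|lborel. f x * fan_fun a (heis_mult (heis_inv x) (w, 0))))"

end

theory Submission
  imports Defs "HOL-Probability.Probability" "HOL-Complex_Analysis.Complex_Analysis"
begin

text \<open>The inequality is obtained by real interpolation for the sublinear operator sending \<open>f\<close> to
  \<open>|\<lambda>|\<^sup>n\<^sup>/\<^sup>2 \<parallel>F f(a, -)\<parallel>\<^sub>2 / \<phi>(a)\<close> with respect to the measure \<open>\<phi>\<^sup>2 d\<mu>\<close>. It is of weak type (1,1), because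
  \<open>|\<lambda>|\<^sup>n\<^sup>/\<^sup>2 \<parallel>F f(a, -)\<parallel>\<^sub>2\<close> is bounded by a multiple of \<open>\<parallel>f\<parallel>\<^sub>1\<close> (Cauchy-Schwarz and the \<open>L\<^sup>2\<close> norm of the
  Laguerre functions) and the integral of \<open>\<phi>\<^sup>2\<close> over \<open>{\<phi> < v}\<close> is at most \<open>2 v \<parallel>\<phi>\<parallel>\<^sub>1\<^sub>,\<^sub>\<infinity>\<close>. It is of strong
  type (2,2) by a Plancherel inequality. Only an inequality with some constant is needed there, which
  avoids the spectral theory of the sublaplacian: twisted convolution with the Gaussian
  \<open>\<Sum>k. r\<^sup>k \<phi>\<^sub>k\<close> is bounded on \<open>L\<^sup>2\<close>, uniformly in complex \<open>r\<close> with \<open>|r| < 1\<close>, by a \<open>T T\<^sup>*\<close> argument, and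
  Bessel's inequality on the circles \<open>|r| = \<rho>\<close> turns this into a bound for the sum over \<open>k\<close> of the
  squared \<open>L\<^sup>2\<close> norms of the twisted convolutions with \<open>\<phi>\<^sub>k\<close>.\<close>

section \<open>Integral operators and Gaussian integrals\<close>

text \<open>Truncations of a Schwartz function are not Schwartz, so both endpoint bounds are proved
  for every integrable f; Schwartz decay enters only through integrability. The normalisations fit
  together. The squared L2 norm of \<open>laguerre_fun k l\<close> is (2 pi/|l|)^n / c with c =
  \<open>fan_coeff n k\<close> <= 1, which the weight |l|^n compensates in the (1,1) bound. The
  c^(-2) in \<open>fan_nu2\<close> removes the c^2 of the squared transform, so the (2,2) bound
  concerns bare twisted convolutions. Uniformity in r rests on an exact cancellation: the Gaussian
  of parameter r has sup norm |1 - r|^(-n), yet the Schur constant of its T T-star kernel is, per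
  complex dimension, 8 pi^2 / (l^2 (1 + |r|^2)), free of 1 - r. Truncating f at height w s, with w
  the weak norm of the weight, makes both interpolation terms scale as w^(2-p), hence w^(2/p-1)
  after the p-th root. The interpolation constant contains 1/(2-p), so p = 2 is read off the (2,2)
  bound directly.\<close>

lemma borel_measurable_cnj [measurable (raw)]:
  "f \<in> borel_measurable M \<Longrightarrow> (\<lambda>x. cnj (f x)) \<in> borel_measurable M"
  by (rule measurable_compose[where N=borel]) (auto intro: borel_measurable_continuous_onI continuous_intros)

lemma borel_measurable_poly [measurable (raw)]:
  fixes p :: "real poly"
  shows "f \<in> borel_measurable M \<Longrightarrow> (\<lambda>x. poly p (f x)) \<in> borel_measurable M"
  by (rule measurable_compose[where N=borel and g="poly p"]) (auto intro!: borel_measurable_continuous_onI continuous_intros)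

text \<open>Cauchy-Schwarz with |f| split as sqrt|f| times sqrt|f|, so that the kernel is squared
  against the measure |f| dM. If f k is not integrable, the Bochner integral is 0 by convention;
  measurability is therefore enough.\<close>

lemma integral_mult_square_le:
  fixes f k :: "'a \<Rightarrow> complex"
  assumes [measurable]: "f \<in> borel_measurable M" "k \<in> borel_measurable M"
  shows "ennreal ((cmod (LINT x|M. f x * k x))\<^sup>2)
    \<le> (\<integral>\<^sup>+ x. ennreal (cmod (f x)) \<partial>M) * (\<integral>\<^sup>+ x. ennreal (cmod (f x) * (cmod (k x))\<^sup>2) \<partial>M)"
proof -
  have 1: "ennreal (cmod (LINT x|M. f x * k x)) \<le> (\<integral>\<^sup>+ x. ennreal (cmod (f x * k x)) \<partial>M)"
    by (cases "integrable M (\<lambda>x. f x * k x)")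
       (auto simp: integral_norm_bound_ennreal not_integrable_integral_eq)
  have "ennreal ((cmod (LINT x|M. f x * k x))\<^sup>2) = (ennreal (cmod (LINT x|M. f x * k x)))\<^sup>2"
    by (simp add: ennreal_power)
  also have "\<dots> \<le> (\<integral>\<^sup>+ x. ennreal (cmod (f x * k x)) \<partial>M)\<^sup>2"
    using 1 by (rule power_mono) simp
  also have "\<dots> = (\<integral>\<^sup>+ x. ennreal (sqrt (cmod (f x))) * ennreal (sqrt (cmod (f x)) * cmod (k x)) \<partial>M)\<^sup>2"
    by (intro arg_cong[where f="\<lambda>u. u\<^sup>2"] nn_integral_cong)
       (simp add: norm_mult mult.assoc[symmetric] ennreal_mult[symmetric])
  also have "\<dots> \<le> (\<integral>\<^sup>+ x. (ennreal (sqrt (cmod (f x))))\<^sup>2 \<partial>M)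
      * (\<integral>\<^sup>+ x. (ennreal (sqrt (cmod (f x)) * cmod (k x)))\<^sup>2 \<partial>M)"
    by (rule Cauchy_Schwarz_nn_integral) measurable
  also have "\<dots> = (\<integral>\<^sup>+ x. ennreal (cmod (f x)) \<partial>M) * (\<integral>\<^sup>+ x. ennreal (cmod (f x) * (cmod (k x))\<^sup>2) \<partial>M)"
    by (simp add: ennreal_power power_mult_distrib)
  finally show ?thesis .
qed

lemma (in pair_sigma_finite) integral_times_pair:
  fixes f :: "'a \<Rightarrow> complex" and g :: "'b \<Rightarrow> complex"
  assumes "integrable M1 f" "integrable M2 g"
  shows "integrable (M1 \<Otimes>\<^sub>M M2) (\<lambda>(x, y). f x * g y)"
    and "(LINT z|(M1 \<Otimes>\<^sub>M M2). (case z of (x, y) \<Rightarrow> f x * g y)) = integral\<^sup>L M1 f * integral\<^sup>L M2 g"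
proof -
  have [measurable]: "f \<in> borel_measurable M1" "g \<in> borel_measurable M2"
    using assms by auto
  show *: "integrable (M1 \<Otimes>\<^sub>M M2) (\<lambda>(x, y). f x * g y)"
  proof (rule Fubini_integrable)
    show "(\<lambda>(x, y). f x * g y) \<in> borel_measurable (M1 \<Otimes>\<^sub>M M2)"
      by measurable
    show "integrable M1 (\<lambda>x. LINT y|M2. norm (case (x, y) of (x, y) \<Rightarrow> f x * g y))"
      using assms by (simp add: norm_mult)
    show "AE x in M1. integrable M2 (\<lambda>y. case (x, y) of (x, y) \<Rightarrow> f x * g y)"
      using assms by simp
  qed
  show "(LINT z|(M1 \<Otimes>\<^sub>M M2). (case z of (x, y) \<Rightarrow> f x * g y)) = integral\<^sup>L M1 f * integral\<^sup>L M2 g"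
    using integral_fst'[OF *] by simp
qed

text \<open>The \<open>T T\<^sup>*\<close> method: the \<open>L\<^sup>2\<close> norm of \<open>T G\<close> is controlled by Schur's test applied to the kernel
  of the composition of \<open>T\<close> with its adjoint.\<close>

lemma tt_star_bound:
  fixes k :: "'a \<Rightarrow> 'b \<Rightarrow> complex"
  assumes M: "sigma_finite_measure M" and N: "sigma_finite_measure N"
    and k [measurable]: "(\<lambda>(z, w). k z w) \<in> borel_measurable (M \<Otimes>\<^sub>M N)"
    and bdd: "\<And>z w. cmod (k z w) \<le> c"
    and D: "\<And>z. (\<integral>\<^sup>+ w. ennreal (cmod (k z w)) \<partial>N) \<le> ennreal D"
    and E: "\<And>z. (\<integral>\<^sup>+ z'. ennreal (cmod (LINT w|N. k z w * cnj (k z' w))) \<partial>M) \<le> E"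
    and G: "integrable M G"
  shows "(\<integral>\<^sup>+ w. ennreal ((cmod (LINT z|M. G z * k z w))\<^sup>2) \<partial>N)
    \<le> E * (\<integral>\<^sup>+ z. ennreal ((cmod (G z))\<^sup>2) \<partial>M)"
proof -
  interpret M: sigma_finite_measure M by (rule M)
  interpret N: sigma_finite_measure N by (rule N)
  interpret MM: pair_sigma_finite M M ..
  interpret NMM: pair_sigma_finite N "M \<Otimes>\<^sub>M M"
    by (rule pair_sigma_finite.intro[OF N MM.P.sigma_finite_measure_axioms])
  have [measurable]: "G \<in> borel_measurable M" using G by auto
  have c: "c \<ge> 0" using order_trans[OF norm_ge_zero bdd] by simp
  have k1 [measurable]: "k z \<in> borel_measurable N" if "z \<in> space M" for z
    using measurable_compose[OF measurable_Pair1'[OF that] k] by simp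
  have k2 [measurable]: "(\<lambda>z. k z w) \<in> borel_measurable M" if "w \<in> space N" for w
    using measurable_compose[OF measurable_Pair2'[OF that] k] by simp
  \<comment> \<open>F is the integrand of |H w|^2 written as a double integral; integrating out w
    first leaves G z, the conjugate of G z', and the composed kernel K.\<close>
  define F where "F = (\<lambda>w (z, z'). (G z * k z w) * cnj (G z' * k z' w))"
  define K where "K = (\<lambda>z z'. LINT w|N. k z w * cnj (k z' w))"
  define H where "H = (\<lambda>w. LINT z|M. G z * k z w)"
  have F_meas [measurable]: "(\<lambda>(w, x). F w x) \<in> borel_measurable (N \<Otimes>\<^sub>M (M \<Otimes>\<^sub>M M))"
    unfolding F_def by measurable
  have K_meas [measurable]: "(\<lambda>(z, z'). K z z') \<in> borel_measurable (M \<Otimes>\<^sub>M M)"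
    unfolding K_def by measurable
  have nG: "(\<integral>\<^sup>+ z. ennreal (cmod (G z)) \<partial>M) < \<infinity>"
    using G by (simp add: integrable_iff_bounded)
  \<comment> \<open>Absolute convergence for Fubini: one kernel factor is bounded by
    \<open>c\<close>, the other is integrated by \<open>D\<close>. Neither constant reaches the
    final estimate, so in applications both may blow up with the regularisation.\<close>
  have F_int: "integrable (N \<Otimes>\<^sub>M (M \<Otimes>\<^sub>M M)) (\<lambda>(w, x). F w x)"
  proof (rule integrableI_bounded[OF F_meas])
    have "(\<integral>\<^sup>+ y. ennreal (norm (case y of (w, x) \<Rightarrow> F w x)) \<partial>(N \<Otimes>\<^sub>M (M \<Otimes>\<^sub>M M)))
        = (\<integral>\<^sup>+ x. (\<integral>\<^sup>+ w. ennreal (cmod (F w x)) \<partial>N) \<partial>(M \<Otimes>\<^sub>M M))"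
      by (subst NMM.nn_integral_snd[symmetric]) auto
    also have "\<dots> \<le> (\<integral>\<^sup>+ x. (\<integral>\<^sup>+ w. ennreal (cmod (G (fst x))) * ennreal (cmod (G (snd x))) * ennreal c
        * ennreal (cmod (k (fst x) w)) \<partial>N) \<partial>(M \<Otimes>\<^sub>M M))"
    proof (intro nn_integral_mono)
      fix x w
      have "cmod (F w x) = cmod (G (fst x)) * cmod (G (snd x)) * cmod (k (snd x) w) * cmod (k (fst x) w)"
        by (simp add: F_def norm_mult split: prod.split)
      also have "\<dots> \<le> cmod (G (fst x)) * cmod (G (snd x)) * c * cmod (k (fst x) w)"
        by (intro mult_mono bdd) (auto simp: c)
      finally show "ennreal (cmod (F w x)) \<le> ennreal (cmod (G (fst x))) * ennreal (cmod (G (snd x))) * ennreal c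
        * ennreal (cmod (k (fst x) w))"
        using c by (simp flip: ennreal_mult add: ennreal_leI)
    qed
    also have "\<dots> \<le> (\<integral>\<^sup>+ x. ennreal (cmod (G (fst x))) * ennreal (cmod (G (snd x))) * ennreal c * ennreal D \<partial>(M \<Otimes>\<^sub>M M))"
    proof (intro nn_integral_mono)
      fix x assume "x \<in> space (M \<Otimes>\<^sub>M M)"
      then have [measurable]: "k (fst x) \<in> borel_measurable N"
        by (intro k1) (auto simp: space_pair_measure)
      show "(\<integral>\<^sup>+ w. ennreal (cmod (G (fst x))) * ennreal (cmod (G (snd x))) * ennreal c
        * ennreal (cmod (k (fst x) w)) \<partial>N) \<le> ennreal (cmod (G (fst x))) * ennreal (cmod (G (snd x))) * ennreal c * ennreal D"
        by (subst nn_integral_cmult) (auto intro!: mult_left_mono D)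
    qed
    also have "\<dots> = (\<integral>\<^sup>+ z. \<integral>\<^sup>+ z'. ennreal (cmod (G z)) * ennreal (cmod (G z')) * ennreal c * ennreal D \<partial>M \<partial>M)"
      by (subst M.nn_integral_fst[symmetric]) auto
    also have "\<dots> = (\<integral>\<^sup>+ z. ennreal (cmod (G z)) \<partial>M) * (\<integral>\<^sup>+ z. ennreal (cmod (G z)) \<partial>M) * ennreal c * ennreal D"
      by (simp add: nn_integral_multc nn_integral_cmult)
    also have "\<dots> < \<infinity>"
      using nG by (simp add: ennreal_mult_less_top)
    finally show "(\<integral>\<^sup>+ y. ennreal (norm (case y of (w, x) \<Rightarrow> F w x)) \<partial>(N \<Otimes>\<^sub>M (M \<Otimes>\<^sub>M M))) < \<infinity>" .
  qed
  have HF: "complex_of_real ((cmod (H w))\<^sup>2) = (LINT x|(M \<Otimes>\<^sub>M M). F w x)" if "w \<in> space N" for w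
  proof -
    note [measurable] = k2[OF that]
    have i: "integrable M (\<lambda>z. G z * k z w)"
    proof (rule Bochner_Integration.integrable_bound)
      show "integrable M (\<lambda>z. c * cmod (G z))" using G by simp
      show "AE z in M. norm (G z * k z w) \<le> norm (c * cmod (G z))"
        using bdd c by (auto simp: norm_mult abs_mult mult.commute[of c] intro!: mult_left_mono)
    qed measurable
    have "complex_of_real ((cmod (H w))\<^sup>2) = H w * cnj (H w)"
      by (simp only: complex_norm_square)
    also have "\<dots> = (LINT z|M. G z * k z w) * (LINT z|M. cnj (G z * k z w))"
      by (simp add: H_def del: complex_cnj_mult)
    also have "\<dots> = (LINT x|(M \<Otimes>\<^sub>M M). F w x)"
      unfolding F_def using i
      by (subst MM.integral_times_pair(2)) (auto simp del: complex_cnj_mult)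
    finally show ?thesis .
  qed
  have FK: "(LINT w|N. F w x) = G (fst x) * cnj (G (snd x)) * K (fst x) (snd x)" for x
  proof -
    have "(LINT w|N. F w x) = (LINT w|N. G (fst x) * cnj (G (snd x)) * (k (fst x) w * cnj (k (snd x) w)))"
      by (simp add: F_def mult_ac case_prod_beta')
    also have "\<dots> = G (fst x) * cnj (G (snd x)) * K (fst x) (snd x)"
      unfolding K_def by (rule integral_mult_right_zero)
    finally show ?thesis .
  qed
  \<comment> \<open>Hermitian symmetry lets the one-sided hypothesis on E control both marginals in
    Schur's test.\<close>
  have K_sym: "cmod (K z z') = cmod (K z' z)" for z z'
  proof -
    have "K z z' = (LINT w|N. cnj (k z' w * cnj (k z w)))"
      by (simp add: K_def mult.commute)
    also have "\<dots> = cnj (K z' z)"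
      by (simp only: K_def Bochner_Integration.integral_cnj)
    finally show ?thesis by simp
  qed
  have H_meas [measurable]: "H \<in> borel_measurable N" unfolding H_def by measurable
  have H_int: "integrable N (\<lambda>w. complex_of_real ((cmod (H w))\<^sup>2))"
    using NMM.integrable_fst'[OF F_int] HF by (subst Bochner_Integration.integrable_cong[OF refl]) auto
  have "(\<integral>\<^sup>+ w. ennreal ((cmod (H w))\<^sup>2) \<partial>N) = ennreal (LINT w|N. (cmod (H w))\<^sup>2)"
  proof -
    have "integrable N (\<lambda>w. (cmod (H w))\<^sup>2)"
      using H_int by (simp only: complex_of_real_integrable_eq)
    from nn_integral_eq_integral[OF this] show ?thesis by simp
  qed
  also have "\<dots> = ennreal (cmod (LINT w|N. complex_of_real ((cmod (H w))\<^sup>2)))"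
    by (subst integral_complex_of_real) (simp add: norm_of_real integral_nonneg_AE del: of_real_power)
  also have "(LINT w|N. complex_of_real ((cmod (H w))\<^sup>2)) = (LINT w|N. LINT x|(M \<Otimes>\<^sub>M M). F w x)"
    by (rule Bochner_Integration.integral_cong) (auto simp: HF simp del: of_real_power)
  also have "\<dots> = (LINT x|(M \<Otimes>\<^sub>M M). LINT w|N. F w x)"
    using NMM.Fubini_integral[OF F_int] by simp
  also have "ennreal (cmod \<dots>) \<le> (\<integral>\<^sup>+ x. ennreal (cmod (LINT w|N. F w x)) \<partial>(M \<Otimes>\<^sub>M M))"
    by (rule integral_norm_bound_ennreal) (rule NMM.integrable_snd[OF F_int])
  \<comment> \<open>From 2ab <= a^2 + b^2 applied to |G z| and |G z'|: the two resulting terms are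
    exchanged by swapping the variables, and each is at most E times the squared L2 norm of
    G.\<close>
  also have "\<dots> \<le> (\<integral>\<^sup>+ x. ennreal (1/2) * (ennreal ((cmod (G (fst x)))\<^sup>2) * ennreal (cmod (K (fst x) (snd x)))
       + ennreal ((cmod (G (snd x)))\<^sup>2) * ennreal (cmod (K (snd x) (fst x)))) \<partial>(M \<Otimes>\<^sub>M M))"
  proof (intro nn_integral_mono)
    fix x
    have "cmod (LINT w|N. F w x) = (cmod (G (fst x)) * cmod (G (snd x))) * cmod (K (fst x) (snd x))"
      by (simp add: FK norm_mult)
    also have "\<dots> \<le> 1/2 * ((cmod (G (fst x)))\<^sup>2 + (cmod (G (snd x)))\<^sup>2) * cmod (K (fst x) (snd x))"
      using sum_squares_bound[of "cmod (G (fst x))" "cmod (G (snd x))"] by (intro mult_right_mono) auto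
    also have "\<dots> = 1/2 * ((cmod (G (fst x)))\<^sup>2 * cmod (K (fst x) (snd x)) + (cmod (G (snd x)))\<^sup>2 * cmod (K (snd x) (fst x)))"
      by (simp add: K_sym[of "snd x" "fst x"] algebra_simps)
    finally have "ennreal (cmod (LINT w|N. F w x)) \<le> ennreal \<dots>"
      by (rule ennreal_leI)
    then show "ennreal (cmod (LINT w|N. F w x)) \<le> ennreal (1/2) * (ennreal ((cmod (G (fst x)))\<^sup>2) * ennreal (cmod (K (fst x) (snd x)))
       + ennreal ((cmod (G (snd x)))\<^sup>2) * ennreal (cmod (K (snd x) (fst x))))"
      by (simp only: ennreal_mult' ennreal_plus zero_le_power2 norm_ge_zero mult_nonneg_nonneg
          zero_le_divide_1_iff zero_le_numeral)
  qed
  also have "\<dots> = ennreal (1/2) * ((\<integral>\<^sup>+ x. ennreal ((cmod (G (fst x)))\<^sup>2) * ennreal (cmod (K (fst x) (snd x))) \<partial>(M \<Otimes>\<^sub>M M))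
       + (\<integral>\<^sup>+ x. ennreal ((cmod (G (snd x)))\<^sup>2) * ennreal (cmod (K (snd x) (fst x))) \<partial>(M \<Otimes>\<^sub>M M)))"
  proof -
    have [measurable]: "(\<lambda>x. K (fst x) (snd x)) \<in> borel_measurable (M \<Otimes>\<^sub>M M)"
      using K_meas by (simp add: case_prod_beta')
    have [measurable]: "(\<lambda>x. K (snd x) (fst x)) \<in> borel_measurable (M \<Otimes>\<^sub>M M)"
      using measurable_compose[OF measurable_pair_swap' K_meas] by (simp add: case_prod_beta')
    show ?thesis by (subst nn_integral_cmult, measurable) (subst nn_integral_add, auto)
  qed
  also have "(\<integral>\<^sup>+ x. ennreal ((cmod (G (fst x)))\<^sup>2) * ennreal (cmod (K (fst x) (snd x))) \<partial>(M \<Otimes>\<^sub>M M))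
      = (\<integral>\<^sup>+ z. \<integral>\<^sup>+ z'. ennreal ((cmod (G z))\<^sup>2) * ennreal (cmod (K z z')) \<partial>M \<partial>M)"
    using K_meas by (subst M.nn_integral_fst[symmetric]) (auto simp: case_prod_beta')
  also have "(\<integral>\<^sup>+ x. ennreal ((cmod (G (snd x)))\<^sup>2) * ennreal (cmod (K (snd x) (fst x))) \<partial>(M \<Otimes>\<^sub>M M))
      = (\<integral>\<^sup>+ z. \<integral>\<^sup>+ z'. ennreal ((cmod (G z))\<^sup>2) * ennreal (cmod (K z z')) \<partial>M \<partial>M)"
    using measurable_compose[OF measurable_pair_swap' K_meas]
    by (subst MM.nn_integral_snd[symmetric]) (auto simp: case_prod_beta')
  also have "(\<integral>\<^sup>+ z. \<integral>\<^sup>+ z'. ennreal ((cmod (G z))\<^sup>2) * ennreal (cmod (K z z')) \<partial>M \<partial>M)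
     \<le> (\<integral>\<^sup>+ z. ennreal ((cmod (G z))\<^sup>2) * E \<partial>M)"
  proof (intro nn_integral_mono)
    fix z assume "z \<in> space M"
    then have [measurable]: "K z \<in> borel_measurable M"
      using measurable_compose[OF measurable_Pair1' K_meas] by simp
    have "(\<integral>\<^sup>+ z'. ennreal (cmod (K z z')) \<partial>M) \<le> E"
      using E[of z] by (simp only: K_def)
    then show "(\<integral>\<^sup>+ z'. ennreal ((cmod (G z))\<^sup>2) * ennreal (cmod (K z z')) \<partial>M) \<le> ennreal ((cmod (G z))\<^sup>2) * E"
      by (subst nn_integral_cmult) (auto intro!: mult_left_mono)
  qed
  also have "(\<integral>\<^sup>+ z. ennreal ((cmod (G z))\<^sup>2) * E \<partial>M) = E * (\<integral>\<^sup>+ z. ennreal ((cmod (G z))\<^sup>2) \<partial>M)"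
    by (subst nn_integral_multc) (auto simp: mult.commute)
  also have "ennreal (1/2) * (E * (\<integral>\<^sup>+ z. ennreal ((cmod (G z))\<^sup>2) \<partial>M) + E * (\<integral>\<^sup>+ z. ennreal ((cmod (G z))\<^sup>2) \<partial>M))
     = E * (\<integral>\<^sup>+ z. ennreal ((cmod (G z))\<^sup>2) \<partial>M)"
    (is "_ * (?x + ?x) = ?x")
  proof -
    have "ennreal (1/2) * (?x + ?x) = (ennreal (1/2) * 2) * ?x"
      by (simp only: mult_2 mult.assoc)
    also have "ennreal (1/2) * 2 = 1"
      by (metis ennreal_1 ennreal_mult'' ennreal_numeral mult.commute nonzero_eq_divide_eq zero_le_numeral zero_neq_numeral)
    finally show ?thesis by simp
  qed
  finally show ?thesis unfolding H_def by (simp add: mult_left_mono add_mono)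
qed

section \<open>Gaussian integrals and their Fourier transforms\<close>

lemma lborel_prod_Basis:
  fixes f :: "'a::euclidean_space \<Rightarrow> real \<Rightarrow> complex"
  assumes f: "\<And>b. b \<in> Basis \<Longrightarrow> integrable lborel (f b)"
  shows "integrable lborel (\<lambda>x::'a. \<Prod>b\<in>Basis. f b (x \<bullet> b))"
    and "(LINT x|lborel. (\<Prod>b\<in>Basis. f b (x \<bullet> b))) = (\<Prod>b\<in>Basis. LINT x|lborel. f b x)"
proof -
  interpret product_sigma_finite "\<lambda>b::'a. lborel :: real measure"
    by unfold_locales
  have [measurable]: "f b \<in> borel_measurable borel" if "b \<in> Basis" for b
    using f[OF that] by (simp add: borel_measurable_integrable)
  have m: "(\<lambda>x::'a. \<Prod>b\<in>Basis. f b (x \<bullet> b)) \<in> borel_measurable borel" by measurable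
  have e: "(\<lambda>x. \<Prod>b\<in>Basis. f b ((\<Sum>b\<in>Basis. x b *\<^sub>R b) \<bullet> b)) = (\<lambda>x. \<Prod>b\<in>Basis. f b (x b))"
    by (intro ext prod.cong refl) (simp add: inner_sum_left_Basis)
  have t: "(\<lambda>f. \<Sum>b\<in>Basis. f b *\<^sub>R b) \<in> (\<Pi>\<^sub>M b\<in>(Basis::'a set). lborel) \<rightarrow>\<^sub>M borel"
    by measurable
  show "integrable lborel (\<lambda>x::'a. \<Prod>b\<in>Basis. f b (x \<bullet> b))"
    unfolding lborel_eq[where 'a='a] by (subst integrable_distr_eq[OF t m]) (simp add: e product_integrable_prod f)
  show "(LINT x|lborel. (\<Prod>b\<in>Basis. f b (x \<bullet> b))) = (\<Prod>b\<in>Basis. LINT x|lborel. f b x)"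
    unfolding lborel_eq[where 'a='a] by (subst integral_distr[OF t m]) (simp add: e product_integral_prod f)
qed

text \<open>Rescaling x by sqrt(2b) turns the Gaussian into a multiple of the standard normal
  density, whose characteristic function is known.\<close>

lemma gaussian_fourier_real:
  fixes b \<xi> :: real
  assumes b: "b > 0"
  shows "integrable lborel (\<lambda>x. complex_of_real (exp (- b * x\<^sup>2)) * iexp (\<xi> * x))"
    and "(LINT x|lborel. complex_of_real (exp (- b * x\<^sup>2)) * iexp (\<xi> * x))
           = complex_of_real (sqrt (pi / b) * exp (- \<xi>\<^sup>2 / (4 * b)))"
proof -
  define c where "c = sqrt (2 * b)"
  have c: "c > 0" "c\<^sup>2 = 2 * b" using b by (auto simp: c_def)
  let ?f = "\<lambda>x. complex_of_real (exp (- b * x\<^sup>2)) * iexp (\<xi> * x)"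
  let ?g = "\<lambda>x. complex_of_real (std_normal_density x) * iexp (\<xi> / c * x)"
  have g: "integrable lborel ?g" "(LINT x|lborel. ?g x) = complex_of_real (exp (- (\<xi> / c)\<^sup>2 / 2))"
  proof -
    interpret real_distribution std_normal_distribution by (rule real_dist_normal_dist)
    have "integrable std_normal_distribution (\<lambda>x. iexp (\<xi> / c * x))"
      by (rule integrable_iexp) auto
    then show "integrable lborel ?g"
      by (subst (asm) integrable_density) (auto simp: scaleR_conv_of_real)
    have "char std_normal_distribution (\<xi> / c) = complex_of_real (exp (- (\<xi> / c)\<^sup>2 / 2))"
      by (simp add: char_std_normal_distribution)
    also have "char std_normal_distribution (\<xi> / c) = (LINT x|lborel. ?g x)"
      unfolding char_def by (subst integral_density) (auto simp: scaleR_conv_of_real)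
    finally show "(LINT x|lborel. ?g x) = complex_of_real (exp (- (\<xi> / c)\<^sup>2 / 2))" .
  qed
  have fg: "?f = (\<lambda>x. complex_of_real (sqrt (2 * pi)) * ?g (0 + c * x))"
    using c by (intro ext) (simp add: std_normal_density_def power_mult_distrib)
  show "integrable lborel ?f"
    unfolding fg using c by (intro integrable_mult_right lborel_integrable_real_affine g) auto
  have "(LINT x|lborel. ?f x) = complex_of_real (sqrt (2 * pi)) * (LINT x|lborel. ?g (0 + c * x))"
    unfolding fg by (rule integral_mult_right_zero)
  also have "(LINT x|lborel. ?g (0 + c * x)) = complex_of_real (1 / c) * (LINT x|lborel. ?g x)"
    using c lborel_integral_real_affine[of c ?g 0] by (simp add: scaleR_conv_of_real)
  also have "complex_of_real (sqrt (2 * pi)) * (complex_of_real (1 / c) * (LINT x|lborel. ?g x))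
     = complex_of_real (sqrt (2 * pi) / c * exp (- (\<xi> / c)\<^sup>2 / 2))"
    unfolding g(2) by simp
  also have "sqrt (2 * pi) / c = sqrt (pi / b)"
    by (simp add: c_def real_sqrt_divide[symmetric])
  also have "- (\<xi> / c)\<^sup>2 / 2 = - \<xi>\<^sup>2 / (4 * b)"
    using c by (simp add: power_divide)
  finally show "(LINT x|lborel. ?f x) = complex_of_real (sqrt (pi / b) * exp (- \<xi>\<^sup>2 / (4 * b)))" .
qed

text \<open>The squared norm and the inner product are sums over coordinates, so the integrand is a
  product of one-dimensional ones.\<close>

lemma gaussian_fourier:
  fixes \<xi> :: "'a::euclidean_space" and b :: real
  assumes b: "b > 0"
  shows "integrable lborel (\<lambda>x::'a. complex_of_real (exp (- b * (norm x)\<^sup>2)) * iexp (\<xi> \<bullet> x))"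
    and "(LINT x|lborel. complex_of_real (exp (- b * (norm (x::'a))\<^sup>2)) * iexp (\<xi> \<bullet> x))
           = complex_of_real (sqrt (pi / b) ^ DIM('a) * exp (- (norm \<xi>)\<^sup>2 / (4 * b)))"
proof -
  have norm: "(norm x)\<^sup>2 = (\<Sum>i\<in>Basis. (x \<bullet> i)\<^sup>2)" for x :: 'a
    unfolding power2_norm_eq_inner by (subst euclidean_inner) (simp add: power2_eq_square)
  have e: "complex_of_real (exp (- b * (norm x)\<^sup>2)) * iexp (\<xi> \<bullet> x)
     = (\<Prod>i\<in>Basis. complex_of_real (exp (- b * (x \<bullet> i)\<^sup>2)) * iexp ((\<xi> \<bullet> i) * (x \<bullet> i)))" for x :: 'a
    by (simp add: norm prod.distrib exp_sum[symmetric] sum_distrib_left euclidean_inner[of \<xi> x]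
        flip: of_real_prod)
  note P = lborel_prod_Basis[of "\<lambda>i x. complex_of_real (exp (- b * x\<^sup>2)) * iexp ((\<xi> \<bullet> i) * x)",
      OF gaussian_fourier_real(1)[OF b]]
  show "integrable lborel (\<lambda>x::'a. complex_of_real (exp (- b * (norm x)\<^sup>2)) * iexp (\<xi> \<bullet> x))"
    unfolding e by (rule P(1))
  show "(LINT x|lborel. complex_of_real (exp (- b * (norm (x::'a))\<^sup>2)) * iexp (\<xi> \<bullet> x))
           = complex_of_real (sqrt (pi / b) ^ DIM('a) * exp (- (norm \<xi>)\<^sup>2 / (4 * b)))"
    unfolding e P(2) gaussian_fourier_real(2)[OF b]
    by (simp add: norm prod.distrib exp_sum[symmetric] sum_divide_distrib sum_negf flip: of_real_prod)
qed

lemma gaussian_integral: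
  fixes c :: "'a::euclidean_space" and b :: real
  assumes b: "b > 0"
  shows "(\<integral>\<^sup>+ x. ennreal (exp (- b * (norm (x - c))\<^sup>2)) \<partial>lborel) = ennreal (sqrt (pi / b) ^ DIM('a))"
proof -
  have "(\<integral>\<^sup>+ x. ennreal (exp (- b * (norm (x - c))\<^sup>2)) \<partial>lborel)
      = (\<integral>\<^sup>+ x. ennreal (exp (- b * (norm (x::'a))\<^sup>2)) \<partial>lborel)"
    by (subst lborel_distr_plus[of "c", symmetric]) (simp add: nn_integral_distr)
  also have "\<dots> = ennreal (LINT x|lborel. exp (- b * (norm (x::'a))\<^sup>2))"
    using gaussian_fourier(1)[OF b, of 0]
    by (intro nn_integral_eq_integral) (simp_all add: complex_of_real_integrable_eq)
  also have "(LINT x|lborel. exp (- b * (norm (x::'a))\<^sup>2)) = sqrt (pi / b) ^ DIM('a)"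
  proof -
    have "complex_of_real (LINT x|lborel. exp (- b * (norm (x::'a))\<^sup>2)) = complex_of_real (sqrt (pi / b) ^ DIM('a))"
      using gaussian_fourier(2)[OF b, of 0] unfolding integral_complex_of_real[symmetric] by simp
    then show ?thesis using of_real_eq_iff by blast
  qed
  finally show ?thesis .
qed

section \<open>Laguerre polynomials\<close>

text \<open>On functions of the form \<open>exp (- s) * q s\<close> differentiation acts as \<open>q \<mapsto> pderiv q - q\<close>.\<close>

definition exp_deriv :: "real poly \<Rightarrow> real poly" where
  "exp_deriv q = pderiv q - q"

lemma higher_deriv_exp_minus_poly:
  "(deriv ^^ k) (\<lambda>s. exp (- s) * poly q s) = (\<lambda>s. exp (- s) * poly ((exp_deriv ^^ k) q) s)"
  by (induction k) (simp_all add: deriv_exp_minus_poly exp_deriv_def)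

lemma exp_deriv_monom_Suc:
  "exp_deriv (monom c (Suc m)) = monom (c * real (Suc m)) m - monom c (Suc m)"
  by (simp add: exp_deriv_def pderiv_monom mult.commute)

lemma exp_deriv_sum: "exp_deriv (\<Sum>i\<in>A. f i) = (\<Sum>i\<in>A. exp_deriv (f i))"
  by (induction A rule: infinite_finite_induct) (simp_all add: exp_deriv_def pderiv_add)

lemma smult_sum_right: "smult c (\<Sum>i\<in>A. f i) = (\<Sum>i\<in>A. smult c (f i))"
  by (induction A rule: infinite_finite_induct) (simp_all add: smult_add_right)

text \<open>Binomial expansion of (D - 1)^k, as D commutes with the identity: the i-th term takes -1
  from i factors and differentiates the monomial k - i times.\<close>

lemma exp_deriv_power_monom:
  assumes "k \<le> N"
  shows "(exp_deriv ^^ k) (monom 1 N)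
     = (\<Sum>i\<le>k. monom ((-1) ^ i * real (k choose i) * fact N / fact (N - k + i)) (N - k + i))"
  using assms
proof (induction k)
  case 0
  then show ?case by simp
next
  case (Suc k)
  define m where "m = N - Suc k"
  have m: "N - k = Suc m" using Suc.prems by (simp add: m_def)
  let ?a = "\<lambda>k i. (-1) ^ i * real (k choose i) * fact N / fact (m + i)"
  have "(exp_deriv ^^ Suc k) (monom 1 N)
      = (\<Sum>i\<le>k. exp_deriv (monom ((-1) ^ i * real (k choose i) * fact N / fact (Suc (m + i))) (Suc (m + i))))"
    using Suc by (simp add: m exp_deriv_sum)
  also have "\<dots> = (\<Sum>i\<le>k. monom (?a k i) (m + i)) 
      - (\<Sum>i\<le>k. monom ((-1) ^ i * real (k choose i) * fact N / fact (m + Suc i)) (m + Suc i))"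
    unfolding exp_deriv_monom_Suc sum_subtractf by (simp del: of_nat_Suc)
  also have "(\<Sum>i\<le>k. monom (?a k i) (m + i)) = (\<Sum>i\<le>Suc k. monom (?a k i) (m + i))"
    by simp
  also have "\<dots> = monom (?a k 0) m + (\<Sum>i\<le>k. monom (?a k (Suc i)) (m + Suc i))"
    by (subst sum.atMost_Suc_shift) simp
  \<comment> \<open>Pascal's rule merges the coefficients of the two shifted sums.\<close>
  also have "\<dots> - (\<Sum>i\<le>k. monom ((-1) ^ i * real (k choose i) * fact N / fact (m + Suc i)) (m + Suc i))
     = monom (?a (Suc k) 0) m + (\<Sum>i\<le>k. monom (?a (Suc k) (Suc i)) (m + Suc i))"
    unfolding add_diff_eq[symmetric] sum_subtractf[symmetric] diff_monom
    by (intro arg_cong2[where f="(+)"] sum.cong refl arg_cong2[where f=monom])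
       (simp_all add: field_simps del: fact_Suc)
  also have "\<dots> = (\<Sum>i\<le>Suc k. monom (?a (Suc k) i) (m + i))"
    by (subst sum.atMost_Suc_shift) simp
  finally show ?case by (simp only: m_def)
qed

text \<open>This is Rodrigues' formula with the negative power of t cleared, hence an identity
  between polynomials that can be compared coefficientwise.\<close>

lemma monom_mult_laguerre_sum:
  "monom 1 \<delta> * (\<Sum>i\<le>k. monom ((-1) ^ i * real ((k + \<delta>) choose (k - i)) / fact i) i)
    = smult (1 / fact k) ((exp_deriv ^^ k) (monom 1 (k + \<delta>)))"
    (is "_ * ?P = _")
proof -
  have "(-1) ^ i * real ((k + \<delta>) choose (k - i)) / fact i
      = 1 / fact k * ((-1) ^ i * real (k choose i) * fact (k + \<delta>) / fact (\<delta> + i))" if "i \<le> k" for i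
    using that by (simp add: binomial_fact field_simps)
  then have "?P = (\<Sum>i\<le>k. monom (1 / fact k * ((-1) ^ i * real (k choose i) * fact (k + \<delta>) / fact (\<delta> + i))) i)"
    by (intro sum.cong) auto
  then show ?thesis
    by (simp add: exp_deriv_power_monom sum_distrib_left mult_monom smult_sum_right smult_monom)
qed

text \<open>Rodrigues' formula gives the values for t > 0 only, but two polynomials that agree on an
  infinite set are equal.\<close>

lemma laguerre_eq_sum:
  "laguerre \<delta> k = (\<Sum>i\<le>k. monom ((-1) ^ i * real ((k + \<delta>) choose (k - i)) / fact i) i)"
    (is "_ = ?P")
proof -
  have "poly (laguerre \<delta> k) t = poly ?P t" if "t > 0" for t
  proof -
    have "(deriv ^^ k) (\<lambda>s. exp (- s) * s ^ (k + \<delta>)) t = exp (- t) * poly ((exp_deriv ^^ k) (monom 1 (k + \<delta>))) t"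
      using higher_deriv_exp_minus_poly[of k "monom 1 (k + \<delta>)"] by (simp add: poly_monom)
    moreover have "t ^ \<delta> * poly ?P t = 1 / fact k * poly ((exp_deriv ^^ k) (monom 1 (k + \<delta>))) t"
      using arg_cong[OF monom_mult_laguerre_sum, of "\<lambda>p. poly p t"] by (simp only: poly_mult poly_smult poly_monom mult_1)
    ultimately show ?thesis
      using that by (simp add: laguerre_rodrigues exp_minus field_simps)
  qed
  then have "{0<..} \<subseteq> {t. poly (laguerre \<delta> k - ?P) t = 0}" by auto
  then have "infinite {t. poly (laguerre \<delta> k - ?P) t = 0}"
    using infinite_Ioi finite_subset by blast
  then show ?thesis using poly_roots_finite[of "laguerre \<delta> k - ?P"] by auto
qed

lemma monom_mult_laguerre:
  "monom 1 \<delta> * laguerre \<delta> k = smult (1 / fact k) ((exp_deriv ^^ k) (monom 1 (k + \<delta>)))"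
  unfolding laguerre_eq_sum by (rule monom_mult_laguerre_sum)

section \<open>The L2 norm of the Laguerre functions\<close>

text \<open>The functional \<open>q \<mapsto> \<integral>\<^sub>0\<^sup>\<infinity> q(x) exp(-x) dx\<close>, in terms of coefficients.\<close>

definition exp_fnl :: "real poly \<Rightarrow> real" where
  "exp_fnl q = (\<Sum>i\<le>degree q. coeff q i * fact i)"

lemma exp_fnl_eq: "degree q \<le> d \<Longrightarrow> exp_fnl q = (\<Sum>i\<le>d. coeff q i * fact i)"
  unfolding exp_fnl_def by (rule sum.mono_neutral_left) (auto simp: coeff_eq_0 not_le)

lemma exp_fnl_add: "exp_fnl (p + q) = exp_fnl p + exp_fnl q"
proof -
  define d where "d = max (degree p) (degree q)"
  have "degree p \<le> d" "degree q \<le> d" "degree (p + q) \<le> d"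
    using degree_add_le_max[of p q] by (auto simp: d_def)
  then show ?thesis by (simp add: exp_fnl_eq[of _ d] sum.distrib algebra_simps)
qed

lemma exp_fnl_smult: "exp_fnl (smult c p) = c * exp_fnl p"
proof -
  have "exp_fnl (smult c p) = (\<Sum>i\<le>degree p. coeff (smult c p) i * fact i)"
    by (rule exp_fnl_eq) (rule degree_smult_le)
  then show ?thesis by (simp add: exp_fnl_def sum_distrib_left mult_ac)
qed

lemma exp_fnl_diff: "exp_fnl (p - q) = exp_fnl p - exp_fnl q"
  using exp_fnl_add[of p "smult (-1) q"] exp_fnl_smult[of "-1" q] by simp

lemma exp_fnl_exp_deriv: "exp_fnl (exp_deriv q) = - coeff q 0"
proof -
  define d where "d = degree q"
  have "exp_fnl (pderiv q) = (\<Sum>i\<le>d. coeff (pderiv q) i * fact i)"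
    by (rule exp_fnl_eq) (simp add: d_def degree_pderiv)
  also have "\<dots> = (\<Sum>i\<le>d. coeff q (Suc i) * fact (Suc i))"
    by (simp add: coeff_pderiv mult_ac)
  also have "\<dots> = (\<Sum>i\<le>Suc d. coeff q i * fact i) - coeff q 0"
    by (subst sum.atMost_Suc_shift) simp
  also have "(\<Sum>i\<le>Suc d. coeff q i * fact i) = exp_fnl q"
    by (rule exp_fnl_eq[symmetric]) (simp add: d_def)
  finally show ?thesis by (simp add: exp_deriv_def exp_fnl_diff)
qed

text \<open>Integration by parts against exp(-x) on the half line: \<open>exp_deriv v\<close> is the
  factor that appears when exp(-x) v is differentiated, and the boundary term lives at 0
  only.\<close>

lemma exp_fnl_by_parts:
  "exp_fnl (u * exp_deriv v) = - exp_fnl (pderiv u * v) - coeff u 0 * coeff v 0"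
proof -
  have "u * exp_deriv v = exp_deriv (u * v) - pderiv u * v"
    by (simp add: exp_deriv_def pderiv_mult algebra_simps)
  then show ?thesis by (simp add: exp_fnl_diff exp_fnl_exp_deriv coeff_mult_0)
qed

text \<open>No boundary term survives: before each of the k integrations the polynomial obtained
  from x^N has been differentiated fewer than N times and is still divisible by x.\<close>

lemma exp_fnl_by_parts_iterated:
  assumes "k \<le> N"
  shows "exp_fnl (u * (exp_deriv ^^ k) (monom 1 N)) = (-1) ^ k * exp_fnl ((pderiv ^^ k) u * monom 1 N)"
  using assms
proof (induction k arbitrary: u)
  case (Suc k)
  have "coeff ((exp_deriv ^^ k) (monom 1 N)) 0 = 0"
    using Suc.prems by (simp add: exp_deriv_power_monom coeff_sum)
  then have "exp_fnl (u * (exp_deriv ^^ Suc k) (monom 1 N)) = - exp_fnl (pderiv u * (exp_deriv ^^ k) (monom 1 N))"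
    by (simp add: exp_fnl_by_parts)
  also have "\<dots> = (-1) ^ Suc k * exp_fnl ((pderiv ^^ k) (pderiv u) * monom 1 N)"
    using Suc by simp
  finally show ?case by (simp add: funpow_swap1)
qed simp

lemma higher_pderiv_top:
  assumes "degree u \<le> k"
  shows "(pderiv ^^ k) u = [:fact k * coeff u k:]"
  using assms
proof (induction k arbitrary: u)
  case 0
  then show ?case by (metis degree_0_id funpow_0 fact_0 le_zero_eq mult_1)
next
  case (Suc k)
  have "degree (pderiv u) \<le> k" using Suc.prems by (simp add: degree_pderiv)
  from Suc.IH[OF this] show ?case
    by (simp add: funpow_Suc_right coeff_pderiv mult_ac del: funpow.simps)
qed

text \<open>Replace one factor by Rodrigues' formula and integrate by parts k times. The k-th
  derivative of the other factor is the constant (-1)^k, whose sign cancels that of the integrations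
  by parts, leaving a Gamma integral.\<close>

lemma exp_fnl_laguerre_square:
  "exp_fnl (monom 1 \<delta> * laguerre \<delta> k ^ 2) = fact (k + \<delta>) / fact k"
proof -
  have deg: "degree (laguerre \<delta> k) \<le> k"
    unfolding laguerre_eq_sum by (rule degree_sum_le) (auto intro: order_trans[OF degree_monom_le])
  have lead: "coeff (laguerre \<delta> k) k = (-1) ^ k / fact k"
    unfolding laguerre_eq_sum by (simp add: coeff_sum)
  have "exp_fnl (monom 1 \<delta> * laguerre \<delta> k ^ 2) = exp_fnl (laguerre \<delta> k * (monom 1 \<delta> * laguerre \<delta> k))"
    by (simp add: power2_eq_square mult_ac)
  also have "\<dots> = 1 / fact k * exp_fnl (laguerre \<delta> k * (exp_deriv ^^ k) (monom 1 (k + \<delta>)))"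
    unfolding monom_mult_laguerre by (simp add: exp_fnl_smult)
  also have "\<dots> = 1 / fact k * exp_fnl (monom 1 (k + \<delta>))"
    by (subst exp_fnl_by_parts_iterated) (simp_all add: higher_pderiv_top[OF deg] lead exp_fnl_smult flip: power_mult_distrib)
  also have "exp_fnl (monom 1 (k + \<delta>)) = fact (k + \<delta>)"
    by (simp add: exp_fnl_def degree_monom_eq if_distrib[of "\<lambda>x. x * _"] cong: if_cong)
  finally show ?thesis by simp
qed

lemma has_bochner_integral_exp_fnl:
  "has_bochner_integral lborel (\<lambda>x. poly q x * exp (- x) * indicator {0..} x) (exp_fnl q)"
proof -
  have "has_bochner_integral lborel
     (\<lambda>x. \<Sum>i\<le>degree q. coeff q i * (x ^ i * exp (- x) * indicator {0..} x)) (\<Sum>i\<le>degree q. coeff q i * fact i)"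
    by (intro has_bochner_integral_sum has_bochner_integral_mult_right has_bochner_integral_I0i_power_exp_m')
  then show ?thesis
    by (simp add: exp_fnl_def poly_altdef sum_distrib_left sum_distrib_right mult_ac)
qed

text \<open>Polar coordinates without angular variables: only functions of |z|^2 have to be
  integrated, and the law of |z|^2 is determined on the half lines \<open>{..x}\<close> by the
  volume pi^n x^n / n! of a ball of radius sqrt x in real dimension 2n; its derivative is the
  density.\<close>

lemma distr_norm_square:
  fixes n :: nat
  assumes n: "DIM('a::euclidean_space) = 2 * n"
  shows "distr lborel borel (\<lambda>z::'a. (norm z)\<^sup>2)
    = density lborel (\<lambda>x. ennreal (pi ^ n / fact (n - 1) * x ^ (n - 1)) * indicator {0..} x)"
    (is "?A = ?B")
proof (rule measure_eqI_generator_eq[where E="range atMost" and \<Omega>=UNIV and A="\<lambda>i. {..real i}"])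
  have n0: "n > 0" using n DIM_positive[where 'a='a] by simp
  have A: "emeasure ?A {..x} = (if x < 0 then 0 else ennreal (pi ^ n / fact n * x ^ n))" for x
  proof -
    have "emeasure ?A {..x} = emeasure lborel {z::'a. (norm z)\<^sup>2 \<le> x}"
      by (subst emeasure_distr) (auto intro!: arg_cong[where f="emeasure lborel"])
    also have "\<dots> = (if x < 0 then 0 else ennreal (pi ^ n / fact n * x ^ n))"
    proof (cases "x < 0")
      case True
      then have "{z::'a. (norm z)\<^sup>2 \<le> x} = {}"
        using order_trans[OF zero_le_power2] by force
      then show ?thesis using True by simp
    next
      case False
      then have "{z::'a. (norm z)\<^sup>2 \<le> x} = cball 0 (sqrt x)"
        by (auto simp: real_le_rsqrt sqrt_ge_absD dest: real_le_rsqrt)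
      then have "emeasure lborel {z::'a. (norm z)\<^sup>2 \<le> x} = ennreal (pi ^ n / fact n * sqrt x ^ (2 * n))"
        using False by (simp only: emeasure_cball real_sqrt_ge_zero not_less n unit_ball_vol_even)
      then show ?thesis using False by (simp add: power_mult)
    qed
    finally show ?thesis .
  qed
  show "emeasure ?A X = emeasure ?B X" if X: "X \<in> range atMost" for X
  proof -
    from X obtain x where x: "X = {..x}" by auto
    have "emeasure ?B X = (\<integral>\<^sup>+ t. ennreal (pi ^ n / fact (n - 1) * t ^ (n - 1)) * indicator {0..x} t \<partial>lborel)"
      unfolding x by (subst emeasure_density) (auto intro!: nn_integral_cong split: split_indicator)
    also have "\<dots> = (if x < 0 then 0 else ennreal (pi ^ n / fact n * x ^ n))"
    proof (cases "x < 0")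
      case False
      have "((\<lambda>t. pi ^ n / fact n * t ^ n) has_real_derivative pi ^ n / fact (n - 1) * t ^ (n - 1)) (at t)" for t :: real
      proof -
        have "real n / fact n = 1 / fact (n - 1)"
        proof -
          have "real n \<noteq> 0" using n0 by simp
          then show ?thesis unfolding fact_reduce[OF n0] by (rule nonzero_divide_mult_cancel_left)
        qed
        then have "pi ^ n / fact n * (real n * t ^ (n - 1)) = pi ^ n / fact (n - 1) * t ^ (n - 1)"
          by (metis (no_types, opaque_lifting) mult.assoc mult.commute times_divide_eq_left times_divide_eq_right mult_1)
        moreover have "((\<lambda>t. pi ^ n / fact n * t ^ n) has_real_derivative pi ^ n / fact n * (real n * t ^ (n - 1))) (at t)"
          by (auto intro!: derivative_eq_intros)
        ultimately show ?thesis by simp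
      qed
      then have "(\<integral>\<^sup>+ t. ennreal (pi ^ n / fact (n - 1) * t ^ (n - 1)) * indicator {0..x} t \<partial>lborel)
         = ennreal (pi ^ n / fact n * x ^ n - pi ^ n / fact n * 0 ^ n)"
        using False by (intro nn_integral_FTC_Icc) auto
      then show ?thesis using False n0 by (simp add: power_0_left)
    qed simp
    finally show ?thesis by (simp add: x A)
  qed
  show "emeasure ?A {..real i} \<noteq> \<infinity>" for i using A by simp
  show "sets ?A = sigma_sets UNIV (range atMost)"
    unfolding sets_distr by (subst borel_eq_atMost) simp
  show "sets ?B = sigma_sets UNIV (range atMost)"
    unfolding sets_density sets_lborel by (subst borel_eq_atMost) simp
  show "(\<Union>i. {..real i}) = UNIV" using real_arch_simple by auto
qed (auto simp: Int_stable_def)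

text \<open>With x = |l| |z|^2 / 2 the Gaussian factors combine to exp(-x) and the density of |z|^2
  supplies x^(n-1), which is exactly the orthogonality weight of Laguerre polynomials of type n -
  1.\<close>

lemma nn_integral_laguerre_fun_square:
  assumes l: "l \<noteq> 0"
  shows "(\<integral>\<^sup>+ z. ennreal ((laguerre_fun k l (z :: complex ^ 'n::finite))\<^sup>2) \<partial>lborel)
     = ennreal ((2 * pi / \<bar>l\<bar>) ^ CARD('n) / fan_coeff CARD('n) k)"
proof -
  define n where "n = CARD('n)"
  have n0: "n > 0" by (simp add: n_def)
  define L where "L = laguerre (n - 1) k"
  define c where "c = \<bar>l\<bar> / 2"
  have c: "c > 0" using l by (simp add: c_def)
  let ?q = "monom 1 (n - 1) * L ^ 2"
  have "(\<integral>\<^sup>+ z. ennreal ((laguerre_fun k l (z :: complex ^ 'n))\<^sup>2) \<partial>lborel)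
      = (\<integral>\<^sup>+ z. ennreal ((poly L (c * (norm (z :: complex ^ 'n))\<^sup>2))\<^sup>2 * exp (- (c * (norm z)\<^sup>2))) \<partial>lborel)"
    by (intro nn_integral_cong)
       (simp add: laguerre_fun_def L_def n_def c_def power_mult_distrib flip: exp_double)
  also have "\<dots> = (\<integral>\<^sup>+ x. ennreal ((poly L (c * x))\<^sup>2 * exp (- (c * x))) \<partial>distr lborel borel (\<lambda>z::complex ^ 'n. (norm z)\<^sup>2))"
    by (subst nn_integral_distr) auto
  also have "\<dots> = (\<integral>\<^sup>+ x. ennreal (pi ^ n / fact (n - 1) * x ^ (n - 1)) * indicator {0..} x
      * ennreal ((poly L (c * x))\<^sup>2 * exp (- (c * x))) \<partial>lborel)"
    by (subst distr_norm_square[of n]) (auto simp: n_def nn_integral_density)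
  also have "\<dots> = (\<integral>\<^sup>+ x. ennreal (pi ^ n / fact (n - 1) / c ^ (n - 1)) *
       ennreal (poly ?q (0 + c * x) * exp (- (0 + c * x)) * indicator {0..} (0 + c * x)) \<partial>lborel)"
    using c by (intro nn_integral_cong)
      (auto simp: poly_monom power_mult_distrib zero_le_mult_iff ennreal_mult'[symmetric] split: split_indicator)
  also have "\<dots> = ennreal (pi ^ n / fact (n - 1) / c ^ (n - 1)) *
     (\<integral>\<^sup>+ x. ennreal (poly ?q (0 + c * x) * exp (- (0 + c * x)) * indicator {0..} (0 + c * x)) \<partial>lborel)"
    by (subst nn_integral_cmult) auto
  also have "(\<integral>\<^sup>+ x. ennreal (poly ?q (0 + c * x) * exp (- (0 + c * x)) * indicator {0..} (0 + c * x)) \<partial>lborel)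
     = ennreal (1 / c) * (\<integral>\<^sup>+ x. ennreal (poly ?q x * exp (- x) * indicator {0..} x) \<partial>lborel)"
  proof -
    have "(\<integral>\<^sup>+ x. ennreal (poly ?q x * exp (- x) * indicator {0..} x) \<partial>lborel)
      = ennreal c * (\<integral>\<^sup>+ x. ennreal (poly ?q (0 + c * x) * exp (- (0 + c * x)) * indicator {0..} (0 + c * x)) \<partial>lborel)"
      using c by (subst nn_integral_real_affine[of _ c 0]) auto
    moreover have "ennreal (1 / c) * ennreal c = 1" using c by (simp flip: ennreal_mult)
    ultimately show ?thesis by (simp only: mult.assoc[symmetric] mult_1)
  qed
  also have "(\<integral>\<^sup>+ x. ennreal (poly ?q x * exp (- x) * indicator {0..} x) \<partial>lborel) = ennreal (exp_fnl ?q)"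
    using has_bochner_integral_exp_fnl[of ?q]
    by (subst nn_integral_eq_integral)
       (auto simp: has_bochner_integral_iff poly_monom split: split_indicator)
  also have "exp_fnl ?q = fact (k + n - 1) / fact k"
    using exp_fnl_laguerre_square[of "n - 1" k] n0 by (simp add: L_def)
  also have "ennreal (pi ^ n / fact (n - 1) / c ^ (n - 1)) * (ennreal (1 / c) * ennreal (fact (k + n - 1) / fact k))
     = ennreal ((2 * pi / \<bar>l\<bar>) ^ n / fan_coeff n k)"
  proof -
    have "pi ^ n / fact (n - 1) / c ^ (n - 1) * (1 / c * (fact (k + n - 1) / fact k))
       = pi ^ n / c ^ Suc (n - 1) / fan_coeff n k"
      by (simp add: fan_coeff_def)
    also have "\<dots> = (2 * pi / \<bar>l\<bar>) ^ n / fan_coeff n k"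
      using n0 by (simp add: c_def power_divide power_mult_distrib del: power_Suc)
    finally show ?thesis using c by (simp add: ennreal_mult'[symmetric])
  qed
  finally show ?thesis by (simp only: n_def)
qed

section \<open>Generating function and Fourier coefficients on the circle\<close>

text \<open>Expand exp(-x r/(1-r)) in powers of x. Its i-th term contributes (-x)^i / i! times r^i
  (1-r)^(-i-n), and the negative binomial series turns the coefficient of r^k into the one in
  \<open>laguerre_eq_sum\<close>.\<close>

lemma laguerre_generating_function:
  assumes n: "n > 0"
  shows "(\<lambda>r::complex. exp (- of_real x * (r * inverse (1 - r))) * inverse ((1 - r) ^ n))
     has_fps_expansion Abs_fps (\<lambda>k. of_real (poly (laguerre (n - 1) k) x))"
proof (rule has_fps_expansion_schematicI)
  let ?B = "fps_X * inverse (1 - fps_X) :: complex fps"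
  let ?C = "inverse ((1 - fps_X) ^ n) :: complex fps"
  let ?E = "fps_exp (- of_real x) :: complex fps"
  show "(\<lambda>r::complex. exp (- of_real x * (r * inverse (1 - r))) * inverse ((1 - r) ^ n))
     has_fps_expansion (fps_compose ?E ?B * ?C)"
    by (intro fps_expansion_intros has_fps_expansion_mult
          has_fps_expansion_compose[where g="\<lambda>r. r * inverse (1 - r)" and f="\<lambda>y. exp (- of_real x * y)", unfolded o_def]) auto
  show "fps_compose ?E ?B * ?C = Abs_fps (\<lambda>k. of_real (poly (laguerre (n - 1) k) x))"
  proof (rule fps_ext)
    fix k
    have coef: "fps_nth (?B ^ i * ?C) k = (if i \<le> k then of_nat ((k + (n - 1)) choose (k - i)) else 0)" for i
    proof -
      have "?B ^ i * ?C = fps_X ^ i * inverse ((1 - fps_const 1 * fps_X) ^ (i + n))"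
        by (simp add: power_mult_distrib power_add fps_inverse_mult fps_inverse_power mult.assoc)
      also have "\<dots> = fps_X ^ i * Abs_fps (\<lambda>k. of_nat (i + n + k - 1 choose k) * 1 ^ k)"
        using n by (subst one_minus_const_fps_X_neg_power') auto
      also have "fps_nth \<dots> k = (if i \<le> k then of_nat (i + n + (k - i) - 1 choose (k - i)) else 0)"
        by (simp add: fps_X_power_mult_nth)
      also have "\<dots> = (if i \<le> k then of_nat ((k + (n - 1)) choose (k - i)) else 0)"
        using n by (simp add: add.commute)
      finally show ?thesis .
    qed
    have "fps_nth (fps_compose ?E ?B * ?C) k
       = (\<Sum>m=0..k. (\<Sum>i=0..m. fps_nth ?E i * fps_nth (?B ^ i) m) * fps_nth ?C (k - m))"
      by (simp only: fps_mult_nth fps_compose_nth)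
    \<comment> \<open>The i-th power of \<open>?B\<close> has no terms of order below i, so the
      inner range can be made independent of m before the sums are exchanged.\<close>
    also have "\<dots> = (\<Sum>m=0..k. (\<Sum>i=0..k. fps_nth ?E i * fps_nth (?B ^ i) m) * fps_nth ?C (k - m))"
      by (intro sum.cong refl arg_cong2[where f="(*)"] sum.mono_neutral_left)
         (auto simp: power_mult_distrib fps_X_power_mult_nth)
    also have "\<dots> = (\<Sum>i=0..k. fps_nth ?E i * (\<Sum>m=0..k. fps_nth (?B ^ i) m * fps_nth ?C (k - m)))"
      unfolding sum_distrib_right by (subst sum.swap) (simp add: sum_distrib_left mult.assoc)
    also have "\<dots> = (\<Sum>i=0..k. fps_nth ?E i * fps_nth (?B ^ i * ?C) k)"
      by (simp only: fps_mult_nth)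
    also have "\<dots> = (\<Sum>i\<le>k. (- of_real x) ^ i / fact i * of_nat ((k + (n - 1)) choose (k - i)))"
      by (intro sum.cong) (auto simp: coef)
    also have "\<dots> = of_real (poly (laguerre (n - 1) k) x)"
      unfolding laguerre_eq_sum poly_sum of_real_sum poly_monom
      by (intro sum.cong refl) (simp add: power_minus[of "of_real x"] mult_ac)
    finally show "fps_nth (fps_compose ?E ?B * ?C) k = fps_nth (Abs_fps (\<lambda>k. of_real (poly (laguerre (n - 1) k) x))) k"
      by simp
  qed
qed

section \<open>Fourier series on circles, parametrised by a probability measure on [0,1]\<close>

definition unit_interval :: "real measure" where
  "unit_interval = density lborel (\<lambda>x. ennreal (indicator {0..1} x))"

lemma sets_unit_interval [measurable_cong, simp]: "sets unit_interval = sets borel"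
  by (simp add: unit_interval_def)

lemma space_unit_interval [simp]: "space unit_interval = UNIV"
  by (simp add: unit_interval_def)

lemma emeasure_unit_interval: "emeasure unit_interval UNIV = 1"
  by (simp add: unit_interval_def emeasure_density ennreal_indicator)

interpretation unit_interval: prob_space unit_interval
  by standard (simp add: emeasure_unit_interval)

lemma integral_unit_interval:
  fixes f :: "real \<Rightarrow> complex"
  assumes f: "continuous_on {0..1} f" "f \<in> borel_measurable borel" and I: "(f has_integral I) {0..1}"
  shows "integral\<^sup>L unit_interval f = I"
proof -
  have "integral\<^sup>L unit_interval f = (LINT x:{0..1}|lborel. f x)"
    using f unfolding unit_interval_def by (subst integral_density) (auto simp: set_lebesgue_integral_def)
  also have "\<dots> = integral {0..1} f"
    using borel_integrable_atLeastAtMost'[OF f(1)] by (rule set_borel_integral_eq_integral)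
  finally show ?thesis using I by (simp add: integral_unique)
qed

definition unit_char :: "int \<Rightarrow> real \<Rightarrow> complex" where
  "unit_char j t = exp (\<i> * of_real (2 * pi * of_int j * t))"

lemma continuous_unit_char [continuous_intros]:
  "continuous_on A f \<Longrightarrow> continuous_on A (\<lambda>x. unit_char j (f x))"
  unfolding unit_char_def by (intro continuous_intros)

lemma measurable_unit_char [measurable]: "unit_char j \<in> borel_measurable borel"
  by (intro borel_measurable_continuous_onI continuous_intros)

lemma norm_unit_char [simp]: "cmod (unit_char j t) = 1"
  by (simp add: unit_char_def)

lemma cnj_unit_char: "cnj (unit_char j t) = unit_char (- j) t"
  by (simp add: unit_char_def exp_cnj)

lemma unit_char_mult: "unit_char i t * unit_char j t = unit_char (i + j) t"
  by (simp add: unit_char_def exp_add[symmetric] algebra_simps)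

lemma integral_unit_char: "integral\<^sup>L unit_interval (unit_char j) = (if j = 0 then 1 else 0)"
proof (rule integral_unit_interval)
  show "(unit_char j has_integral (if j = 0 then 1 else 0)) {0..1}"
  proof (cases "j = 0")
    case True
    then have "unit_char j = (\<lambda>x. 1)" by (simp add: unit_char_def fun_eq_iff)
    then show ?thesis using True has_integral_const_real[of "1::complex" 0 1] by simp
  next
    case False
    let ?c = "\<i> * of_real (2 * pi * of_int j)"
    have c: "?c \<noteq> 0" using False by simp
    have "((\<lambda>t. unit_char j t) has_integral (exp (?c * of_real 1) / ?c - exp (?c * of_real 0) / ?c)) {0..1}"
    proof (rule fundamental_theorem_of_calculus)
      fix t :: real assume "t \<in> {0..1}"
      have "((\<lambda>u. exp (?c * u) / ?c) has_field_derivative exp (?c * of_real t)) (at (of_real t))"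
        using c by (auto intro!: derivative_eq_intros)
      then have "((\<lambda>t. exp (?c * of_real t) / ?c) has_vector_derivative exp (?c * of_real t)) (at t within {0..1})"
        by (rule has_vector_derivative_real_field)
      then show "((\<lambda>t. exp (?c * of_real t) / ?c) has_vector_derivative unit_char j t) (at t within {0..1})"
        by (simp add: unit_char_def mult_ac)
    qed simp
    moreover have "exp ?c = 1"
      by (subst exp_eq_1) (auto intro: exI[of _ j])
    ultimately show ?thesis using False by simp
  qed
qed (auto intro: continuous_intros simp: continuous_unit_char[OF continuous_on_id, unfolded id_def])

text \<open>Cauchy's integral formula for the k-th derivative at the centre, written on the circle
  of radius \<rho> < 1; no boundary behaviour of f is required.\<close>

lemma circle_coefficient:
  assumes f: "f holomorphic_on ball 0 1" and \<rho>: "0 < \<rho>" "\<rho> < 1"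
  shows "(LINT t|unit_interval. f (of_real \<rho> * unit_char 1 t) * unit_char (- int k) t)
     = of_real (\<rho> ^ k) * ((deriv ^^ k) f 0 / fact k)"
proof (rule integral_unit_interval)
  let ?h = "\<lambda>t. f (of_real \<rho> * unit_char 1 t) * unit_char (- int k) t"
  have contf: "continuous_on (ball 0 1) f" using f by (rule holomorphic_on_imp_continuous_on)
  have cont: "continuous_on UNIV ?h"
    by (intro continuous_intros continuous_on_compose2[OF contf]) (use \<rho> in \<open>auto simp: norm_mult\<close>)
  then show "continuous_on {0..1} ?h" by (rule continuous_on_subset) simp
  show "?h \<in> borel_measurable borel" using cont by (rule borel_measurable_continuous_onI)
  have "((\<lambda>u. f u / (u - 0) ^ Suc k) has_contour_integral ((2 * pi * \<i>) / (fact k) * (deriv ^^ k) f 0)) (circlepath 0 \<rho>)"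
    by (rule Cauchy_has_contour_integral_higher_derivative_circlepath)
       (use \<rho> in \<open>auto intro!: continuous_on_subset[OF contf] holomorphic_on_subset[OF f]\<close>)
  then have "((\<lambda>t. f (circlepath 0 \<rho> t) / circlepath 0 \<rho> t ^ Suc k * (2 * pi * \<i> * \<rho> * exp (2 * of_real pi * \<i> * t)))
      has_integral ((2 * pi * \<i>) / (fact k) * (deriv ^^ k) f 0)) {0..1}"
    unfolding has_contour_integral_def
    by (rule has_integral_eq[rotated]) (simp add: vector_derivative_circlepath01)
  \<comment> \<open>The factor \<rho>^k / (2 pi i) turns dz / z^(k+1) on the circle into the
    conjugate character dt.\<close>
  then have "((\<lambda>t. f (circlepath 0 \<rho> t) / circlepath 0 \<rho> t ^ Suc k * (2 * pi * \<i> * \<rho> * exp (2 * of_real pi * \<i> * t))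
       * (of_real (\<rho> ^ k) / (2 * pi * \<i>)))
      has_integral ((2 * pi * \<i>) / (fact k) * (deriv ^^ k) f 0 * (of_real (\<rho> ^ k) / (2 * pi * \<i>)))) {0..1}"
    by (rule has_integral_mult_left)
  also have "(2 * pi * \<i>) / (fact k) * (deriv ^^ k) f 0 * (of_real (\<rho> ^ k) / (2 * pi * \<i>))
     = of_real (\<rho> ^ k) * ((deriv ^^ k) f 0 / fact k)"
    by simp
  also have "(\<lambda>t. f (circlepath 0 \<rho> t) / circlepath 0 \<rho> t ^ Suc k * (2 * pi * \<i> * \<rho> * exp (2 * of_real pi * \<i> * t))
       * (of_real (\<rho> ^ k) / (2 * pi * \<i>))) = ?h"
  proof
    fix t :: real
    have e: "exp (2 * of_real pi * \<i> * of_real t) = unit_char 1 t"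
      by (simp add: unit_char_def mult_ac)
    have nz: "unit_char 1 t \<noteq> 0" by (simp add: unit_char_def)
    have "unit_char (- int k) t = 1 / unit_char 1 t ^ k"
      by (simp add: unit_char_def exp_of_nat_mult[symmetric] exp_minus[symmetric] divide_inverse algebra_simps)
    then show "f (circlepath 0 \<rho> t) / circlepath 0 \<rho> t ^ Suc k * (2 * pi * \<i> * \<rho> * exp (2 * of_real pi * \<i> * t))
       * (of_real (\<rho> ^ k) / (2 * pi * \<i>)) = ?h t"
      using \<rho> nz by (simp add: circlepath e power_mult_distrib)
  qed
  finally show "(?h has_integral of_real (\<rho> ^ k) * ((deriv ^^ k) f 0 / fact k)) {0..1}" .
qed

text \<open>S is the projection of h to the first N characters; the integral of |h - S|^2 is
  nonnegative, and both the mixed term and the integral of |S|^2 equal the sum of squared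
  coefficients.\<close>

lemma bessel_unit_interval:
  fixes h :: "real \<Rightarrow> complex"
  assumes [measurable]: "h \<in> borel_measurable borel" and bdd: "\<And>t. cmod (h t) \<le> B"
  shows "(\<Sum>k<N. (cmod (LINT t|unit_interval. h t * unit_char (- int k) t))\<^sup>2)
     \<le> (LINT t|unit_interval. (cmod (h t))\<^sup>2)"
proof -
  define c where "c = (\<lambda>k. LINT t|unit_interval. h t * unit_char (- int k) t)"
  define S where "S = (\<lambda>t. \<Sum>k<N. c k * unit_char (int k) t)"
  have Sm [measurable]: "S \<in> borel_measurable borel" unfolding S_def by measurable
  have int_bdd: "integrable unit_interval f" if "f \<in> borel_measurable borel" "\<And>t. cmod (f t) \<le> K" 
    for f :: "real \<Rightarrow> complex" and K
    using that by (intro unit_interval.integrable_const_bound[of _ K]) auto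
  have i1: "integrable unit_interval (\<lambda>t. h t * unit_char j t)" for j
    by (rule int_bdd[of _ B]) (auto simp: norm_mult bdd)
  have i2: "integrable unit_interval (unit_char j)" for j
    by (rule int_bdd[of _ 1]) auto
  have Sb: "cmod (S t) \<le> (\<Sum>k<N. cmod (c k))" for t
    unfolding S_def by (rule order_trans[OF norm_sum]) (simp add: norm_mult)
  have B: "B \<ge> 0" using order_trans[OF norm_ge_zero bdd] by simp
  have hS: "(LINT t|unit_interval. h t * cnj (S t)) = of_real (\<Sum>k<N. (cmod (c k))\<^sup>2)"
  proof -
    have "(LINT t|unit_interval. h t * cnj (S t))
       = (LINT t|unit_interval. (\<Sum>k<N. cnj (c k) * (h t * unit_char (- int k) t)))"
      by (simp add: S_def cnj_unit_char sum_distrib_left mult_ac)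
    also have "\<dots> = (\<Sum>k<N. cnj (c k) * c k)"
      unfolding c_def by (simp add: Bochner_Integration.integral_sum i1)
    finally show ?thesis by (simp add: complex_norm_square mult.commute del: of_real_power)
  qed
  have SS: "(LINT t|unit_interval. S t * cnj (S t)) = of_real (\<Sum>k<N. (cmod (c k))\<^sup>2)"
  proof -
    have "(LINT t|unit_interval. S t * cnj (S t))
       = (LINT t|unit_interval. (\<Sum>j<N. \<Sum>k<N. c j * cnj (c k) * unit_char (int j - int k) t))"
      unfolding S_def cnj_sum complex_cnj_mult cnj_unit_char sum_product
      by (intro Bochner_Integration.integral_cong refl sum.cong)
         (simp add: unit_char_mult[symmetric] mult_ac flip: uminus_add_conv_diff)
    also have "\<dots> = (\<Sum>j<N. \<Sum>k<N. c j * cnj (c k) * (if int j - int k = 0 then 1 else 0))"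
      by (simp add: Bochner_Integration.integral_sum i2 integral_unit_char)
    also have "\<dots> = (\<Sum>j<N. c j * cnj (c j))"
      by (intro sum.cong refl) (simp add: if_distrib[of "\<lambda>x. _ * x"] cong: if_cong)
    finally show ?thesis by (simp add: complex_norm_square del: of_real_power)
  qed
  have i_h: "integrable unit_interval (\<lambda>t. h t * cnj (h t))"
    by (rule int_bdd[of _ "B * B"]) (auto simp: norm_mult intro!: mult_mono bdd B)
  have i_hS: "integrable unit_interval (\<lambda>t. h t * cnj (S t))"
    by (rule int_bdd[of _ "B * (\<Sum>k<N. cmod (c k))"]) (auto simp: norm_mult intro!: mult_mono bdd B Sb)
  have i_S: "integrable unit_interval (\<lambda>t. S t * cnj (S t))"
    by (rule int_bdd[of _ "(\<Sum>k<N. cmod (c k)) * (\<Sum>k<N. cmod (c k))"])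
       (auto simp: norm_mult intro!: mult_mono Sb sum_nonneg)
  have i_Sh: "integrable unit_interval (\<lambda>t. cnj (h t * cnj (S t)))"
    using i_hS by (simp del: complex_cnj_mult)
  have "complex_of_real (LINT t|unit_interval. (cmod (h t - S t))\<^sup>2)
     = (LINT t|unit_interval. (h t - S t) * cnj (h t - S t))"
    by (simp only: integral_complex_of_real[symmetric] complex_norm_square)
  also have "\<dots> = (LINT t|unit_interval. h t * cnj (h t) - h t * cnj (S t) - cnj (h t * cnj (S t)) + S t * cnj (S t))"
    by (simp add: algebra_simps)
  also have "\<dots> = (LINT t|unit_interval. h t * cnj (h t)) - (LINT t|unit_interval. h t * cnj (S t))
      - cnj (LINT t|unit_interval. h t * cnj (S t)) + (LINT t|unit_interval. S t * cnj (S t))"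
    using i_h i_hS i_S i_Sh by (simp del: complex_cnj_mult)
  also have "\<dots> = (LINT t|unit_interval. h t * cnj (h t)) - of_real (\<Sum>k<N. (cmod (c k))\<^sup>2)"
    unfolding hS SS by simp
  also have "(LINT t|unit_interval. h t * cnj (h t)) = complex_of_real (LINT t|unit_interval. (cmod (h t))\<^sup>2)"
    by (simp only: integral_complex_of_real[symmetric] complex_norm_square)
  finally have "(LINT t|unit_interval. (cmod (h t - S t))\<^sup>2)
      = (LINT t|unit_interval. (cmod (h t))\<^sup>2) - (\<Sum>k<N. (cmod (c k))\<^sup>2)"
    by (simp only: of_real_diff[symmetric] of_real_eq_iff)
  moreover have "(LINT t|unit_interval. (cmod (h t - S t))\<^sup>2) \<ge> 0" by simp
  ultimately show ?thesis unfolding c_def by simp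
qed

section \<open>Twisted convolution\<close>

lemma integral_lborel_shift:
  fixes f :: "'a::euclidean_space \<Rightarrow> complex"
  assumes "f \<in> borel_measurable borel"
  shows "(LINT x|lborel. f (c + x)) = (LINT x|lborel. f x)"
proof -
  have "(LINT x|lborel. f x) = (LINT x|distr lborel borel ((+) c). f x)"
    by (simp only: lborel_distr_plus)
  also have "\<dots> = (LINT x|lborel. f (c + x))"
    using assms by (subst integral_distr) auto
  finally show ?thesis ..
qed

definition symp :: "complex ^ 'n::finite \<Rightarrow> complex ^ 'n \<Rightarrow> real" where
  "symp z w = Im (\<Sum>j\<in>UNIV. z $ j * cnj (w $ j))"

text \<open>Multiplication by -i converts the symplectic form into the real inner product. A twist
  thus becomes a Fourier character in w whose frequency is orthogonal to z and has length
  proportional to |z|, as the next two lemmas record.\<close>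

lemma symp_eq_inner: "symp z w = (\<chi> j. - \<i> * z $ j) \<bullet> w"
  by (simp add: symp_def inner_vec_def inner_complex_def algebra_simps)

lemma inner_symp_vec: "z \<bullet> (\<chi> j. - \<i> * z $ j) = 0"
  by (simp add: inner_vec_def inner_complex_def algebra_simps)

lemma norm_symp_vec: "norm (\<chi> j. - \<i> * z $ j) = norm z"
  by (simp add: norm_vec_def norm_mult)

lemma symp_add_left: "symp (x + y) w = symp x w + symp y w"
  by (simp add: symp_def distrib_right sum.distrib)

lemma symp_minus_left: "symp (- x) w = - symp x w"
  by (simp add: symp_def sum_negf)

lemma symp_add_right: "symp z (v + w) = symp z v + symp z w"
  by (simp add: symp_eq_inner inner_add_right)

lemma continuous_on_symp [continuous_intros]:
  "continuous_on A f \<Longrightarrow> continuous_on A g \<Longrightarrow> continuous_on A (\<lambda>x. symp (f x) (g x))"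
  unfolding symp_def by (intro continuous_intros)

text \<open>The quotient is the Cayley transform of the unit disc onto the right half plane, so the
  real part of the rate is positive for |r| < 1 and l nonzero.\<close>

definition mehler_rate :: "real \<Rightarrow> complex \<Rightarrow> complex" where
  "mehler_rate l r = of_real (\<bar>l\<bar> / 4) * ((1 + r) / (1 - r))"

text \<open>The generating function \<open>\<Sum>k. r ^ k * laguerre_fun k l\<close>, see \<open>mehler_circle_coefficient\<close>, as a
  function of \<open>v = (norm z)\<^sup>2\<close>. Its closed form is a Gaussian with complex parameter.\<close>

definition mehler :: "nat \<Rightarrow> real \<Rightarrow> complex \<Rightarrow> real \<Rightarrow> complex" where
  "mehler n l r v = exp (- mehler_rate l r * of_real v) / (1 - r) ^ n"

text \<open>The phase left by the central component of the group law after the Fourier transform in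
  t; it is what makes the convolution on C^n twisted.\<close>

definition twist :: "real \<Rightarrow> complex ^ 'n::finite \<Rightarrow> complex ^ 'n \<Rightarrow> complex" where
  "twist l z w = exp (\<i> * of_real (- (l / 2) * symp z w))"

lemma norm_twist [simp]: "cmod (twist l z w) = 1"
  by (simp add: twist_def)

lemma twist_mult_cnj:
  "twist l z w * cnj (twist l z' w) = exp (\<i> * of_real (- (l / 2) * symp z w + l / 2 * symp z' w))"
  by (simp add: twist_def exp_cnj exp_add[symmetric] algebra_simps)

lemma Re_cayley: "Re ((1 + r) / (1 - r)) = (1 - (cmod r)\<^sup>2) / (cmod (1 - r))\<^sup>2"
proof -
  have "(1 + r) / (1 - r) = (1 + r) * cnj (1 - r) / of_real ((cmod (1 - r))\<^sup>2)"
    by (subst complex_div_cnj) simp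
  then have "Re ((1 + r) / (1 - r)) = Re ((1 + r) * cnj (1 - r)) / (cmod (1 - r))\<^sup>2"
    by (simp only: Re_divide_of_real)
  also have "Re ((1 + r) * cnj (1 - r)) = 1 - (cmod r)\<^sup>2"
    unfolding cmod_power2 by (simp add: power2_eq_square algebra_simps)
  finally show ?thesis .
qed

lemma Re_mehler_rate: "Re (mehler_rate l r) = \<bar>l\<bar> / 4 * ((1 - (cmod r)\<^sup>2) / (cmod (1 - r))\<^sup>2)"
  by (simp only: mehler_rate_def Re_cayley times_complex.sel Re_complex_of_real Im_complex_of_real
      mult_zero_left diff_zero)

lemma Re_mehler_rate_pos:
  assumes "cmod r < 1" "l \<noteq> 0"
  shows "Re (mehler_rate l r) > 0"
proof -
  have "(cmod r)\<^sup>2 < 1" "1 - r \<noteq> 0" using assms by (auto simp: abs_square_less_1)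
  then show ?thesis using assms unfolding Re_mehler_rate by simp
qed

lemma norm_mehler_rate: "cmod (mehler_rate l r) = \<bar>l\<bar> / 4 * (cmod (1 + r) / cmod (1 - r))"
  unfolding mehler_rate_def norm_mult norm_divide by simp

lemma norm_mehler_le:
  assumes r: "cmod r < 1" and v: "v \<ge> 0"
  shows "cmod (mehler n l r v) \<le> 1 / (1 - cmod r) ^ n"
proof -
  have "Re (mehler_rate l r) \<ge> 0"
    unfolding Re_mehler_rate using r by (simp add: power_le_one)
  then have "cmod (exp (- mehler_rate l r * of_real v)) \<le> 1"
    using v by simp
  moreover have "(1 - cmod r) ^ n \<le> cmod (1 - r) ^ n"
    using norm_triangle_ineq2[of 1 r] r by (intro power_mono) auto
  ultimately show ?thesis
    using r unfolding mehler_def norm_divide norm_power by (intro frac_le) auto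
qed

text \<open>Centred at the midpoint of z and z', the product is a constant times a real Gaussian of
  rate 2 Re \<beta> times a pure character: the twists contribute a frequency along -i(z' - z), and
  the imaginary part of the rate one along z' - z. The integral is then a Fourier transform of a
  Gaussian.\<close>

lemma twisted_gaussian_correlation:
  fixes z z' :: "complex ^ 'n::finite"
  assumes r: "cmod r < 1" and l: "l \<noteq> 0"
  defines "\<beta> \<equiv> mehler_rate l r"
  defines "k \<equiv> \<lambda>z w. twist l z w * mehler CARD('n) l r ((norm (w - z))\<^sup>2)"
  shows "cmod (LINT w|lborel. k z w * cnj (k z' w))
    = (pi / (2 * Re \<beta>)) ^ CARD('n) / cmod (1 - r) ^ (2 * CARD('n))
      * exp (- ((2 * Re \<beta> + (l\<^sup>2 + 16 * (Im \<beta>)\<^sup>2) / (8 * Re \<beta>)) / 4) * (norm (z' - z))\<^sup>2)"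
proof -
  define b c where "b = Re \<beta>" and "c = Im \<beta>"
  \<comment> \<open>Midpoint and half difference: with w = m + u, the vectors w - z and w - z'
    become u + d and u - d.\<close>
  define m where "m = (1/2) *\<^sub>R (z + z')"
  define d where "d = (1/2) *\<^sub>R (z' - z)"
  define J where "J = (\<chi> j. - \<i> * d $ j)"
  define \<xi> where "\<xi> = l *\<^sub>R J - (4 * c) *\<^sub>R d"
  define U where "U = exp (\<i> * of_real (l * symp d m)) * of_real (exp (- (2 * b) * (norm d)\<^sup>2) / cmod (1 - r) ^ (2 * CARD('n)))"
  have b: "b > 0" using Re_mehler_rate_pos[OF r l] by (simp add: b_def \<beta>_def)
  have beta: "\<beta> = Complex b c" by (simp add: b_def c_def)
  have zd: "z = m - d" "z' = m + d"
  proof -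
    have "m - d = (1/2) *\<^sub>R ((z + z') - (z' - z))" "m + d = (1/2) *\<^sub>R ((z + z') + (z' - z))"
      by (simp_all only: m_def d_def scaleR_right_diff_distrib scaleR_right_distrib)
    moreover have "(z + z') - (z' - z) = 2 *\<^sub>R z" "(z + z') + (z' - z) = 2 *\<^sub>R z'"
      by (simp_all add: scaleR_2)
    ultimately show "z = m - d" "z' = m + d" by simp_all
  qed
  have n1: "(norm (u + d))\<^sup>2 = (norm u)\<^sup>2 + 2 * (u \<bullet> d) + (norm d)\<^sup>2" for u :: "complex ^ 'n"
    by (simp add: power2_norm_eq_inner inner_add_left inner_add_right inner_commute)
  have n2: "(norm (u - d))\<^sup>2 = (norm u)\<^sup>2 - 2 * (u \<bullet> d) + (norm d)\<^sup>2" for u :: "complex ^ 'n"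
    by (simp add: power2_norm_eq_inner inner_diff_left inner_diff_right inner_commute)
  have kk: "k z (m + u) * cnj (k z' (m + u))
     = U * (complex_of_real (exp (- (2 * b) * (norm u)\<^sup>2)) * iexp (\<xi> \<bullet> u))" for u
  proof -
    have tw: "twist l z (m + u) * cnj (twist l z' (m + u)) = exp (\<i> * of_real (l * symp d m)) * exp (\<i> * of_real (l * (J \<bullet> u)))"
    proof -
      have "symp d u = J \<bullet> u" by (simp add: symp_eq_inner J_def)
      then have s: "symp d (m + u) = symp d m + J \<bullet> u" by (simp add: symp_add_right)
      have "symp z w = symp m w - symp d w" "symp z' w = symp m w + symp d w" for w
        unfolding zd using symp_add_left[of m "- d"] by (simp_all add: symp_add_left symp_minus_left)
      then have T: "- (l / 2) * symp z (m + u) + l / 2 * symp z' (m + u) = l * symp d m + l * (J \<bullet> u)"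
        by (simp only: s) (simp add: field_simps)
      show ?thesis
        unfolding twist_mult_cnj T exp_add[symmetric] by (simp add: distrib_left)
    qed
    have me: "mehler CARD('n) l r ((norm (m + u - z))\<^sup>2) * cnj (mehler CARD('n) l r ((norm (m + u - z'))\<^sup>2))
      = of_real (exp (- (2 * b) * (norm d)\<^sup>2) / cmod (1 - r) ^ (2 * CARD('n)))
        * (of_real (exp (- (2 * b) * (norm u)\<^sup>2)) * exp (\<i> * of_real (- 4 * c * (d \<bullet> u))))"
    proof -
      have den: "(1 - r) ^ CARD('n) * cnj ((1 - r) ^ CARD('n)) = of_real (cmod (1 - r) ^ (2 * CARD('n)))"
        by (simp only: complex_norm_square[symmetric] norm_power power_mult[symmetric] mult.commute[of 2] of_real_power)
      have "- \<beta> * of_real ((norm (u + d))\<^sup>2) + cnj (- \<beta> * of_real ((norm (u - d))\<^sup>2))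
        = of_real (- (2 * b) * (norm d)\<^sup>2) + (of_real (- (2 * b) * (norm u)\<^sup>2) + \<i> * of_real (- 4 * c * (d \<bullet> u)))"
        unfolding n1 n2 beta by (simp add: complex_eq_iff inner_commute[of d u] algebra_simps)
      then have E: "exp (- \<beta> * of_real ((norm (u + d))\<^sup>2)) * cnj (exp (- \<beta> * of_real ((norm (u - d))\<^sup>2)))
        = of_real (exp (- (2 * b) * (norm d)\<^sup>2)) * (of_real (exp (- (2 * b) * (norm u)\<^sup>2)) * exp (\<i> * of_real (- 4 * c * (d \<bullet> u))))"
        unfolding exp_cnj exp_add[symmetric] exp_of_real[symmetric] by (simp only:)
      have mu: "m + u - z = u + d" "m + u - z' = u - d" by (simp_all add: zd)
      show ?thesis
        unfolding mehler_def \<beta>_def[symmetric] complex_cnj_divide times_divide_times_eq den mu E by simp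
    qed
    have "k z (m + u) * cnj (k z' (m + u)) = (twist l z (m + u) * cnj (twist l z' (m + u))) *
       (mehler CARD('n) l r ((norm (m + u - z))\<^sup>2) * cnj (mehler CARD('n) l r ((norm (m + u - z'))\<^sup>2)))"
      by (simp add: k_def mult_ac)
    also have "\<dots> = U * (complex_of_real (exp (- (2 * b) * (norm u)\<^sup>2))
       * (exp (\<i> * of_real (l * (J \<bullet> u))) * exp (\<i> * of_real (- 4 * c * (d \<bullet> u)))))"
      unfolding tw me U_def by (simp only: mult_ac)
    also have "exp (\<i> * of_real (l * (J \<bullet> u))) * exp (\<i> * of_real (- 4 * c * (d \<bullet> u))) = iexp (\<xi> \<bullet> u)"
      unfolding exp_add[symmetric] by (simp add: \<xi>_def inner_diff_left algebra_simps)
    finally show ?thesis .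
  qed
  have meas: "(\<lambda>w. k z w * cnj (k z' w)) \<in> borel_measurable borel"
    unfolding k_def twist_def mehler_def
    by (intro borel_measurable_continuous_onI continuous_intros) (use r in auto)
  have "(LINT w|lborel. k z w * cnj (k z' w)) = (LINT u|lborel. k z (m + u) * cnj (k z' (m + u)))"
    using integral_lborel_shift[OF meas, of m] by simp
  also have "\<dots> = U * (LINT u|lborel. complex_of_real (exp (- (2 * b) * (norm u)\<^sup>2)) * iexp (\<xi> \<bullet> u))"
    unfolding kk by (rule integral_mult_right_zero)
  also have "\<dots> = U * complex_of_real (sqrt (pi / (2 * b)) ^ (2 * CARD('n)) * exp (- (norm \<xi>)\<^sup>2 / (4 * (2 * b))))"
    using b by (subst gaussian_fourier(2)) (simp_all add: mult.commute)
  finally have "cmod (LINT w|lborel. k z w * cnj (k z' w))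
     = exp (- (2 * b) * (norm d)\<^sup>2) / cmod (1 - r) ^ (2 * CARD('n)) * ((pi / (2 * b)) ^ CARD('n) * exp (- (norm \<xi>)\<^sup>2 / (8 * b)))"
    using b by (simp add: norm_mult U_def norm_divide norm_power power_mult)
  \<comment> \<open>J and d are orthogonal and of equal length, so the two contributions to the
    frequency add by Pythagoras.\<close>
  also have "(norm \<xi>)\<^sup>2 = (l\<^sup>2 + 16 * c\<^sup>2) * (norm d)\<^sup>2"
  proof -
    have "J \<bullet> d = 0" using inner_symp_vec[of d] by (simp add: J_def inner_commute)
    moreover have "J \<bullet> J = d \<bullet> d" using norm_symp_vec[of d] by (simp add: J_def norm_eq)
    ultimately show ?thesis
      unfolding power2_norm_eq_inner
      by (simp add: \<xi>_def inner_diff_left inner_diff_right inner_commute[of d J] power2_eq_square algebra_simps)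
  qed
  also have "exp (- (2 * b) * (norm d)\<^sup>2) / cmod (1 - r) ^ (2 * CARD('n)) * ((pi / (2 * b)) ^ CARD('n)
       * exp (- ((l\<^sup>2 + 16 * c\<^sup>2) * (norm d)\<^sup>2) / (8 * b)))
     = (pi / (2 * b)) ^ CARD('n) / cmod (1 - r) ^ (2 * CARD('n))
      * exp (- (2 * b) * (norm d)\<^sup>2 + - ((l\<^sup>2 + 16 * c\<^sup>2) * (norm d)\<^sup>2) / (8 * b))"
    unfolding exp_add by simp
  also have "- (2 * b) * (norm d)\<^sup>2 + - ((l\<^sup>2 + 16 * c\<^sup>2) * (norm d)\<^sup>2) / (8 * b)
     = - ((2 * b + (l\<^sup>2 + 16 * c\<^sup>2) / (8 * b)) / 4) * (norm (z' - z))\<^sup>2"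
  proof -
    have nd: "(norm d)\<^sup>2 = (norm (z' - z))\<^sup>2 / 4" by (simp add: d_def power_divide)
    show ?thesis using b unfolding nd by (simp add: field_simps)
  qed
  finally show ?thesis by (simp only: b_def c_def)
qed

section \<open>L2 bounds for regularised oscillating kernels\<close>

lemma gaussian_integral_cmult:
  fixes c :: "'a::euclidean_space" and b :: real
  assumes b: "b > 0"
  shows "(\<integral>\<^sup>+ x. C * ennreal (exp (- b * (norm (x - c))\<^sup>2)) \<partial>lborel) = C * ennreal (sqrt (pi / b) ^ DIM('a))"
  unfolding gaussian_integral[OF b, of c, symmetric] by (rule nn_integral_cmult) measurable

text \<open>An instance of \<open>tt_star_bound\<close>. The composed kernel has Gaussian modulus,
  so its Schur integral is explicit, and the constant is independent of r: this is what allows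
  integration over whole circles with radius tending to 1.\<close>

lemma twisted_gaussian_bound:
  fixes G :: "complex ^ 'n::finite \<Rightarrow> complex"
  assumes r: "cmod r < 1" and l: "l \<noteq> 0" and G: "integrable lborel G"
  shows "(\<integral>\<^sup>+ w. ennreal ((cmod (LINT z|lborel. G z * (twist l z w * mehler CARD('n) l r ((norm (w - z))\<^sup>2))))\<^sup>2) \<partial>lborel)
    \<le> ennreal ((8 * pi\<^sup>2 / l\<^sup>2) ^ CARD('n)) * (\<integral>\<^sup>+ z. ennreal ((cmod (G z))\<^sup>2) \<partial>lborel)"
proof (rule tt_star_bound)
  define \<beta> where "\<beta> = mehler_rate l r"
  have r1: "1 - r \<noteq> 0" using r by auto
  have b: "Re \<beta> > 0" using Re_mehler_rate_pos[OF r l] by (simp add: \<beta>_def)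
  define \<kappa> where "\<kappa> = 2 * Re \<beta> + (l\<^sup>2 + 16 * (Im \<beta>)\<^sup>2) / (8 * Re \<beta>)"
  have \<kappa>: "\<kappa> > 0" unfolding \<kappa>_def using b by (intro add_pos_nonneg divide_nonneg_pos) auto
  let ?k = "\<lambda>(z :: complex ^ 'n) w. twist l z w * mehler CARD('n) l r ((norm (w - z))\<^sup>2)"
  show "sigma_finite_measure (lborel :: (complex ^ 'n) measure)" "sigma_finite_measure (lborel :: (complex ^ 'n) measure)"
    by (rule lborel.sigma_finite_measure_axioms)+
  have "(\<lambda>(z, w). ?k z w) \<in> borel_measurable (borel :: ((complex ^ 'n) \<times> (complex ^ 'n)) measure)"
    unfolding twist_def mehler_def case_prod_beta'
    by (intro borel_measurable_continuous_onI continuous_intros) (use r in auto)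
  then show "(\<lambda>(z, w). ?k z w) \<in> borel_measurable (lborel \<Otimes>\<^sub>M lborel)"
    by (simp add: lborel_prod)
  show "cmod (?k z w) \<le> 1 / (1 - cmod r) ^ CARD('n)" for z w
    using norm_mehler_le[OF r, of "(norm (w - z))\<^sup>2"] by (simp add: norm_mult)
  \<comment> \<open>This bound degenerates as r tends to 1, but it only justifies Fubini.\<close>
  show "(\<integral>\<^sup>+ w. ennreal (cmod (?k z w)) \<partial>lborel) \<le> ennreal (1 / cmod (1 - r) ^ CARD('n) * sqrt (pi / Re \<beta>) ^ DIM(complex ^ 'n))" for z
  proof -
    have "(\<integral>\<^sup>+ w. ennreal (cmod (?k z w)) \<partial>lborel)
       = (\<integral>\<^sup>+ w. ennreal (1 / cmod (1 - r) ^ CARD('n)) * ennreal (exp (- Re \<beta> * (norm (w - z))\<^sup>2)) \<partial>lborel)"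
      by (intro nn_integral_cong) (simp add: norm_mult mehler_def norm_divide norm_power \<beta>_def[symmetric] flip: ennreal_mult')
    also have "\<dots> = ennreal (1 / cmod (1 - r) ^ CARD('n)) * ennreal (sqrt (pi / Re \<beta>) ^ DIM(complex ^ 'n))"
      by (rule gaussian_integral_cmult[OF b])
    finally show ?thesis by (simp flip: ennreal_mult')
  qed
  show "(\<integral>\<^sup>+ z'. ennreal (cmod (LINT w|lborel. ?k z w * cnj (?k z' w))) \<partial>lborel) \<le> ennreal ((8 * pi\<^sup>2 / l\<^sup>2) ^ CARD('n))" for z
  proof -
    let ?c = "(pi / (2 * Re \<beta>)) ^ CARD('n) / cmod (1 - r) ^ (2 * CARD('n))"
    have c: "?c \<ge> 0" using b by simp
    have "(\<integral>\<^sup>+ z'. ennreal (cmod (LINT w|lborel. ?k z w * cnj (?k z' w))) \<partial>lborel)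
       = (\<integral>\<^sup>+ z'. ennreal ?c * ennreal (exp (- (\<kappa> / 4) * (norm (z' - z))\<^sup>2)) \<partial>lborel)"
      unfolding twisted_gaussian_correlation[OF r l] \<beta>_def[symmetric] \<kappa>_def[symmetric]
      by (simp only: ennreal_mult'[OF c])
    also have "\<dots> = ennreal ?c * ennreal (sqrt (pi / (\<kappa> / 4)) ^ DIM(complex ^ 'n))"
      using \<kappa> by (intro gaussian_integral_cmult) simp
    also have "\<dots> = ennreal (?c * (pi / (\<kappa> / 4)) ^ CARD('n))"
      using \<kappa> c by (simp add: ennreal_mult'[symmetric] power_mult mult.commute[of _ 2])
    also have "?c * (pi / (\<kappa> / 4)) ^ CARD('n) = (pi / (2 * Re \<beta>) / (cmod (1 - r))\<^sup>2 * (pi / (\<kappa> / 4))) ^ CARD('n)"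
      by (simp only: power_mult_distrib power_divide power_mult)
    also have "pi / (2 * Re \<beta>) / (cmod (1 - r))\<^sup>2 * (pi / (\<kappa> / 4)) = 2 * pi\<^sup>2 / (Re \<beta> * \<kappa> * (cmod (1 - r))\<^sup>2)"
      by (simp add: power2_eq_square)
    also have "(2 * pi\<^sup>2 / (Re \<beta> * \<kappa> * (cmod (1 - r))\<^sup>2)) ^ CARD('n) \<le> (8 * pi\<^sup>2 / l\<^sup>2) ^ CARD('n)"
    proof (rule power_mono)
      \<comment> \<open>The squares of the real and imaginary parts of \<beta> recombine to
        |\<beta>|^2, which carries the factor |1 + r|^2 / |1 - r|^2. After multiplication by |1 -
        r|^2 the parallelogram law leaves l^2 (1 + |r|^2) / 4 >= l^2 / 4.\<close>
      have "Re \<beta> * \<kappa> = 2 * (cmod \<beta>)\<^sup>2 + l\<^sup>2 / 8"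
        using b unfolding \<kappa>_def cmod_power2 by (simp add: field_simps power2_eq_square)
      also have "(cmod \<beta>)\<^sup>2 = l\<^sup>2 / 16 * ((cmod (1 + r))\<^sup>2 / (cmod (1 - r))\<^sup>2)"
        by (simp add: \<beta>_def norm_mehler_rate power_mult_distrib power_divide)
      finally have "Re \<beta> * \<kappa> * (cmod (1 - r))\<^sup>2 = l\<^sup>2 / 8 * ((cmod (1 + r))\<^sup>2 + (cmod (1 - r))\<^sup>2)"
        using r1 by (simp add: field_simps)
      also have "(cmod (1 + r))\<^sup>2 + (cmod (1 - r))\<^sup>2 = 2 + 2 * (cmod r)\<^sup>2"
        unfolding cmod_power2 by (simp add: power2_eq_square algebra_simps)
      finally have e: "Re \<beta> * \<kappa> * (cmod (1 - r))\<^sup>2 = l\<^sup>2 / 8 * (2 + 2 * (cmod r)\<^sup>2)" .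
      have "l\<^sup>2 / 4 \<le> Re \<beta> * \<kappa> * (cmod (1 - r))\<^sup>2"
        unfolding e by (simp add: algebra_simps)
      then have "2 * pi\<^sup>2 / (Re \<beta> * \<kappa> * (cmod (1 - r))\<^sup>2) \<le> 2 * pi\<^sup>2 / (l\<^sup>2 / 4)"
        using l by (intro frac_le) auto
      then show "2 * pi\<^sup>2 / (Re \<beta> * \<kappa> * (cmod (1 - r))\<^sup>2) \<le> 8 * pi\<^sup>2 / l\<^sup>2" by simp
      show "0 \<le> 2 * pi\<^sup>2 / (Re \<beta> * \<kappa> * (cmod (1 - r))\<^sup>2)"
        using b \<kappa> by (intro divide_nonneg_nonneg mult_nonneg_nonneg) auto
    qed
    finally show ?thesis by (simp add: ennreal_leI)
  qed
qed (rule G)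

text \<open>The T T-star bound is applied to characters damped by exp(-e l^2). Their composed kernel
  is a Gaussian in t' - t of mass 2 pi whatever e is, so the damping can be removed by Fatou. Only
  integrability of g is assumed; the right side may be infinite.\<close>

lemma plancherel_le:
  assumes g: "integrable lborel g"
  shows "(\<integral>\<^sup>+ l. ennreal ((cmod (LINT t|lborel. g t * iexp (- (l * t))))\<^sup>2) \<partial>lborel)
    \<le> ennreal (2 * pi) * (\<integral>\<^sup>+ t. ennreal ((cmod (g t))\<^sup>2) \<partial>lborel)"
proof -
  define h where "h = (\<lambda>l. LINT t|lborel. g t * iexp (- (l * t)))"
  have [measurable]: "g \<in> borel_measurable borel" using g by simp
  have h_meas [measurable]: "h \<in> borel_measurable borel" unfolding h_def by measurable
  have weighted: "(\<integral>\<^sup>+ l. ennreal ((exp (- e * l\<^sup>2) * cmod (h l))\<^sup>2) \<partial>lborel)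
      \<le> ennreal (2 * pi) * (\<integral>\<^sup>+ t. ennreal ((cmod (g t))\<^sup>2) \<partial>lborel)" if e: "e > 0" for e
  proof -
    let ?k = "\<lambda>t l. complex_of_real (exp (- e * l\<^sup>2)) * iexp (- (l * t))"
    have "(\<integral>\<^sup>+ l. ennreal ((cmod (LINT t|lborel. g t * ?k t l))\<^sup>2) \<partial>lborel)
       \<le> ennreal (2 * pi) * (\<integral>\<^sup>+ t. ennreal ((cmod (g t))\<^sup>2) \<partial>lborel)"
    proof (rule tt_star_bound)
      show "sigma_finite_measure (lborel :: real measure)" "sigma_finite_measure (lborel :: real measure)"
        by (rule lborel.sigma_finite_measure_axioms)+
      show "(\<lambda>(t, l). ?k t l) \<in> borel_measurable (lborel \<Otimes>\<^sub>M lborel)" by measurable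
      show "cmod (?k t l) \<le> 1" for t l using e by (simp add: norm_mult)
      show "(\<integral>\<^sup>+ l. ennreal (cmod (?k t l)) \<partial>lborel) \<le> ennreal (sqrt (pi / e) ^ DIM(real))" for t
        using gaussian_integral[OF e, of "0::real"] by (simp add: norm_mult)
      show "(\<integral>\<^sup>+ t'. ennreal (cmod (LINT l|lborel. ?k t l * cnj (?k t' l))) \<partial>lborel) \<le> ennreal (2 * pi)" for t
      proof -
        have "(LINT l|lborel. ?k t l * cnj (?k t' l)) = complex_of_real (sqrt (pi / (2 * e)) * exp (- (1 / (8 * e)) * (t' - t)\<^sup>2))" for t'
        proof -
          have "?k t l * cnj (?k t' l) = complex_of_real (exp (- (2 * e) * l\<^sup>2)) * iexp ((t' - t) * l)" for l
          proof -
            have "?k t l * cnj (?k t' l) = (complex_of_real (exp (- e * l\<^sup>2)) * complex_of_real (exp (- e * l\<^sup>2)))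
               * (iexp (- (l * t)) * cnj (iexp (- (l * t'))))"
              by simp
            also have "complex_of_real (exp (- e * l\<^sup>2)) * complex_of_real (exp (- e * l\<^sup>2)) = complex_of_real (exp (- (2 * e) * l\<^sup>2))"
              unfolding of_real_mult[symmetric] exp_add[symmetric] by simp
            also have "iexp (- (l * t)) * cnj (iexp (- (l * t'))) = iexp ((t' - t) * l)"
              unfolding exp_cnj exp_add[symmetric] by (simp add: algebra_simps)
            finally show ?thesis .
          qed
          then show ?thesis
            using gaussian_fourier_real(2)[of "2 * e" "t' - t"] e by simp
        qed
        then have "(\<integral>\<^sup>+ t'. ennreal (cmod (LINT l|lborel. ?k t l * cnj (?k t' l))) \<partial>lborel)
          = (\<integral>\<^sup>+ t'. ennreal (sqrt (pi / (2 * e))) * ennreal (exp (- (1 / (8 * e)) * (norm (t' - t))\<^sup>2)) \<partial>lborel)"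
          using e by (simp add: norm_mult ennreal_mult' del: of_real_mult)
        also have "\<dots> = ennreal (sqrt (pi / (2 * e))) * ennreal (sqrt (pi / (1 / (8 * e))) ^ DIM(real))"
          using e by (intro gaussian_integral_cmult) simp
        also have "\<dots> = ennreal (sqrt (pi / (2 * e) * (pi / (1 / (8 * e)))))"
        proof -
          have "0 \<le> sqrt (pi / (2 * e))" using e by simp
          then show ?thesis by (simp only: DIM_real power_one_right real_sqrt_mult ennreal_mult')
        qed
        \<comment> \<open>The height of the composed Gaussian and its width balance: e
          cancels.\<close>
        also have "pi / (2 * e) * (pi / (1 / (8 * e))) = (2 * pi)\<^sup>2"
          using e by (simp add: power2_eq_square)
        also have "sqrt ((2 * pi)\<^sup>2) = 2 * pi"
          unfolding real_sqrt_abs by simp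
        finally show ?thesis by simp
      qed
    qed (rule g)
    moreover have "(LINT t|lborel. g t * ?k t l) = of_real (exp (- e * l\<^sup>2)) * h l" for l
      unfolding h_def integral_mult_right_zero[symmetric] by (simp only: mult_ac)
    ultimately show ?thesis by (simp add: norm_mult)
  qed
  let ?e = "\<lambda>m. 1 / real (Suc m)"
  \<comment> \<open>The damping 1/(m+1) tends to 0; Fatou passes the uniform bound to the
    limit.\<close>
  have "(\<integral>\<^sup>+ l. ennreal ((cmod (h l))\<^sup>2) \<partial>lborel)
     = (\<integral>\<^sup>+ l. liminf (\<lambda>m. ennreal ((exp (- ?e m * l\<^sup>2) * cmod (h l))\<^sup>2)) \<partial>lborel)"
  proof (intro nn_integral_cong)
    fix l
    have "(\<lambda>m. (exp (- ?e m * l\<^sup>2) * cmod (h l))\<^sup>2) \<longlonglongrightarrow> (exp (- 0 * l\<^sup>2) * cmod (h l))\<^sup>2"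
      by (intro tendsto_intros LIMSEQ_Suc lim_1_over_n)
    then have "(\<lambda>m. ennreal ((exp (- ?e m * l\<^sup>2) * cmod (h l))\<^sup>2)) \<longlonglongrightarrow> ennreal ((cmod (h l))\<^sup>2)"
      by (intro tendsto_ennrealI) simp
    then show "ennreal ((cmod (h l))\<^sup>2) = liminf (\<lambda>m. ennreal ((exp (- ?e m * l\<^sup>2) * cmod (h l))\<^sup>2))"
      by (rule lim_imp_Liminf[OF trivial_limit_sequentially, symmetric])
  qed
  also have "\<dots> \<le> liminf (\<lambda>m. \<integral>\<^sup>+ l. ennreal ((exp (- ?e m * l\<^sup>2) * cmod (h l))\<^sup>2) \<partial>lborel)"
    by (rule nn_integral_liminf) measurable
  also have "\<dots> \<le> liminf (\<lambda>m. ennreal (2 * pi) * (\<integral>\<^sup>+ t. ennreal ((cmod (g t))\<^sup>2) \<partial>lborel))"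
    by (intro Liminf_mono always_eventually allI weighted) simp
  also have "\<dots> = ennreal (2 * pi) * (\<integral>\<^sup>+ t. ennreal ((cmod (g t))\<^sup>2) \<partial>lborel)"
    by (rule Liminf_const) simp
  finally show ?thesis by (simp only: h_def)
qed

text \<open>Since (1+r)/(1-r) = 1 + 2 r/(1-r), the exponent splits into the Gaussian factor of
  \<open>laguerre_fun\<close> and the exponent of the generating function at x = |l| v / 2. At r = 1
  both sides are 0 by the convention for division by zero, as n > 0.\<close>

lemma mehler_eq_generating_function:
  assumes n: "n > 0"
  shows "mehler n l r v = of_real (exp (- (1/4 * \<bar>l\<bar> * v))) *
     (exp (- of_real (1/2 * \<bar>l\<bar> * v) * (r * inverse (1 - r))) * inverse ((1 - r) ^ n))"
proof (cases "r = 1")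
  case False
  then have "(1 + r) / (1 - r) = 1 + 2 * (r * inverse (1 - r))" by (simp add: field_simps)
  then have "- mehler_rate l r * of_real v = of_real (- (1/4 * \<bar>l\<bar> * v)) + (- of_real (1/2 * \<bar>l\<bar> * v) * (r * inverse (1 - r)))"
    by (simp add: mehler_rate_def algebra_simps)
  then have "exp (- mehler_rate l r * of_real v) = of_real (exp (- (1/4 * \<bar>l\<bar> * v))) * exp (- of_real (1/2 * \<bar>l\<bar> * v) * (r * inverse (1 - r)))"
    by (simp only: exp_add exp_of_real)
  then show ?thesis by (simp only: mehler_def divide_inverse mult.assoc)
qed (use n in \<open>simp add: mehler_def power_0_left\<close>)

text \<open>The k-th Taylor coefficient of the Mehler function in r is the Laguerre function, so it
  can be isolated by integrating over a circle inside the disc.\<close>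

lemma mehler_circle_coefficient:
  fixes z :: "complex ^ 'n::finite"
  assumes \<rho>: "0 < \<rho>" "\<rho> < 1"
  shows "(LINT t|unit_interval. mehler CARD('n) l (of_real \<rho> * unit_char 1 t) ((norm z)\<^sup>2) * unit_char (- int k) t)
     = of_real (\<rho> ^ k * laguerre_fun k l z)"
proof -
  let ?n = "CARD('n)" and ?v = "(norm z)\<^sup>2"
  let ?f = "\<lambda>r. mehler ?n l r ?v"
  have n: "?n > 0" by simp
  have hol: "?f holomorphic_on ball 0 1"
    unfolding mehler_def mehler_rate_def by (intro holomorphic_intros) auto
  have "?f has_fps_expansion fps_const (of_real (exp (- (1/4 * \<bar>l\<bar> * ?v))))
      * Abs_fps (\<lambda>k. of_real (poly (laguerre (?n - 1) k) (1/2 * \<bar>l\<bar> * ?v)))"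
    unfolding mehler_eq_generating_function[OF n]
    by (intro has_fps_expansion_cmult_left laguerre_generating_function n)
  from fps_nth_fps_expansion[OF this, of k]
  have "(deriv ^^ k) ?f 0 / fact k = of_real (laguerre_fun k l z)"
    by (simp add: laguerre_fun_def mult.commute)
  then show ?thesis
    using circle_coefficient[OF hol \<rho>, of k] by simp
qed

lemma ennreal_le_of_mult_le:
  fixes S R :: ennreal
  assumes le: "\<And>c. 0 < c \<Longrightarrow> c < 1 \<Longrightarrow> ennreal c * S \<le> R"
  shows "S \<le> R"
proof (cases R)
  case (real x)
  show ?thesis
  proof (cases S)
    case (real s)
    have "s \<le> x"
    proof (rule field_le_mult_one_interval)
      fix c :: real assume c: "0 < c" "c < 1"
      then show "c * s \<le> x"
        using le[of c] real \<open>R = ennreal x\<close> \<open>0 \<le> x\<close> by (simp add: ennreal_mult'[symmetric])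
    qed
    then show ?thesis using real \<open>R = ennreal x\<close> by (simp add: ennreal_leI)
  next
    case top
    then show ?thesis using le[of "1/2"] real by (simp add: ennreal_mult_top top_unique)
  qed
qed simp

text \<open>For fixed w, the twisted convolutions with \<open>laguerre_fun k l\<close>, damped by
  \<rho>^k, are Fourier coefficients in t of one function \<open>h w\<close>, the twisted
  convolution with the Mehler kernel at r = \<rho> exp(2 pi i t). Bessel in t, Tonelli, and
  \<open>twisted_gaussian_bound\<close> at each t give the bound with a factor c < 1 lost, which
  finally tends to 1. The constant does not depend on N.\<close>

lemma twisted_bessel:
  fixes G :: "complex ^ 'n::finite \<Rightarrow> complex"
  assumes l: "l \<noteq> 0" and G: "integrable lborel G"
  shows "(\<Sum>k<N. \<integral>\<^sup>+ w. ennreal ((cmod (LINT z|lborel. G z * (twist l z w * of_real (laguerre_fun k l (w - z)))))\<^sup>2) \<partial>lborel)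
    \<le> ennreal ((8 * pi\<^sup>2 / l\<^sup>2) ^ CARD('n)) * (\<integral>\<^sup>+ z. ennreal ((cmod (G z))\<^sup>2) \<partial>lborel)"
    (is "?S \<le> ?R")
proof -
  let ?n = "CARD('n)"
  have Gm [measurable]: "G \<in> borel_measurable borel" using G by simp
  define A where "A = (\<lambda>k w. LINT z|lborel. G z * (twist l z w * of_real (laguerre_fun k l (w - z))))"
  interpret UL: pair_sigma_finite unit_interval "lborel :: (complex ^ 'n) measure"
    by (intro pair_sigma_finite.intro unit_interval.sigma_finite_measure_axioms lborel.sigma_finite_measure_axioms)
  interpret LU: pair_sigma_finite "lborel :: (complex ^ 'n) measure" unit_interval
    by (intro pair_sigma_finite.intro unit_interval.sigma_finite_measure_axioms lborel.sigma_finite_measure_axioms)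
  have twist_meas [measurable]: "(\<lambda>x. twist l (snd x) (fst x)) \<in> borel_measurable (lborel \<Otimes>\<^sub>M lborel)"
    unfolding lborel_prod twist_def
    by (simp, intro borel_measurable_continuous_onI continuous_intros) simp
  have A_meas [measurable]: "A k \<in> borel_measurable borel" for k
  proof -
    have "(\<lambda>x. laguerre_fun k l (fst x - snd x)) \<in> borel_measurable (lborel \<Otimes>\<^sub>M (lborel :: (complex ^ 'n) measure))"
      unfolding laguerre_fun_def by measurable
    note [measurable] = this
    have "(\<lambda>(w, z). G z * (twist l z w * of_real (laguerre_fun k l (w - z)))) \<in> borel_measurable (lborel \<Otimes>\<^sub>M lborel)"
      unfolding case_prod_beta' by measurable
    then show ?thesis unfolding A_def
      using lborel.borel_measurable_lebesgue_integral by auto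
  qed
  have main: "ennreal c * ?S \<le> ?R" if c: "0 < c" "c < 1" for c
  proof -
    \<comment> \<open>Chosen so that \<rho>^(2k) >= c for all k < N: the damping of the first N
      coefficients costs at most c. The successor keeps the degree of the root positive when N =
      0.\<close>
    define \<rho> where "\<rho> = root (2 * Suc N) c"
    have \<rho>: "0 < \<rho>" "\<rho> < 1" using c by (auto simp: \<rho>_def)
    have \<rho>c: "\<rho> ^ (2 * Suc N) = c" unfolding \<rho>_def using c by (intro real_root_pow_pos2) auto
    define r where "r = (\<lambda>t. of_real \<rho> * unit_char 1 t)"
    have r: "cmod (r t) = \<rho>" for t using \<rho> by (simp add: r_def norm_mult)
    have r1: "1 - r t \<noteq> 0" for t using r[of t] \<rho> by auto
    define m where "m = (\<lambda>t (u :: complex ^ 'n). mehler ?n l (r t) ((norm u)\<^sup>2))"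
    define C where "C = 1 / (1 - \<rho>) ^ ?n"
    have C: "C \<ge> 0" using \<rho> by (simp add: C_def)
    have mC: "cmod (m t u) \<le> C" for t u
      using norm_mehler_le[of "r t" "(norm u)\<^sup>2" ?n l] \<rho> by (simp add: m_def C_def r)
    have m_cont: "continuous_on UNIV (\<lambda>x. m (f x) (g x))" if "continuous_on UNIV f" "continuous_on UNIV g" 
      for f :: "'b::topological_space \<Rightarrow> real" and g
    proof -
      have "continuous_on UNIV (\<lambda>x. r (f x))" unfolding r_def by (intro continuous_intros that)
      moreover have "\<forall>x\<in>UNIV. 1 - r (f x) \<noteq> 0" "\<forall>x\<in>UNIV. (1 - r (f x)) ^ ?n \<noteq> 0" using r1 by simp_all
      ultimately show ?thesis
        unfolding m_def mehler_def mehler_rate_def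
        by (intro continuous_on_divide continuous_on_exp continuous_on_mult continuous_on_minus continuous_on_add
            continuous_on_diff continuous_on_power continuous_on_of_real continuous_on_norm continuous_on_const that)
    qed
    define h where "h = (\<lambda>w t. LINT z|lborel. G z * (twist l z w * m t (w - z)))"
    have "(\<lambda>x. m (snd (fst x)) (fst (fst x) - snd x)) \<in> borel_measurable (borel :: (((complex ^ 'n) \<times> real) \<times> (complex ^ 'n)) measure)"
      by (intro borel_measurable_continuous_onI m_cont continuous_intros)
    then have m_meas [measurable]: "(\<lambda>x. m (snd (fst x)) (fst (fst x) - snd x)) \<in> borel_measurable ((borel \<Otimes>\<^sub>M borel) \<Otimes>\<^sub>M (borel :: (complex ^ 'n) measure))"
      by (simp only: borel_prod)
    have "(\<lambda>x. twist l (snd x) (fst (fst x))) \<in> borel_measurable (borel :: (((complex ^ 'n) \<times> real) \<times> (complex ^ 'n)) measure)"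
      unfolding twist_def by (intro borel_measurable_continuous_onI continuous_intros)
    then have tw_meas [measurable]: "(\<lambda>x. twist l (snd x) (fst (fst x))) \<in> borel_measurable ((borel \<Otimes>\<^sub>M (borel :: real measure)) \<Otimes>\<^sub>M (borel :: (complex ^ 'n) measure))"
      by (simp only: borel_prod)
    have "(\<lambda>(x, z). G z * (twist l z (fst x) * m (snd x) (fst x - z))) \<in> borel_measurable ((borel \<Otimes>\<^sub>M borel) \<Otimes>\<^sub>M (borel :: (complex ^ 'n) measure))"
      unfolding case_prod_beta' by measurable
    then have "(\<lambda>(x, z). G z * (twist l z (fst x) * m (snd x) (fst x - z))) \<in> borel_measurable ((borel \<Otimes>\<^sub>M borel) \<Otimes>\<^sub>M lborel)"
      by (simp cong: measurable_cong_sets)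
    from lborel.borel_measurable_lebesgue_integral[OF this]
    have h_meas: "(\<lambda>x. h (fst x) (snd x)) \<in> borel_measurable (borel \<Otimes>\<^sub>M borel)"
      by (simp add: h_def)
    then have h_meas' [measurable]: "(\<lambda>x. h (fst x) (snd x)) \<in> borel_measurable (lborel \<Otimes>\<^sub>M unit_interval)"
      by (simp cong: measurable_cong_sets)
    have h_meas1 [measurable]: "h w \<in> borel_measurable borel" for w
      using measurable_compose[OF measurable_Pair1'[of w borel borel] h_meas] by simp
    have Gi: "integrable lborel (\<lambda>z. C * cmod (G z))" using G by simp
    have bd: "cmod (G z * (twist l z w * m t (w - z))) \<le> C * cmod (G z)" for z w t
      using mult_left_mono[OF mC, of "cmod (G z)" t "w - z"] by (simp add: norm_mult mult.commute)
    define Bd where "Bd = (LINT z|lborel. C * cmod (G z))"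
    have h_bdd: "cmod (h w t) \<le> Bd" for w t
    proof (cases "integrable lborel (\<lambda>z. G z * (twist l z w * m t (w - z)))")
      case True
      have "cmod (h w t) \<le> (LINT z|lborel. cmod (G z * (twist l z w * m t (w - z))))"
        unfolding h_def by (rule integral_norm_bound)
      also have "\<dots> \<le> Bd"
        unfolding Bd_def using True by (intro integral_mono Gi bd) simp
      finally show ?thesis .
    next
      case False
      then have "h w t = 0" unfolding h_def by (rule not_integrable_integral_eq)
      moreover have "Bd \<ge> 0" unfolding Bd_def using C by (intro integral_nonneg_AE) simp
      ultimately show ?thesis by simp
    qed
    have coef: "(LINT t|unit_interval. h w t * unit_char (- int k) t) = of_real (\<rho> ^ k) * A k w" for w k
    proof -
      have mw: "(\<lambda>x. m (fst x) (w - snd x)) \<in> borel_measurable (unit_interval \<Otimes>\<^sub>M (lborel :: (complex ^ 'n) measure))"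
      proof -
        have "(\<lambda>x. m (fst x) (w - snd x)) \<in> borel_measurable (borel :: (real \<times> (complex ^ 'n)) measure)"
          by (intro borel_measurable_continuous_onI m_cont continuous_intros)
        then show ?thesis by (simp add: borel_prod[symmetric] cong: measurable_cong_sets)
      qed
      note [measurable] = mw
      have [measurable]: "(\<lambda>z. twist l z w) \<in> borel_measurable borel"
        unfolding twist_def by (intro borel_measurable_continuous_onI continuous_intros)
      \<comment> \<open>On this fixed circle the Mehler kernel is bounded by C, so an integrable
        multiple of |G| dominates and the t and z integrals may be exchanged.\<close>
      have F_int: "integrable (unit_interval \<Otimes>\<^sub>M lborel) (\<lambda>(t, z). G z * (twist l z w * m t (w - z)) * unit_char (- int k) t)"
      proof (rule Bochner_Integration.integrable_bound)
        show "integrable (unit_interval \<Otimes>\<^sub>M lborel) (\<lambda>(t, z). 1 * complex_of_real (C * cmod (G z)))"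
          using Gi by (intro UL.integral_times_pair(1)) (simp, simp only: complex_of_real_integrable_eq)
        show "(\<lambda>(t, z). G z * (twist l z w * m t (w - z)) * unit_char (- int k) t) \<in> borel_measurable (unit_interval \<Otimes>\<^sub>M lborel)"
          unfolding case_prod_beta' by measurable
        show "AE x in unit_interval \<Otimes>\<^sub>M lborel. norm (case x of (t, z) \<Rightarrow> G z * (twist l z w * m t (w - z)) * unit_char (- int k) t)
            \<le> norm (case x of (t, z) \<Rightarrow> 1 * complex_of_real (C * cmod (G z)))"
        proof (intro AE_I2)
          fix x :: "real \<times> (complex ^ 'n)"
          show "norm (case x of (t, z) \<Rightarrow> G z * (twist l z w * m t (w - z)) * unit_char (- int k) t)
            \<le> norm (case x of (t, z) \<Rightarrow> 1 * complex_of_real (C * cmod (G z)))"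
            using bd[of "snd x" w "fst x"] C by (simp add: case_prod_beta' norm_mult)
        qed
      qed
      have "(LINT t|unit_interval. h w t * unit_char (- int k) t)
          = (LINT t|unit_interval. LINT z|lborel. G z * (twist l z w * m t (w - z)) * unit_char (- int k) t)"
        unfolding h_def by simp
      also have "\<dots> = (LINT z|lborel. LINT t|unit_interval. G z * (twist l z w * m t (w - z)) * unit_char (- int k) t)"
        by (rule UL.Fubini_integral[OF F_int, symmetric])
      also have "\<dots> = (LINT z|lborel. G z * (twist l z w * (LINT t|unit_interval. m t (w - z) * unit_char (- int k) t)))"
        by (simp add: mult.assoc)
      also have "\<dots> = (LINT z|lborel. of_real (\<rho> ^ k) * (G z * (twist l z w * of_real (laguerre_fun k l (w - z)))))"
        unfolding m_def r_def mehler_circle_coefficient[OF \<rho>] by (simp add: mult_ac)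
      also have "\<dots> = of_real (\<rho> ^ k) * A k w"
        unfolding A_def by (rule integral_mult_right_zero)
      finally show ?thesis .
    qed
    have pw: "ennreal c * (\<Sum>k<N. ennreal ((cmod (A k w))\<^sup>2)) \<le> (\<integral>\<^sup>+ t. ennreal ((cmod (h w t))\<^sup>2) \<partial>unit_interval)" for w
    proof -
      have "c * (\<Sum>k<N. (cmod (A k w))\<^sup>2) \<le> (\<Sum>k<N. (\<rho> ^ k)\<^sup>2 * (cmod (A k w))\<^sup>2)"
        unfolding sum_distrib_left
      proof (intro sum_mono mult_right_mono)
        fix k assume "k \<in> {..<N}"
        then show "c \<le> (\<rho> ^ k)\<^sup>2"
          unfolding \<rho>c[symmetric] power_mult[symmetric] using \<rho> by (intro power_decreasing) auto
      qed simp
      also have "\<dots> = (\<Sum>k<N. (cmod (LINT t|unit_interval. h w t * unit_char (- int k) t))\<^sup>2)"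
        using \<rho> by (simp add: coef norm_mult norm_power power_mult_distrib)
      also have "\<dots> \<le> (LINT t|unit_interval. (cmod (h w t))\<^sup>2)"
        by (rule bessel_unit_interval[OF _ h_bdd]) measurable
      finally have "ennreal (c * (\<Sum>k<N. (cmod (A k w))\<^sup>2)) \<le> ennreal (LINT t|unit_interval. (cmod (h w t))\<^sup>2)"
        by (rule ennreal_leI)
      also have "\<dots> = (\<integral>\<^sup>+ t. ennreal ((cmod (h w t))\<^sup>2) \<partial>unit_interval)"
      proof (rule nn_integral_eq_integral[symmetric])
        show "integrable unit_interval (\<lambda>t. (cmod (h w t))\<^sup>2)"
          by (rule unit_interval.integrable_const_bound[of _ "Bd\<^sup>2"])
             (auto intro!: power_mono h_bdd)
      qed simp
      finally show ?thesis using c by (simp add: ennreal_mult')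
    qed
    have "?S = (\<Sum>k<N. \<integral>\<^sup>+ w. ennreal ((cmod (A k w))\<^sup>2) \<partial>lborel)"
      by (simp only: A_def)
    then have "ennreal c * ?S = (\<integral>\<^sup>+ w. ennreal c * (\<Sum>k<N. ennreal ((cmod (A k w))\<^sup>2)) \<partial>lborel)"
      by (simp add: nn_integral_cmult nn_integral_sum del: sum_ennreal)
    also have "\<dots> \<le> (\<integral>\<^sup>+ w. \<integral>\<^sup>+ t. ennreal ((cmod (h w t))\<^sup>2) \<partial>unit_interval \<partial>lborel)"
      by (intro nn_integral_mono pw)
    also have "\<dots> = (\<integral>\<^sup>+ t. \<integral>\<^sup>+ w. ennreal ((cmod (h w t))\<^sup>2) \<partial>lborel \<partial>unit_interval)"
      by (rule LU.Fubini'[symmetric]) (use h_meas' in \<open>simp add: case_prod_beta'\<close>)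
    \<comment> \<open>Every point of the circle has modulus \<rho> < 1 and the bound is the same at
      each of them, so averaging over the circle preserves it.\<close>
    also have "\<dots> \<le> (\<integral>\<^sup>+ t. ?R \<partial>unit_interval)"
      unfolding h_def m_def by (intro nn_integral_mono twisted_gaussian_bound l G) (simp add: r \<rho>)
    also have "\<dots> = ?R"
      by (simp add: emeasure_unit_interval)
    finally show ?thesis .
  qed
  show ?thesis by (rule ennreal_le_of_mult_le) (rule main)
qed

section \<open>Interpolation\<close>

lemma nn_integral_powr_from_0:
  assumes "e > -1" "c \<ge> 0"
  shows "(\<integral>\<^sup>+ s. (if 0 < s \<and> s < c then ennreal (s powr e) else 0) \<partial>lborel) = ennreal (c powr (e + 1) / (e + 1))"
proof -
  have "(\<integral>\<^sup>+ s. (if 0 < s \<and> s < c then ennreal (s powr e) else 0) \<partial>lborel)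
     = (\<integral>\<^sup>+ s. ennreal (s powr e) * indicator {0..c} s \<partial>lborel)"
    by (rule nn_integral_cong_AE)
       (use AE_lborel_singleton[of c] in eventually_elim, auto split: split_indicator)
  also have "\<dots> = ennreal (c powr (e + 1) / (e + 1))"
    by (rule nn_integral_has_integral_lebesgue'[OF _ has_integral_powr_from_0[OF assms]]) simp
  finally show ?thesis .
qed

lemma nn_integral_powr_to_inf:
  assumes "e < -1" "c > 0"
  shows "(\<integral>\<^sup>+ s. (if 0 < s \<and> c \<le> s then ennreal (s powr e) else 0) \<partial>lborel) = ennreal (- (c powr (e + 1)) / (e + 1))"
proof -
  have "(\<integral>\<^sup>+ s. (if 0 < s \<and> c \<le> s then ennreal (s powr e) else 0) \<partial>lborel)
     = (\<integral>\<^sup>+ s. ennreal (s powr e) * indicator {c..} s \<partial>lborel)"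
    using assms by (intro nn_integral_cong) (auto split: split_indicator)
  also have "\<dots> = ennreal (- (c powr (e + 1)) / (e + 1))"
    by (rule nn_integral_has_integral_lebesgue'[OF _ has_integral_powr_to_inf[OF assms]]) simp
  finally show ?thesis .
qed

lemma UN_superlevel_sets:
  assumes pos: "\<And>a. a \<in> space M \<Longrightarrow> (0::real) < \<phi> a"
  shows "(\<Union>m::nat. {a \<in> space M. 1 / Suc m < \<phi> a}) = space M"
proof (intro equalityI subsetI)
  fix a assume a: "a \<in> space M"
  then obtain m where "inverse (real (Suc m)) < \<phi> a"
    using reals_Archimedean[OF pos[OF a]] by blast
  then show "a \<in> (\<Union>m::nat. {a \<in> space M. 1 / Suc m < \<phi> a})"
    using a by (auto simp: divide_inverse intro!: exI[of _ m])
qed auto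

text \<open>A positive weak-L1 function provides its own exhaustion: the superlevel sets at 1/(m+1)
  have finite measure and cover the space. The Fubini arguments of the interpolation rely on
  this.\<close>

lemma sigma_finite_measure_of_weak_L1:
  assumes [measurable]: "\<phi> \<in> borel_measurable M" and pos: "\<And>a. a \<in> space M \<Longrightarrow> (0::real) < \<phi> a"
    and weak: "\<And>s. s > 0 \<Longrightarrow> ennreal s * emeasure M {a \<in> space M. s < \<phi> a} \<le> ennreal w"
  shows "sigma_finite_measure M"
proof
  let ?A = "\<lambda>m::nat. {a \<in> space M. 1 / Suc m < \<phi> a}"
  have "emeasure M (?A m) \<noteq> \<infinity>" for m
    using weak[of "1 / Suc m"] by (auto simp: ennreal_mult_top top_unique)
  moreover have "(\<Union>m. ?A m) = space M"
    by (rule UN_superlevel_sets[OF pos])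
  moreover have "?A m \<in> sets M" for m by measurable
  ultimately show "\<exists>A. countable A \<and> A \<subseteq> sets M \<and> \<Union> A = space M \<and> (\<forall>a\<in>A. emeasure M a \<noteq> \<infinity>)"
    by (intro exI[of _ "range ?A"]) auto
qed

text \<open>Layer cake: \<phi>^2 is the integral of 2s over 0 < s < \<phi>. Exchanging the order
  leaves 2s M{\<phi> > s} <= 2w for s in (0, v), which integrates to 2vw.\<close>

lemma weak_L1_square_integral:
  assumes [measurable]: "\<phi> \<in> borel_measurable M" and pos: "\<And>a. a \<in> space M \<Longrightarrow> (0::real) < \<phi> a"
    and weak: "\<And>s. s > 0 \<Longrightarrow> ennreal s * emeasure M {a \<in> space M. s < \<phi> a} \<le> ennreal w"
    and v: "v \<ge> 0" and w: "w \<ge> 0"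
  shows "(\<integral>\<^sup>+ a. (if \<phi> a < v then ennreal ((\<phi> a)\<^sup>2) else 0) \<partial>M) \<le> ennreal (2 * v * w)"
proof -
  interpret M: sigma_finite_measure M by (rule sigma_finite_measure_of_weak_L1[OF assms(1-3)])
  interpret MR: pair_sigma_finite M "lborel :: real measure" ..
  let ?h = "\<lambda>a s. if 0 < s \<and> s < \<phi> a \<and> s < v then ennreal (2 * s) else 0"
  have "(\<integral>\<^sup>+ a. (if \<phi> a < v then ennreal ((\<phi> a)\<^sup>2) else 0) \<partial>M) \<le> (\<integral>\<^sup>+ a. \<integral>\<^sup>+ s. ?h a s \<partial>lborel \<partial>M)"
  proof (intro nn_integral_mono)
    fix a assume a: "a \<in> space M"
    show "(if \<phi> a < v then ennreal ((\<phi> a)\<^sup>2) else 0) \<le> (\<integral>\<^sup>+ s. ?h a s \<partial>lborel)"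
    proof (cases "\<phi> a < v")
      case True
      have "ennreal ((\<phi> a)\<^sup>2) = ennreal 2 * ennreal (\<phi> a powr (1 + 1) / (1 + 1))"
        using pos[OF a] by (subst ennreal_mult'[symmetric]) (simp_all add: powr_numeral)
      also have "\<dots> = (\<integral>\<^sup>+ s. ennreal 2 * (if 0 < s \<and> s < \<phi> a then ennreal (s powr 1) else 0) \<partial>lborel)"
        using pos[OF a] by (subst nn_integral_cmult) (auto simp: nn_integral_powr_from_0[of 1 "\<phi> a"])
      also have "\<dots> \<le> (\<integral>\<^sup>+ s. ?h a s \<partial>lborel)"
        using True by (intro nn_integral_mono) (auto simp: ennreal_mult')
      finally show ?thesis using True by simp
    qed simp
  qed
  also have "\<dots> = (\<integral>\<^sup>+ s. \<integral>\<^sup>+ a. ?h a s \<partial>M \<partial>lborel)"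
    by (rule MR.Fubini'[symmetric]) measurable
  also have "\<dots> \<le> (\<integral>\<^sup>+ s. ennreal (2 * w) * indicator {0..v} s \<partial>lborel)"
  proof (intro nn_integral_mono)
    fix s :: real
    show "(\<integral>\<^sup>+ a. ?h a s \<partial>M) \<le> ennreal (2 * w) * indicator {0..v} s"
    proof (cases "0 < s \<and> s < v")
      case True
      have "(\<integral>\<^sup>+ a. ?h a s \<partial>M) = (\<integral>\<^sup>+ a. ennreal (2 * s) * indicator {a \<in> space M. s < \<phi> a} a \<partial>M)"
        using True by (intro nn_integral_cong) (auto split: split_indicator)
      also have "\<dots> = ennreal (2 * s) * emeasure M {a \<in> space M. s < \<phi> a}"
        by (subst nn_integral_cmult_indicator) auto
      also have "\<dots> = 2 * (ennreal s * emeasure M {a \<in> space M. s < \<phi> a})"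
        using True by (simp add: ennreal_mult' mult.assoc)
      also have "\<dots> \<le> 2 * ennreal w"
        using True by (intro mult_left_mono weak) auto
      finally show ?thesis using True w by (simp add: ennreal_mult')
    next
      case False
      then have "(\<lambda>a. ?h a s) = (\<lambda>a. 0)" by auto
      then show ?thesis by simp
    qed
  qed
  also have "\<dots> = ennreal (2 * v * w)"
    using v w by (subst nn_integral_cmult_indicator) (auto simp: ennreal_mult'[symmetric] mult_ac)
  finally show ?thesis .
qed

text \<open>Marcinkiewicz interpolation between (1,1) and (2,2). \<open>Q\<close> stands for the
  square of the sublinear operator, hence the quasi-subadditivity with factor 2, the squared L1
  bound and the exponent p/2. The change of measure is implicit: the level sets of T = sqrt(Q
  f)/\<phi> are weighted by \<phi>^2.\<close>

lemma paley_interpolation: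
  fixes M :: "'a measure" and N :: "'b measure" and Q :: "('b \<Rightarrow> complex) \<Rightarrow> 'a \<Rightarrow> ennreal"
  assumes p: "1 < p" "p < 2" and A: "A \<ge> 0" and B: "B \<ge> 0"
    and N: "sigma_finite_measure N"
    and \<phi> [measurable]: "\<phi> \<in> borel_measurable M" and pos: "\<And>a. a \<in> space M \<Longrightarrow> 0 < \<phi> a"
    and w: "w > 0" and weak: "\<And>s. s > 0 \<Longrightarrow> ennreal s * emeasure M {a \<in> space M. s < \<phi> a} \<le> ennreal w"
    and Qm: "\<And>g. integrable N g \<Longrightarrow> Q g \<in> borel_measurable M"
    and sub: "\<And>g h a. integrable N g \<Longrightarrow> integrable N h \<Longrightarrow> Q (\<lambda>x. g x + h x) a \<le> 2 * Q g a + 2 * Q h a"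
    and L1: "\<And>g a. integrable N g \<Longrightarrow> a \<in> space M \<Longrightarrow> Q g a \<le> ennreal ((A * (LINT x|N. cmod (g x)))\<^sup>2)"
    and L2: "\<And>g. integrable N g \<Longrightarrow> (\<integral>\<^sup>+ a. Q g a \<partial>M) \<le> ennreal B * (\<integral>\<^sup>+ x. ennreal ((cmod (g x))\<^sup>2) \<partial>N)"
    and f: "integrable N f"
  shows "(\<integral>\<^sup>+ a. enn_powr (Q f a) (p / 2) * ennreal (\<phi> a powr (2 - p)) \<partial>M)
    \<le> ennreal ((4 * A * p / (p - 1) + 4 * B * p / (2 - p)) * w powr (2 - p)) * (\<integral>\<^sup>+ x. ennreal (cmod (f x) powr p) \<partial>N)"
proof -
  interpret M: sigma_finite_measure M by (rule sigma_finite_measure_of_weak_L1[OF \<phi> pos weak])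
  interpret N: sigma_finite_measure N by (rule N)
  interpret MR: pair_sigma_finite M "lborel :: real measure" ..
  interpret NR: pair_sigma_finite N "lborel :: real measure" ..
  note [measurable] = Qm[OF f]
  have [measurable]: "f \<in> borel_measurable N" using f by simp
  \<comment> \<open>The pointwise L1 bound makes Q f finite on the space, so passing to real numbers
    loses nothing.\<close>
  define q where "q = (\<lambda>a. sqrt (enn2real (Q f a)))"
  have q [measurable]: "q \<in> borel_measurable M" unfolding q_def by measurable
  have q0: "q a \<ge> 0" for a by (simp add: q_def)
  have Qq: "Q f a = ennreal ((q a)\<^sup>2)" if "a \<in> space M" for a
    using order_le_less_trans[OF L1[OF f that] ennreal_less_top] by (simp add: q_def)
  define T where "T = (\<lambda>a. q a / \<phi> a)"
  have T [measurable]: "T \<in> borel_measurable M" unfolding T_def by measurable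
  \<comment> \<open>At level s the function is cut at height w s: the tall part g is sent to the L1
    bound, the low part h to the L2 bound. The factor w is what gives both terms the same power of w
    at the end.\<close>
  define g where "g = (\<lambda>s x. if w * s < cmod (f x) then f x else 0)"
  define h where "h = (\<lambda>s x. if w * s < cmod (f x) then 0 else f x)"
  have g_int: "integrable N (g s)" and h_int: "integrable N (h s)" for s
    by (rule Bochner_Integration.integrable_bound[OF f]; simp add: g_def h_def)+
  have level: "(\<integral>\<^sup>+ a. (if s < T a then ennreal ((\<phi> a)\<^sup>2) else 0) \<partial>M)
     \<le> ennreal (4 * A * w / s) * (\<integral>\<^sup>+ x. (if w * s < cmod (f x) then ennreal (cmod (f x)) else 0) \<partial>N)
      + ennreal (4 * B / s\<^sup>2) * (\<integral>\<^sup>+ x. (if w * s < cmod (f x) then 0 else ennreal ((cmod (f x))\<^sup>2)) \<partial>N)"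
    if s: "s > 0" for s
  proof -
    note [measurable] = Qm[OF g_int] Qm[OF h_int]
    \<comment> \<open>Where \<phi> is at least v, the L1 bound yields sqrt(Q g) <= s \<phi> / 2, so
      the exceptional set for g lies in {\<phi> < v}, on which the weak norm controls
      \<phi>^2.\<close>
    define v where "v = 2 * A * (LINT x|N. cmod (g s x)) / s"
    have v0: "v \<ge> 0" unfolding v_def using A s by simp
    have "(\<integral>\<^sup>+ a. (if s < T a then ennreal ((\<phi> a)\<^sup>2) else 0) \<partial>M)
      \<le> (\<integral>\<^sup>+ a. (if \<phi> a < v then ennreal ((\<phi> a)\<^sup>2) else 0) + ennreal (4 / s\<^sup>2) * Q (h s) a \<partial>M)"
    proof (intro nn_integral_mono)
      fix a assume a: "a \<in> space M"
      note pa = pos[OF a]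
      show "(if s < T a then ennreal ((\<phi> a)\<^sup>2) else 0) \<le> (if \<phi> a < v then ennreal ((\<phi> a)\<^sup>2) else 0) + ennreal (4 / s\<^sup>2) * Q (h s) a"
      proof (cases "s < T a \<and> \<not> \<phi> a < v")
        case True
        then have "s * \<phi> a < q a" using pa by (simp add: T_def field_simps)
        then have "(s * \<phi> a)\<^sup>2 < (q a)\<^sup>2" using s pa by (intro power_strict_mono) auto
        then have gt: "ennreal ((s * \<phi> a)\<^sup>2) < Q f a"
          unfolding Qq[OF a] by (simp only: ennreal_less_iff zero_le_power2)
        have "A * (LINT x|N. cmod (g s x)) \<le> s * \<phi> a / 2"
          using True s by (simp add: v_def field_simps)
        then have "(A * (LINT x|N. cmod (g s x)))\<^sup>2 \<le> (s * \<phi> a / 2)\<^sup>2"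
          using A by (intro power_mono) auto
        then have g4: "Q (g s) a \<le> ennreal ((s * \<phi> a)\<^sup>2 / 4)"
          using order_trans[OF L1[OF g_int a] ennreal_leI] by (simp add: power_divide)
        have "f = (\<lambda>x. g s x + h s x)" by (auto simp: g_def h_def)
        then have "Q f a \<le> 2 * Q (g s) a + 2 * Q (h s) a" using sub[OF g_int h_int] by metis
        \<comment> \<open>Q f exceeds (s \<phi>)^2 while 2 Q g takes up at most half of it, so 2 Q h
          must supply the other half; this pointwise Chebyshev bound explains the factor 4 /
          s^2.\<close>
        have "ennreal ((s * \<phi> a)\<^sup>2 / 4) \<le> Q (h s) a"
        proof (rule ccontr)
          assume "\<not> ?thesis"
          then have "Q (h s) a \<le> ennreal ((s * \<phi> a)\<^sup>2 / 4)" by simp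
          then have "2 * Q (g s) a + 2 * Q (h s) a \<le> 2 * ennreal ((s * \<phi> a)\<^sup>2 / 4) + 2 * ennreal ((s * \<phi> a)\<^sup>2 / 4)"
            using g4 by (intro add_mono mult_left_mono) auto
          also have "\<dots> = ennreal (2 * ((s * \<phi> a)\<^sup>2 / 4) + 2 * ((s * \<phi> a)\<^sup>2 / 4))"
            by (subst ennreal_plus) (auto simp: ennreal_mult' simp del: times_divide_eq_right)
          also have "2 * ((s * \<phi> a)\<^sup>2 / 4) + 2 * ((s * \<phi> a)\<^sup>2 / 4) = (s * \<phi> a)\<^sup>2" by simp
          finally show False using gt \<open>Q f a \<le> 2 * Q (g s) a + 2 * Q (h s) a\<close> by (meson leD order_trans)
        qed
        then have "ennreal (4 / s\<^sup>2) * ennreal ((s * \<phi> a)\<^sup>2 / 4) \<le> ennreal (4 / s\<^sup>2) * Q (h s) a"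
          by (rule mult_left_mono) simp
        moreover have "ennreal (4 / s\<^sup>2) * ennreal ((s * \<phi> a)\<^sup>2 / 4) = ennreal ((\<phi> a)\<^sup>2)"
          using s by (simp add: ennreal_mult'[symmetric] power_mult_distrib)
        ultimately show ?thesis using True by simp
      qed auto
    qed
    also have "\<dots> = (\<integral>\<^sup>+ a. (if \<phi> a < v then ennreal ((\<phi> a)\<^sup>2) else 0) \<partial>M) + ennreal (4 / s\<^sup>2) * (\<integral>\<^sup>+ a. Q (h s) a \<partial>M)"
      by (subst nn_integral_add) (auto simp: nn_integral_cmult)
    also have "\<dots> \<le> ennreal (2 * v * w) + ennreal (4 / s\<^sup>2) * (ennreal B * (\<integral>\<^sup>+ x. ennreal ((cmod (h s x))\<^sup>2) \<partial>N))"
      by (intro add_mono mult_left_mono weak_L1_square_integral[OF \<phi> pos weak] L2 h_int v0 less_imp_le[OF w]) auto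
    also have "ennreal (2 * v * w) = ennreal (4 * A * w / s) * ennreal (LINT x|N. cmod (g s x))"
      using A w s by (simp add: v_def ennreal_mult'[symmetric] mult_ac)
    also have "ennreal (LINT x|N. cmod (g s x)) = (\<integral>\<^sup>+ x. (if w * s < cmod (f x) then ennreal (cmod (f x)) else 0) \<partial>N)"
      using g_int by (subst nn_integral_eq_integral[symmetric]) (auto simp: g_def intro!: nn_integral_cong)
    also have "ennreal (4 / s\<^sup>2) * (ennreal B * (\<integral>\<^sup>+ x. ennreal ((cmod (h s x))\<^sup>2) \<partial>N))
       = ennreal (4 * B / s\<^sup>2) * (\<integral>\<^sup>+ x. ennreal ((cmod (h s x))\<^sup>2) \<partial>N)"
      using B by (simp add: mult.assoc[symmetric] ennreal_mult'[symmetric])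
    also have "(\<integral>\<^sup>+ x. ennreal ((cmod (h s x))\<^sup>2) \<partial>N) = (\<integral>\<^sup>+ x. (if w * s < cmod (f x) then 0 else ennreal ((cmod (f x))\<^sup>2)) \<partial>N)"
      by (intro nn_integral_cong) (auto simp: h_def)
    finally show ?thesis .
  qed
  let ?G = "\<lambda>x s. if 0 < s \<and> w * s < cmod (f x) then ennreal (cmod (f x)) * ennreal (s powr (p - 2)) else 0"
  let ?H = "\<lambda>x s. if 0 < s \<and> \<not> w * s < cmod (f x) then ennreal ((cmod (f x))\<^sup>2) * ennreal (s powr (p - 3)) else 0"
  \<comment> \<open>Layer cake for T^p; the powers of \<phi> combine because \<phi>^2 (q/\<phi>)^p =
    q^p \<phi>^(2-p).\<close>
  have "(\<integral>\<^sup>+ a. enn_powr (Q f a) (p / 2) * ennreal (\<phi> a powr (2 - p)) \<partial>M)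
     = (\<integral>\<^sup>+ a. \<integral>\<^sup>+ s. (if 0 < s \<and> s < T a then ennreal ((\<phi> a)\<^sup>2) * ennreal (p * s powr (p - 1)) else 0) \<partial>lborel \<partial>M)"
  proof (intro nn_integral_cong)
    fix a assume a: "a \<in> space M"
    note pa = pos[OF a]
    have T0: "T a \<ge> 0" using q0[of a] pa by (simp add: T_def)
    have "(\<integral>\<^sup>+ s. (if 0 < s \<and> s < T a then ennreal ((\<phi> a)\<^sup>2) * ennreal (p * s powr (p - 1)) else 0) \<partial>lborel)
       = (\<integral>\<^sup>+ s. ennreal ((\<phi> a)\<^sup>2 * p) * (if 0 < s \<and> s < T a then ennreal (s powr (p - 1)) else 0) \<partial>lborel)"
      using p by (intro nn_integral_cong) (auto simp: ennreal_mult'[symmetric] mult.assoc)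
    also have "\<dots> = ennreal ((\<phi> a)\<^sup>2 * p) * ennreal (T a powr p / p)"
      using T0 p by (subst nn_integral_cmult) (auto simp: nn_integral_powr_from_0)
    also have "\<dots> = ennreal ((\<phi> a)\<^sup>2 * T a powr p)"
      using p by (simp add: ennreal_mult'[symmetric])
    also have "(\<phi> a)\<^sup>2 * T a powr p = q a powr p * \<phi> a powr (2 - p)"
      using pa q0[of a] by (simp add: T_def powr_divide powr_diff powr_numeral)
    also have "ennreal (q a powr p * \<phi> a powr (2 - p)) = enn_powr (Q f a) (p / 2) * ennreal (\<phi> a powr (2 - p))"
    proof -
      have "((q a)\<^sup>2) powr (p / 2) = q a powr p"
        using q0[of a] by (cases "q a = 0") (auto simp: powr_powr simp flip: powr_numeral)
      then show ?thesis using p a by (simp add: enn_powr_def Qq ennreal_mult')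
    qed
    finally show "enn_powr (Q f a) (p / 2) * ennreal (\<phi> a powr (2 - p)) = (\<integral>\<^sup>+ s. (if 0 < s \<and> s < T a then ennreal ((\<phi> a)\<^sup>2) * ennreal (p * s powr (p - 1)) else 0) \<partial>lborel)" ..
  qed
  also have "\<dots> = (\<integral>\<^sup>+ s. \<integral>\<^sup>+ a. (if 0 < s \<and> s < T a then ennreal ((\<phi> a)\<^sup>2) * ennreal (p * s powr (p - 1)) else 0) \<partial>M \<partial>lborel)"
    by (rule MR.Fubini'[symmetric]) measurable
  also have "\<dots> \<le> (\<integral>\<^sup>+ s. ennreal (4 * A * w * p) * (\<integral>\<^sup>+ x. ?G x s \<partial>N) + ennreal (4 * B * p) * (\<integral>\<^sup>+ x. ?H x s \<partial>N) \<partial>lborel)"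
  proof (intro nn_integral_mono)
    fix s :: real
    show "(\<integral>\<^sup>+ a. (if 0 < s \<and> s < T a then ennreal ((\<phi> a)\<^sup>2) * ennreal (p * s powr (p - 1)) else 0) \<partial>M)
      \<le> ennreal (4 * A * w * p) * (\<integral>\<^sup>+ x. ?G x s \<partial>N) + ennreal (4 * B * p) * (\<integral>\<^sup>+ x. ?H x s \<partial>N)"
    proof (cases "s > 0")
      case s: True
      have "(\<integral>\<^sup>+ a. (if 0 < s \<and> s < T a then ennreal ((\<phi> a)\<^sup>2) * ennreal (p * s powr (p - 1)) else 0) \<partial>M)
         = (\<integral>\<^sup>+ a. ennreal (p * s powr (p - 1)) * (if s < T a then ennreal ((\<phi> a)\<^sup>2) else 0) \<partial>M)"
        using s by (intro nn_integral_cong) (auto simp: mult.commute)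
      also have "\<dots> = ennreal (p * s powr (p - 1)) * (\<integral>\<^sup>+ a. (if s < T a then ennreal ((\<phi> a)\<^sup>2) else 0) \<partial>M)"
        by (rule nn_integral_cmult) measurable
      also have "\<dots> \<le> ennreal (p * s powr (p - 1)) *
         (ennreal (4 * A * w / s) * (\<integral>\<^sup>+ x. (if w * s < cmod (f x) then ennreal (cmod (f x)) else 0) \<partial>N)
        + ennreal (4 * B / s\<^sup>2) * (\<integral>\<^sup>+ x. (if w * s < cmod (f x) then 0 else ennreal ((cmod (f x))\<^sup>2)) \<partial>N))"
        by (rule mult_left_mono[OF level[OF s]]) simp
      also have "\<dots> = (ennreal (p * s powr (p - 1)) * ennreal (4 * A * w / s)) * (\<integral>\<^sup>+ x. (if w * s < cmod (f x) then ennreal (cmod (f x)) else 0) \<partial>N)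
        + (ennreal (p * s powr (p - 1)) * ennreal (4 * B / s\<^sup>2)) * (\<integral>\<^sup>+ x. (if w * s < cmod (f x) then 0 else ennreal ((cmod (f x))\<^sup>2)) \<partial>N)"
        by (simp only: distrib_left mult.assoc)
      also have "ennreal (p * s powr (p - 1)) * ennreal (4 * A * w / s) = ennreal (4 * A * w * p) * ennreal (s powr (p - 2))"
      proof -
        have "s powr (p - 1) / s = s powr (p - 2)" using s by (simp add: powr_diff power2_eq_square powr_numeral)
        from this[symmetric] have "p * s powr (p - 1) * (4 * A * w / s) = 4 * A * w * p * s powr (p - 2)"
          by (simp only:) simp
        then show ?thesis using p A w s by (simp only: ennreal_mult''[symmetric] powr_ge_zero divide_nonneg_pos mult_nonneg_nonneg less_imp_le zero_le_numeral)
      qed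
      also have "ennreal (p * s powr (p - 1)) * ennreal (4 * B / s\<^sup>2) = ennreal (4 * B * p) * ennreal (s powr (p - 3))"
      proof -
        have "s powr (p - 1) / s\<^sup>2 = s powr (p - 3)"
          using s by (simp add: powr_diff power2_eq_square powr_numeral power3_eq_cube)
        from this[symmetric] have "p * s powr (p - 1) * (4 * B / s\<^sup>2) = 4 * B * p * s powr (p - 3)"
          by (simp only:) simp
        then show ?thesis using p B s by (simp only: ennreal_mult''[symmetric] powr_ge_zero divide_nonneg_nonneg zero_le_power2 mult_nonneg_nonneg zero_le_numeral)
      qed
      also have "ennreal (4 * A * w * p) * ennreal (s powr (p - 2)) * (\<integral>\<^sup>+ x. (if w * s < cmod (f x) then ennreal (cmod (f x)) else 0) \<partial>N)
         = ennreal (4 * A * w * p) * (\<integral>\<^sup>+ x. ?G x s \<partial>N)"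
        unfolding mult.assoc using s
        by (subst nn_integral_cmult[symmetric]) (auto intro!: arg_cong2[where f="(*)"] nn_integral_cong simp: mult.commute)
      also have "ennreal (4 * B * p) * ennreal (s powr (p - 3)) * (\<integral>\<^sup>+ x. (if w * s < cmod (f x) then 0 else ennreal ((cmod (f x))\<^sup>2)) \<partial>N)
         = ennreal (4 * B * p) * (\<integral>\<^sup>+ x. ?H x s \<partial>N)"
        unfolding mult.assoc using s
        by (subst nn_integral_cmult[symmetric]) (auto intro!: arg_cong2[where f="(*)"] nn_integral_cong simp: mult.commute)
      finally show ?thesis .
    qed simp
  qed
  also have "\<dots> = ennreal (4 * A * w * p) * (\<integral>\<^sup>+ s. \<integral>\<^sup>+ x. ?G x s \<partial>N \<partial>lborel) + ennreal (4 * B * p) * (\<integral>\<^sup>+ s. \<integral>\<^sup>+ x. ?H x s \<partial>N \<partial>lborel)"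
    by (subst nn_integral_add) (auto simp: nn_integral_cmult)
  also have "(\<integral>\<^sup>+ s. \<integral>\<^sup>+ x. ?G x s \<partial>N \<partial>lborel) = (\<integral>\<^sup>+ x. \<integral>\<^sup>+ s. ?G x s \<partial>lborel \<partial>N)"
    by (rule NR.Fubini') measurable
  also have "(\<integral>\<^sup>+ s. \<integral>\<^sup>+ x. ?H x s \<partial>N \<partial>lborel) = (\<integral>\<^sup>+ x. \<integral>\<^sup>+ s. ?H x s \<partial>lborel \<partial>N)"
    by (rule NR.Fubini') measurable
  \<comment> \<open>For fixed x the tall part is present for s < |f x| / w; s^(p-2) is integrable at
    0 because p > 1.\<close>
  also have "(\<integral>\<^sup>+ x. \<integral>\<^sup>+ s. ?G x s \<partial>lborel \<partial>N) = (\<integral>\<^sup>+ x. ennreal (w powr (1 - p) / (p - 1)) * ennreal (cmod (f x) powr p) \<partial>N)"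
  proof (intro nn_integral_cong)
    fix x
    have "(\<integral>\<^sup>+ s. ?G x s \<partial>lborel) = (\<integral>\<^sup>+ s. ennreal (cmod (f x)) * (if 0 < s \<and> s < cmod (f x) / w then ennreal (s powr (p - 2)) else 0) \<partial>lborel)"
      using w by (intro nn_integral_cong) (auto simp: field_simps)
    also have "\<dots> = ennreal (cmod (f x)) * ennreal ((cmod (f x) / w) powr (p - 2 + 1) / (p - 2 + 1))"
      by (subst nn_integral_cmult, measurable, subst nn_integral_powr_from_0) (use w p in auto)
    also have "\<dots> = ennreal (cmod (f x) * ((cmod (f x) / w) powr (p - 1) / (p - 1)))"
      unfolding ennreal_mult'[OF norm_ge_zero] by simp
    also have "cmod (f x) * ((cmod (f x) / w) powr (p - 1) / (p - 1)) = w powr (1 - p) / (p - 1) * cmod (f x) powr p"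
      using w p by (cases "f x = 0") (auto simp: powr_divide powr_diff field_simps)
    finally show "(\<integral>\<^sup>+ s. ?G x s \<partial>lborel) = ennreal (w powr (1 - p) / (p - 1)) * ennreal (cmod (f x) powr p)"
      by (simp only: ennreal_mult'' powr_ge_zero)
  qed
  \<comment> \<open>The low part is present for s >= |f x| / w; s^(p-3) is integrable at infinity
    because p < 2. Zeros of f are separated, as the lower limit must be positive.\<close>
  also have "(\<integral>\<^sup>+ x. \<integral>\<^sup>+ s. ?H x s \<partial>lborel \<partial>N) = (\<integral>\<^sup>+ x. ennreal (w powr (2 - p) / (2 - p)) * ennreal (cmod (f x) powr p) \<partial>N)"
  proof (intro nn_integral_cong)
    fix x
    show "(\<integral>\<^sup>+ s. ?H x s \<partial>lborel) = ennreal (w powr (2 - p) / (2 - p)) * ennreal (cmod (f x) powr p)"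
    proof (cases "f x = 0")
      case True
      then have "(\<lambda>s. ?H x s) = (\<lambda>s. 0)" by auto
      then show ?thesis using True p by simp
    next
      case False
      have "(\<integral>\<^sup>+ s. ?H x s \<partial>lborel) = (\<integral>\<^sup>+ s. ennreal ((cmod (f x))\<^sup>2) * (if 0 < s \<and> cmod (f x) / w \<le> s then ennreal (s powr (p - 3)) else 0) \<partial>lborel)"
        using w by (intro nn_integral_cong) (auto simp: field_simps)
      also have "\<dots> = ennreal ((cmod (f x))\<^sup>2) * ennreal (- ((cmod (f x) / w) powr (p - 3 + 1)) / (p - 3 + 1))"
        by (subst nn_integral_cmult, measurable, subst nn_integral_powr_to_inf) (use w p False in auto)
      also have "\<dots> = ennreal ((cmod (f x))\<^sup>2 * ((cmod (f x) / w) powr (p - 2) / (2 - p)))"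
        using p by (simp add: ennreal_mult'[symmetric] field_simps)
      also have "(cmod (f x))\<^sup>2 * ((cmod (f x) / w) powr (p - 2) / (2 - p)) = w powr (2 - p) / (2 - p) * cmod (f x) powr p"
        using w p False by (simp add: powr_divide powr_diff powr_numeral)
      finally show ?thesis by (simp only: ennreal_mult'' powr_ge_zero)
    qed
  qed
  also have "ennreal (4 * A * w * p) * (\<integral>\<^sup>+ x. ennreal (w powr (1 - p) / (p - 1)) * ennreal (cmod (f x) powr p) \<partial>N)
      + ennreal (4 * B * p) * (\<integral>\<^sup>+ x. ennreal (w powr (2 - p) / (2 - p)) * ennreal (cmod (f x) powr p) \<partial>N)
    = (ennreal (4 * A * w * p) * ennreal (w powr (1 - p) / (p - 1)) + ennreal (4 * B * p) * ennreal (w powr (2 - p) / (2 - p)))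
      * (\<integral>\<^sup>+ x. ennreal (cmod (f x) powr p) \<partial>N)"
    by (simp add: nn_integral_cmult distrib_right mult.assoc)
  also have "ennreal (4 * A * w * p) * ennreal (w powr (1 - p) / (p - 1)) + ennreal (4 * B * p) * ennreal (w powr (2 - p) / (2 - p))
     = ennreal (4 * A * w * p * (w powr (1 - p) / (p - 1)) + 4 * B * p * (w powr (2 - p) / (2 - p)))"
  proof -
    have "w powr (1 - p) / (p - 1) \<ge> 0" "w powr (2 - p) / (2 - p) \<ge> 0" "4 * A * w * p \<ge> 0" "4 * B * p \<ge> 0"
      using A B w p by auto
    then show ?thesis by (simp only: ennreal_plus ennreal_mult'' mult_nonneg_nonneg)
  qed
  also have "4 * A * w * p * (w powr (1 - p) / (p - 1)) + 4 * B * p * (w powr (2 - p) / (2 - p))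
     = (4 * A * p / (p - 1) + 4 * B * p / (2 - p)) * w powr (2 - p)"
  proof -
    \<comment> \<open>Here the extra w from the (1,1) bound brings the first term to the power
      w^(2-p) of the second.\<close>
    have "w * w powr (1 - p) = w powr (2 - p)" using w by (simp add: powr_diff power2_eq_square powr_numeral)
    from this[symmetric] have "4 * A * w * p * (w powr (1 - p) / (p - 1)) = 4 * A * p / (p - 1) * w powr (2 - p)"
      by (simp only:) simp
    then show ?thesis by (simp add: distrib_right)
  qed
  finally show ?thesis .
qed

section \<open>The Strichartz Fourier transform\<close>

lemma borel_measurable_pair_sets:
  fixes M :: "'a::second_countable_topology measure" and N :: "'b::second_countable_topology measure"
  assumes "f \<in> borel_measurable borel" "sets M = sets borel" "sets N = sets borel"
  shows "f \<in> borel_measurable (M \<Otimes>\<^sub>M N)"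
proof -
  have "sets (M \<Otimes>\<^sub>M N) = sets (borel :: ('a \<times> 'b) measure)"
    unfolding borel_prod[symmetric] by (rule sets_pair_measure_cong[OF assms(2,3)])
  then show ?thesis using assms(1) by (simp cong: measurable_cong_sets)
qed

text \<open>Cauchy's estimate on the circle |r| = 1/2, where the Mehler function is at most 2^n. The
  bound is crude in k but uniform in z and l, which suffices for integrability against f.\<close>

lemma abs_laguerre_fun_le: "\<bar>laguerre_fun k l (z :: complex ^ 'n::finite)\<bar> \<le> 2 ^ (k + CARD('n))"
proof -
  let ?h = "\<lambda>t. mehler CARD('n) l (of_real (1/2) * unit_char 1 t) ((norm z)\<^sup>2) * unit_char (- int k) t"
  have "cmod (?h t) \<le> 2 ^ CARD('n)" for t
    using norm_mehler_le[of "of_real (1/2) * unit_char 1 t" "(norm z)\<^sup>2" "CARD('n)" l]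
    by (simp add: norm_mult power_one_over)
  then have "cmod (LINT t|unit_interval. ?h t) \<le> 2 ^ CARD('n)"
    by (cases "integrable unit_interval ?h")
       (auto simp: not_integrable_integral_eq unit_interval.prob_space
         intro!: integral_norm_bound[THEN order_trans] unit_interval.integral_le_const)
  then have "(1/2) ^ k * \<bar>laguerre_fun k l z\<bar> \<le> 2 ^ CARD('n)"
    using mehler_circle_coefficient[of "1/2" l z k] by (simp add: norm_mult norm_power)
  then show ?thesis by (simp add: power_add power_divide field_simps)
qed

text \<open>The index k is a separate argument instead of being recovered by
  \<open>fan_index\<close>, so that for fixed k the kernel is jointly continuous in the remaining
  variables.\<close>

definition heis_kernel :: "nat \<Rightarrow> real \<Rightarrow> complex ^ 'n::finite \<Rightarrow> 'n heis \<Rightarrow> complex" where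
  "heis_kernel k l w x = iexp (- (l * snd x)) * (twist l (fst x) w * of_real (laguerre_fun k l (w - fst x)))"

definition heis_conv :: "('n::finite heis \<Rightarrow> complex) \<Rightarrow> nat \<Rightarrow> real \<Rightarrow> complex ^ 'n \<Rightarrow> complex" where
  "heis_conv f k l w = (LINT x|lborel. f x * heis_kernel k l w x)"

lemma fan_fun_eq_kernel:
  "fan_fun a (heis_mult (heis_inv x) (w, 0)) = heis_kernel (fan_index CARD('n) a) (fst a) (w :: complex ^ 'n::finite) x"
proof -
  have "Im (\<Sum>j\<in>UNIV. (- fst x) $ j * cnj (w $ j)) = - symp (fst x) w"
    using symp_minus_left[of "fst x" w] by (simp only: symp_def)
  then have h: "heis_mult (heis_inv x) (w, 0) = (w - fst x, - snd x - 1/2 * symp (fst x) w)"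
    unfolding heis_mult_def heis_inv_def by simp
  have "exp (\<i> * of_real (fst a * (- snd x - 1/2 * symp (fst x) w))) = iexp (- (fst a * snd x)) * twist (fst a) (fst x) w"
    unfolding twist_def exp_add[symmetric] by (simp add: algebra_simps)
  then show ?thesis
    by (simp only: fan_fun_def h heis_kernel_def fst_conv snd_conv mult.assoc)
qed

lemma strichartz_fourier_eq:
  fixes w :: "complex ^ 'n::finite"
  shows "strichartz_fourier f a w = (if fst a = 0 then 0
     else of_real (fan_coeff CARD('n) (fan_index CARD('n) a)) * heis_conv f (fan_index CARD('n) a) (fst a) w)"
  by (simp add: strichartz_fourier_def heis_conv_def fan_fun_eq_kernel)

lemma norm_heis_kernel: "cmod (heis_kernel k l w x) = \<bar>laguerre_fun k l (w - fst x)\<bar>"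
  by (simp add: heis_kernel_def norm_mult)

lemma norm_heis_kernel_le: "cmod (heis_kernel k l (w :: complex ^ 'n::finite) x) \<le> 2 ^ (k + CARD('n))"
  unfolding norm_heis_kernel by (rule abs_laguerre_fun_le)

lemma continuous_on_laguerre_fun [continuous_intros]:
  "continuous_on A f \<Longrightarrow> continuous_on A g \<Longrightarrow> continuous_on A (\<lambda>x. laguerre_fun k (f x) (g x))"
  unfolding laguerre_fun_def by (intro continuous_intros)

lemma continuous_on_heis_kernel:
  "continuous_on UNIV (\<lambda>((l, w :: complex ^ 'n::finite), x). heis_kernel k l w x)"
  unfolding heis_kernel_def twist_def case_prod_beta' by (intro continuous_intros) auto

lemma heis_kernel_measurable:
  "(\<lambda>y. heis_kernel k (fst (fst y)) (snd (fst y)) (snd y))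
     \<in> borel_measurable ((borel \<Otimes>\<^sub>M (borel :: (complex ^ 'n::finite) measure)) \<Otimes>\<^sub>M lborel)"
proof -
  have "(\<lambda>y. heis_kernel k (fst (fst y)) (snd (fst y)) (snd y))
     \<in> borel_measurable (borel :: ((real \<times> (complex ^ 'n)) \<times> 'n heis) measure)"
    using borel_measurable_continuous_onI[OF continuous_on_heis_kernel] by (simp add: case_prod_beta')
  then show ?thesis by (rule borel_measurable_pair_sets) (simp_all only: borel_prod sets_lborel)
qed

lemma heis_kernel_measurable_slice [measurable]: "heis_kernel k l w \<in> borel_measurable borel"
proof -
  have "continuous_on UNIV (heis_kernel k l w)"
    using continuous_on_compose2[OF continuous_on_heis_kernel[of k], of UNIV "\<lambda>x. ((l, w), x)"]
    by (simp add: continuous_on_Pair)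
  then show ?thesis by (rule borel_measurable_continuous_onI)
qed

lemma integrable_mult_heis_kernel:
  fixes w :: "complex ^ 'n::finite"
  assumes f: "integrable lborel f"
  shows "integrable lborel (\<lambda>x. f x * heis_kernel k l w x)"
proof (rule Bochner_Integration.integrable_bound)
  have [measurable]: "f \<in> borel_measurable borel" using f by simp
  show "integrable lborel (\<lambda>x. f x * 2 ^ (k + CARD('n)))" using f by simp
  show "(\<lambda>x. f x * heis_kernel k l w x) \<in> borel_measurable lborel" by measurable
  show "AE x in lborel. norm (f x * heis_kernel k l w x) \<le> norm (f x * 2 ^ (k + CARD('n)))"
    using norm_heis_kernel_le[of k l w]
    by (intro AE_I2) (auto simp: norm_mult norm_power intro!: mult_left_mono)
qed

lemma heis_conv_add:
  "integrable lborel f \<Longrightarrow> integrable lborel g \<Longrightarrow> heis_conv (\<lambda>x. f x + g x) k l w = heis_conv f k l w + heis_conv g k l w"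
  by (simp add: heis_conv_def distrib_right integrable_mult_heis_kernel)

lemma heis_conv_measurable:
  fixes f :: "'n::finite heis \<Rightarrow> complex"
  assumes [measurable]: "f \<in> borel_measurable borel"
  shows "(\<lambda>y. heis_conv f k (fst y) (snd y)) \<in> borel_measurable (borel \<Otimes>\<^sub>M borel)"
proof -
  note [measurable] = heis_kernel_measurable[where 'n='n]
  have "(\<lambda>(y, x). f x * heis_kernel k (fst y) (snd y) x) \<in> borel_measurable ((borel \<Otimes>\<^sub>M borel) \<Otimes>\<^sub>M lborel)"
    unfolding case_prod_beta' by measurable
  from lborel.borel_measurable_lebesgue_integral[OF this] show ?thesis by (simp add: heis_conv_def)
qed

lemma heis_conv_measurable_slice [measurable]:
  fixes f :: "'n::finite heis \<Rightarrow> complex"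
  assumes f: "f \<in> borel_measurable borel"
  shows "heis_conv f k l \<in> borel_measurable borel"
  using measurable_compose[OF measurable_Pair1'[of l borel borel] heis_conv_measurable[OF f]] by simp

text \<open>The instance of \<open>Q\<close> in \<open>paley_interpolation\<close>. Being a square,
  it absorbs the weight as |lambda|^n and can be infinite without a side condition.\<close>

definition fourier_energy :: "('n::finite heis \<Rightarrow> complex) \<Rightarrow> real \<times> real \<Rightarrow> ennreal" where
  "fourier_energy f a = ennreal (\<bar>fst a\<bar> ^ CARD('n)) * (\<integral>\<^sup>+ w. ennreal ((cmod (strichartz_fourier f a w))\<^sup>2) \<partial>lborel)"

lemma strichartz_fourier_measurable [measurable]:
  fixes f :: "'n::finite heis \<Rightarrow> complex"
  assumes [measurable]: "f \<in> borel_measurable borel"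
  shows "strichartz_fourier f a \<in> borel_measurable borel"
  unfolding strichartz_fourier_eq[abs_def] by measurable

lemma fourier_energy_add:
  assumes f: "integrable lborel f" and g: "integrable lborel (g :: 'n::finite heis \<Rightarrow> complex)"
  shows "fourier_energy (\<lambda>x. f x + g x) a \<le> 2 * fourier_energy f a + 2 * fourier_energy g a"
proof -
  have [measurable]: "f \<in> borel_measurable borel" "g \<in> borel_measurable borel" using f g by simp_all
  have F: "strichartz_fourier (\<lambda>x. f x + g x) a w = strichartz_fourier f a w + strichartz_fourier g a w" for w
    by (simp add: strichartz_fourier_eq heis_conv_add[OF f g] distrib_left)
  have "(cmod (x + y))\<^sup>2 \<le> 2 * (cmod x)\<^sup>2 + 2 * (cmod y)\<^sup>2" for x y
  proof -
    have "(cmod (x + y))\<^sup>2 \<le> (cmod x + cmod y)\<^sup>2" by (intro power_mono norm_triangle_ineq) simp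
    also have "\<dots> \<le> 2 * (cmod x)\<^sup>2 + 2 * (cmod y)\<^sup>2"
      using sum_squares_bound[of "cmod x" "cmod y"] by (simp add: power2_sum)
    finally show ?thesis .
  qed
  then have "(\<integral>\<^sup>+ w. ennreal ((cmod (strichartz_fourier (\<lambda>x. f x + g x) a w))\<^sup>2) \<partial>lborel)
     \<le> (\<integral>\<^sup>+ w. ennreal (2 * (cmod (strichartz_fourier f a w))\<^sup>2 + 2 * (cmod (strichartz_fourier g a w))\<^sup>2) \<partial>lborel)"
    unfolding F by (intro nn_integral_mono ennreal_leI)
  also have "\<dots> = 2 * (\<integral>\<^sup>+ w. ennreal ((cmod (strichartz_fourier f a w))\<^sup>2) \<partial>lborel)
       + 2 * (\<integral>\<^sup>+ w. ennreal ((cmod (strichartz_fourier g a w))\<^sup>2) \<partial>lborel)"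
    by (simp add: ennreal_mult' nn_integral_add nn_integral_cmult)
  finally have "fourier_energy (\<lambda>x. f x + g x) a \<le> ennreal (\<bar>fst a\<bar> ^ CARD('n)) * \<dots>"
    unfolding fourier_energy_def by (rule mult_left_mono) simp
  then show ?thesis unfolding fourier_energy_def by (simp add: distrib_left mult_ac)
qed

lemma fan_coeff_pos: "fan_coeff n k > 0"
  by (simp add: fan_coeff_def)

text \<open>The coefficient is the reciprocal of the binomial coefficient k+n-1 over k.\<close>

lemma fan_coeff_le_1: 
  assumes "n > 0" shows "fan_coeff n k \<le> 1"
proof -
  have "fact k * fact (n - 1) dvd (fact (k + (n - 1)) :: nat)" by (rule fact_fact_dvd_fact)
  then have "fact k * fact (n - 1) \<le> (fact (k + n - 1) :: nat)" using assms by (intro dvd_imp_le) (auto simp: add.commute)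
  then have "real (fact k * fact (n - 1)) \<le> real (fact (k + n - 1))" by (rule of_nat_mono)
  then show ?thesis by (simp add: fan_coeff_def)
qed

text \<open>Cauchy-Schwarz relative to |f|, Tonelli, and translation invariance reduce the
  w-integral to the L2 norm of a Laguerre function. Its |l|^(-n) meets the weight |l|^n, and c^2 / c
  = c is at most 1, so the bound is uniform in l and k.\<close>

lemma fourier_energy_le_L1:
  fixes f :: "'n::finite heis \<Rightarrow> complex"
  assumes f: "integrable lborel f"
  shows "fourier_energy f a \<le> ennreal ((sqrt ((2 * pi) ^ CARD('n)) * (LINT x|lborel. cmod (f x)))\<^sup>2)"
proof (cases "fst a = 0")
  case True
  then show ?thesis by (simp add: fourier_energy_def strichartz_fourier_eq)
next
  case False
  define k l c where "k = fan_index CARD('n) a" and "l = fst a" and "c = fan_coeff CARD('n) k"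
  have l: "l \<noteq> 0" using False by (simp add: l_def)
  have c: "0 < c" "c \<le> 1" by (simp_all add: c_def fan_coeff_pos fan_coeff_le_1)
  have [measurable]: "f \<in> borel_measurable borel" using f by simp
  let ?I = "\<integral>\<^sup>+ x. ennreal (cmod (f x)) \<partial>lborel"
  have I: "?I = ennreal (LINT x|lborel. cmod (f x))"
    using f by (intro nn_integral_eq_integral) auto
  have "(\<integral>\<^sup>+ w. ennreal ((cmod (heis_conv f k l w))\<^sup>2) \<partial>lborel)
    \<le> (\<integral>\<^sup>+ w. ?I * (\<integral>\<^sup>+ x. ennreal (cmod (f x) * (cmod (heis_kernel k l w x))\<^sup>2) \<partial>lborel) \<partial>lborel)"
    unfolding heis_conv_def by (intro nn_integral_mono integral_mult_square_le) simp_all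
  also have "\<dots> = (\<integral>\<^sup>+ w. ?I * (\<integral>\<^sup>+ x. ennreal (cmod (f x)) * ennreal ((laguerre_fun k l (w - fst x))\<^sup>2) \<partial>lborel) \<partial>lborel)"
    by (simp add: norm_heis_kernel ennreal_mult')
  also have "\<dots> = ?I * (\<integral>\<^sup>+ w. \<integral>\<^sup>+ x. ennreal (cmod (f x)) * ennreal ((laguerre_fun k l (w - fst x))\<^sup>2) \<partial>lborel \<partial>lborel)"
  proof (rule nn_integral_cmult)
    have "(\<lambda>y. laguerre_fun k l (fst y - fst (snd y))) \<in> borel_measurable (borel :: ((complex ^ 'n) \<times> 'n heis) measure)"
      by (intro borel_measurable_continuous_onI continuous_intros)
    then have [measurable]: "(\<lambda>y. laguerre_fun k l (fst y - fst (snd y))) \<in> borel_measurable (lborel \<Otimes>\<^sub>M (lborel :: 'n heis measure))"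
      by (rule borel_measurable_pair_sets) (simp_all only: sets_lborel)
    show "(\<lambda>w. \<integral>\<^sup>+ x. ennreal (cmod (f x)) * ennreal ((laguerre_fun k l (w - fst x))\<^sup>2) \<partial>lborel) \<in> borel_measurable lborel"
      by measurable
  qed
  also have "(\<integral>\<^sup>+ w. \<integral>\<^sup>+ x. ennreal (cmod (f x)) * ennreal ((laguerre_fun k l (w - fst x))\<^sup>2) \<partial>lborel \<partial>lborel)
     = (\<integral>\<^sup>+ x. \<integral>\<^sup>+ w. ennreal (cmod (f x)) * ennreal ((laguerre_fun k l (w - fst x))\<^sup>2) \<partial>lborel \<partial>lborel)"
  proof (rule pair_sigma_finite.Fubini')
    show "pair_sigma_finite (lborel :: 'n heis measure) (lborel :: (complex ^ 'n) measure)"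
      by (intro pair_sigma_finite.intro lborel.sigma_finite_measure_axioms)
    have "(\<lambda>y. laguerre_fun k l (snd y - fst (fst y))) \<in> borel_measurable (borel :: ('n heis \<times> (complex ^ 'n)) measure)"
      by (intro borel_measurable_continuous_onI continuous_intros)
    then have [measurable]: "(\<lambda>y. laguerre_fun k l (snd y - fst (fst y))) \<in> borel_measurable ((lborel :: 'n heis measure) \<Otimes>\<^sub>M lborel)"
      by (rule borel_measurable_pair_sets) (simp_all only: sets_lborel)
    show "(\<lambda>(x, w). ennreal (cmod (f x)) * ennreal ((laguerre_fun k l (w - fst x))\<^sup>2)) \<in> borel_measurable (lborel \<Otimes>\<^sub>M lborel)"
      unfolding case_prod_beta' by measurable
  qed
  also have "\<dots> = (\<integral>\<^sup>+ x. ennreal (cmod (f x)) * ennreal ((2 * pi / \<bar>l\<bar>) ^ CARD('n) / c) \<partial>lborel)"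
  proof (intro nn_integral_cong)
    fix x :: "'n heis"
    have [measurable]: "laguerre_fun k l \<in> borel_measurable (borel :: (complex ^ 'n) measure)"
      by (intro borel_measurable_continuous_onI) (auto intro!: continuous_intros)
    have "(\<integral>\<^sup>+ w. ennreal ((laguerre_fun k l (w - fst x))\<^sup>2) \<partial>lborel) = (\<integral>\<^sup>+ w. ennreal ((laguerre_fun k l (w :: complex ^ 'n))\<^sup>2) \<partial>lborel)"
      by (subst lborel_distr_plus[of "fst x", symmetric]) (simp add: nn_integral_distr)
    then show "(\<integral>\<^sup>+ w. ennreal (cmod (f x)) * ennreal ((laguerre_fun k l (w - fst x))\<^sup>2) \<partial>lborel)
      = ennreal (cmod (f x)) * ennreal ((2 * pi / \<bar>l\<bar>) ^ CARD('n) / c)"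
      using nn_integral_laguerre_fun_square[OF l, of k, where 'n='n] by (simp add: nn_integral_cmult c_def)
  qed
  also have "\<dots> = ?I * ennreal ((2 * pi / \<bar>l\<bar>) ^ CARD('n) / c)"
    by (rule nn_integral_multc) simp
  finally have conv: "(\<integral>\<^sup>+ w. ennreal ((cmod (heis_conv f k l w))\<^sup>2) \<partial>lborel) \<le> ?I * (?I * ennreal ((2 * pi / \<bar>l\<bar>) ^ CARD('n) / c))" .
  have "fourier_energy f a = ennreal (\<bar>l\<bar> ^ CARD('n)) * (ennreal (c\<^sup>2) * (\<integral>\<^sup>+ w. ennreal ((cmod (heis_conv f k l w))\<^sup>2) \<partial>lborel))"
    using False c unfolding fourier_energy_def strichartz_fourier_eq k_def[symmetric] c_def[symmetric] l_def[symmetric]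
    by (simp add: norm_mult power_mult_distrib ennreal_mult' nn_integral_cmult)
  also have "\<dots> \<le> ennreal (\<bar>l\<bar> ^ CARD('n)) * (ennreal (c\<^sup>2) * (?I * (?I * ennreal ((2 * pi / \<bar>l\<bar>) ^ CARD('n) / c))))"
    by (intro mult_left_mono conv) auto
  also have "\<dots> = ennreal (\<bar>l\<bar> ^ CARD('n) * (c\<^sup>2 * ((LINT x|lborel. cmod (f x)) * ((LINT x|lborel. cmod (f x)) * ((2 * pi / \<bar>l\<bar>) ^ CARD('n) / c)))))"
  proof -
    have "(LINT x|lborel. cmod (f x)) \<ge> 0" by simp
    then show ?thesis
      unfolding I by (simp only: ennreal_mult' zero_le_power abs_ge_zero zero_le_power2)
  qed
  also have "\<dots> \<le> ennreal ((sqrt ((2 * pi) ^ CARD('n)) * (LINT x|lborel. cmod (f x)))\<^sup>2)"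
  proof (rule ennreal_leI)
    have "\<bar>l\<bar> ^ CARD('n) * (c\<^sup>2 * ((LINT x|lborel. cmod (f x)) * ((LINT x|lborel. cmod (f x)) * ((2 * pi / \<bar>l\<bar>) ^ CARD('n) / c))))
       = c * ((2 * pi) ^ CARD('n) * (LINT x|lborel. cmod (f x))\<^sup>2)"
      using l c by (simp add: power_divide power2_eq_square)
    also have "\<dots> \<le> 1 * ((2 * pi) ^ CARD('n) * (LINT x|lborel. cmod (f x))\<^sup>2)"
      using c by (intro mult_right_mono) auto
    finally show "\<bar>l\<bar> ^ CARD('n) * (c\<^sup>2 * ((LINT x|lborel. cmod (f x)) * ((LINT x|lborel. cmod (f x)) * ((2 * pi / \<bar>l\<bar>) ^ CARD('n) / c))))
       \<le> (sqrt ((2 * pi) ^ CARD('n)) * (LINT x|lborel. cmod (f x)))\<^sup>2"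
      by (simp add: power_mult_distrib)
  qed
  finally show ?thesis .
qed

section \<open>Measurability on the fan and the (2,2) bound\<close>

lemma sets_fan_mu [measurable_cong]: "sets (fan_mu n) = sets (restrict_space borel (heis_fan n))"
  by (simp add: fan_mu_def sets_fan_nu2)

lemma space_fan_mu: "space (fan_mu n) = heis_fan n"
  by (simp add: fan_mu_def space_fan_nu2)

text \<open>\<open>fan_index\<close> is a definite description; off the vertical axis this replaces
  it by an explicit Borel function of the point.\<close>

lemma fan_index_eq_floor:
  assumes "a \<in> heis_fan n" "fst a \<noteq> 0"
  shows "fan_index n a = nat \<lfloor>(snd a / \<bar>fst a\<bar> - real n) / 2\<rfloor>"
proof -
  obtain k where k: "a \<in> fan_ray n k" using assms by (auto simp: heis_fan_def fan_ray_inf_def)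
  then have "(snd a / \<bar>fst a\<bar> - real n) / 2 = real k" by (auto simp: fan_ray_def)
  then show ?thesis using fan_index_ray[OF k] by simp
qed

text \<open>For each fixed k the energy is a Borel function of lambda. The index is a measurable
  function with countable range, so the measurable families over k can be glued along it.\<close>

lemma fourier_energy_measurable:
  fixes f :: "'n::finite heis \<Rightarrow> complex"
  assumes [measurable]: "f \<in> borel_measurable borel"
  shows "fourier_energy f \<in> borel_measurable (restrict_space borel (heis_fan CARD('n)))"
proof -
  define G where "G = (\<lambda>k l. \<integral>\<^sup>+ w. ennreal ((cmod (heis_conv f k l w))\<^sup>2) \<partial>lborel)"
  have [measurable]: "G k \<in> borel_measurable borel" for k
  proof -
    have "(\<lambda>y. heis_conv f k (fst y) (snd y)) \<in> borel_measurable (borel \<Otimes>\<^sub>M lborel)"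
      using heis_conv_measurable[OF assms] by (simp cong: measurable_cong_sets)
    note [measurable] = this
    have "(\<lambda>(l, w). ennreal ((cmod (heis_conv f k l w))\<^sup>2)) \<in> borel_measurable (borel \<Otimes>\<^sub>M lborel)"
      unfolding case_prod_beta' by measurable
    then show ?thesis unfolding G_def by (rule lborel.borel_measurable_nn_integral)
  qed
  define E where "E = (\<lambda>a :: real \<times> real. \<lambda>k. if fst a = 0 then 0 else ennreal (\<bar>fst a\<bar> ^ CARD('n)) * (ennreal ((fan_coeff CARD('n) k)\<^sup>2) * G k (fst a)))"
  have "(\<lambda>a. E a (nat \<lfloor>(snd a / \<bar>fst a\<bar> - real CARD('n)) / 2\<rfloor>)) \<in> borel_measurable (borel :: (real \<times> real) measure)"
  proof (rule measurable_compose_countable)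
    show "(\<lambda>a. E a k) \<in> borel_measurable (borel :: (real \<times> real) measure)" for k
      unfolding E_def borel_prod[symmetric] by measurable
    show "(\<lambda>a. nat \<lfloor>(snd a / \<bar>fst a\<bar> - real CARD('n)) / 2\<rfloor>) \<in> measurable (borel :: (real \<times> real) measure) (count_space UNIV)"
      unfolding borel_prod[symmetric] by measurable
  qed
  then have "(\<lambda>a. E a (nat \<lfloor>(snd a / \<bar>fst a\<bar> - real CARD('n)) / 2\<rfloor>)) \<in> borel_measurable (restrict_space borel (heis_fan CARD('n)))"
    by (rule measurable_restrict_space1)
  moreover have "fourier_energy f a = E a (nat \<lfloor>(snd a / \<bar>fst a\<bar> - real CARD('n)) / 2\<rfloor>)"
    if "a \<in> space (restrict_space borel (heis_fan CARD('n)))" for a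
  proof (cases "fst a = 0")
    case True
    then show ?thesis by (simp add: fourier_energy_def strichartz_fourier_eq E_def)
  next
    case False
    then show ?thesis using that fan_index_eq_floor[of a "CARD('n)"]
      by (simp add: space_restrict_space fourier_energy_def strichartz_fourier_eq E_def G_def norm_mult power_mult_distrib
          ennreal_mult' nn_integral_cmult)
  qed
  ultimately show ?thesis by (subst measurable_cong) auto
qed

text \<open>Integrating out the central variable first gives the Fourier transform of f in t,
  followed by twisted convolution on C^n at the same frequency.\<close>

lemma heis_conv_eq:
  fixes f :: "'n::finite heis \<Rightarrow> complex"
  assumes f: "integrable lborel f"
  shows "heis_conv f k l w
    = (LINT z|lborel. (LINT t|lborel. f (z, t) * iexp (- (l * t))) * (twist l z w * of_real (laguerre_fun k l (w - z))))"
proof -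
  have "integrable (lborel \<Otimes>\<^sub>M lborel) (\<lambda>x. f x * heis_kernel k l w x)"
    unfolding lborel_prod by (rule integrable_mult_heis_kernel[OF f])
  from lborel_pair.integral_fst'[OF this]
  have "heis_conv f k l w = (LINT z|lborel. LINT t|lborel. f (z, t) * heis_kernel k l w (z, t))"
    by (simp add: heis_conv_def lborel_prod)
  then show ?thesis by (simp add: heis_kernel_def mult.assoc[symmetric])
qed

lemma fourier_slice_integrable:
  fixes f :: "'n::finite heis \<Rightarrow> complex"
  assumes f: "integrable lborel f"
  shows "integrable lborel (\<lambda>z. LINT t|lborel. f (z, t) * iexp (- (l * t)))"
proof -
  have f': "integrable (lborel \<Otimes>\<^sub>M lborel) f" using f by (simp add: lborel_prod)
  note [measurable] = borel_measurable_integrable[OF f']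
  have "(\<lambda>x. f x * iexp (- (l * snd x))) \<in> borel_measurable (lborel \<Otimes>\<^sub>M lborel)" by measurable
  then have "integrable (lborel \<Otimes>\<^sub>M lborel) (\<lambda>x. f x * iexp (- (l * snd x)))"
    by (rule Bochner_Integration.integrable_bound[OF f']) (simp add: norm_mult)
  from lborel_pair.integrable_fst'[OF this] show ?thesis by simp
qed

text \<open>For fixed l nonzero all normalising factors cancel except |l|^(2n), and the sum over k
  is the one bounded by \<open>twisted_bessel\<close>, whose l^(-2n) removes it.
  \<open>plancherel_le\<close> in the central variable finishes; the constant is (2 pi)^(-2n-1) (8
  pi^2)^n 2 pi = 2^n.\<close>

lemma fourier_energy_integral_le:
  fixes f :: "'n::finite heis \<Rightarrow> complex"
  assumes f: "integrable lborel f"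
  shows "(\<integral>\<^sup>+ a. fourier_energy f a \<partial>fan_mu CARD('n)) \<le> ennreal (2 ^ CARD('n)) * (\<integral>\<^sup>+ x. ennreal ((cmod (f x))\<^sup>2) \<partial>lborel)"
proof -
  let ?n = "CARD('n)"
  have f_borel: "f \<in> borel_measurable borel" using f by simp
  then have fm [measurable]: "f \<in> borel_measurable (lborel \<Otimes>\<^sub>M lborel)" by (simp add: lborel_prod)
  note [measurable] = heis_conv_measurable_slice[OF f_borel]
  define fl where "fl = (\<lambda>l z. LINT t|lborel. f (z, t) * iexp (- (l * t)))"
  have fl_meas [measurable]: "(\<lambda>(z, l). fl l z) \<in> borel_measurable (lborel \<Otimes>\<^sub>M lborel)"
  proof -
    have "(\<lambda>x. f (fst (fst x), snd x)) \<in> borel_measurable ((lborel \<Otimes>\<^sub>M lborel) \<Otimes>\<^sub>M (lborel :: real measure))"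
      by (rule measurable_compose[OF _ fm]) measurable
    note [measurable] = this
    have "(\<lambda>(x, t). f (fst x, t) * iexp (- (snd x * t))) \<in> borel_measurable ((lborel \<Otimes>\<^sub>M lborel) \<Otimes>\<^sub>M (lborel :: real measure))"
      unfolding case_prod_beta' by measurable
    from lborel.borel_measurable_lebesgue_integral[OF this] show ?thesis by (simp add: fl_def case_prod_beta')
  qed
  have Em [measurable]: "fourier_energy f \<in> borel_measurable (fan_nu2 ?n)"
    using fourier_energy_measurable[OF f_borel] by (simp cong: measurable_cong_sets add: sets_fan_nu2)
  have fstm [measurable]: "fst \<in> borel_measurable (fan_nu2 ?n)"
  proof -
    have "fst \<in> borel_measurable (restrict_space (borel :: (real \<times> real) measure) (heis_fan ?n))"
      by (intro measurable_restrict_space1 borel_measurable_continuous_onI continuous_intros)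
    then show ?thesis by (simp cong: measurable_cong_sets add: sets_fan_nu2)
  qed
  have ray: "(\<Sum>k. ennreal (1 / (fan_coeff ?n k)\<^sup>2) * (ennreal (1 / \<bar>l\<bar> ^ ?n) * fourier_energy f (l, (2 * real k + real ?n) * \<bar>l\<bar>)))
      * ennreal (\<bar>l\<bar> ^ (2 * ?n)) \<le> ennreal ((8 * pi\<^sup>2) ^ ?n) * (\<integral>\<^sup>+ z. ennreal ((cmod (fl l z))\<^sup>2) \<partial>lborel)" if l: "l \<noteq> 0" for l
  proof -
    let ?S = "\<integral>\<^sup>+ z. ennreal ((cmod (fl l z))\<^sup>2) \<partial>lborel"
    have "ennreal (1 / (fan_coeff ?n k)\<^sup>2) * (ennreal (1 / \<bar>l\<bar> ^ ?n) * fourier_energy f (l, (2 * real k + real ?n) * \<bar>l\<bar>))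
       = (\<integral>\<^sup>+ w. ennreal ((cmod (heis_conv f k l w))\<^sup>2) \<partial>lborel)" for k
    proof -
      let ?c = "fan_coeff ?n k" and ?J = "\<integral>\<^sup>+ w. ennreal ((cmod (heis_conv f k l w))\<^sup>2) \<partial>lborel"
      have "fan_index ?n (l, (2 * real k + real ?n) * \<bar>l\<bar>) = k"
        using l by (intro fan_index_ray) (auto simp: fan_ray_def)
      then have "fourier_energy f (l, (2 * real k + real ?n) * \<bar>l\<bar>) = ennreal (\<bar>l\<bar> ^ ?n) * (ennreal (?c\<^sup>2) * ?J)"
        using l by (simp add: fourier_energy_def strichartz_fourier_eq norm_mult power_mult_distrib ennreal_mult' nn_integral_cmult)
      then have "ennreal (1 / ?c\<^sup>2) * (ennreal (1 / \<bar>l\<bar> ^ ?n) * fourier_energy f (l, (2 * real k + real ?n) * \<bar>l\<bar>))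
        = (ennreal (1 / ?c\<^sup>2) * (ennreal (1 / \<bar>l\<bar> ^ ?n) * (ennreal (\<bar>l\<bar> ^ ?n) * ennreal (?c\<^sup>2)))) * ?J"
        by (simp only: mult.assoc)
      also have "ennreal (1 / ?c\<^sup>2) * (ennreal (1 / \<bar>l\<bar> ^ ?n) * (ennreal (\<bar>l\<bar> ^ ?n) * ennreal (?c\<^sup>2))) = 1"
        using l fan_coeff_pos[of ?n k] by (simp add: ennreal_mult'[symmetric])
      finally show ?thesis by simp
    qed
    then have "(\<Sum>k. ennreal (1 / (fan_coeff ?n k)\<^sup>2) * (ennreal (1 / \<bar>l\<bar> ^ ?n) * fourier_energy f (l, (2 * real k + real ?n) * \<bar>l\<bar>)))
        = (\<Sum>k. \<integral>\<^sup>+ w. ennreal ((cmod (heis_conv f k l w))\<^sup>2) \<partial>lborel)" by simp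
    \<comment> \<open>The infinite sum is the supremum of its partial sums, to which the
      N-independent bound applies.\<close>
    also have "\<dots> \<le> ennreal ((8 * pi\<^sup>2 / l\<^sup>2) ^ ?n) * ?S"
      unfolding suminf_eq_SUP heis_conv_eq[OF f] fl_def
      by (intro SUP_least twisted_bessel l fourier_slice_integrable f)
    finally have "(\<Sum>k. ennreal (1 / (fan_coeff ?n k)\<^sup>2) * (ennreal (1 / \<bar>l\<bar> ^ ?n) * fourier_energy f (l, (2 * real k + real ?n) * \<bar>l\<bar>)))
        * ennreal (\<bar>l\<bar> ^ (2 * ?n)) \<le> ennreal ((8 * pi\<^sup>2 / l\<^sup>2) ^ ?n) * ?S * ennreal (\<bar>l\<bar> ^ (2 * ?n))"
      by (rule mult_right_mono) simp
    also have "\<dots> = (ennreal ((8 * pi\<^sup>2 / l\<^sup>2) ^ ?n) * ennreal (\<bar>l\<bar> ^ (2 * ?n))) * ?S"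
      by (simp only: mult_ac)
    also have "ennreal ((8 * pi\<^sup>2 / l\<^sup>2) ^ ?n) * ennreal (\<bar>l\<bar> ^ (2 * ?n)) = ennreal ((8 * pi\<^sup>2) ^ ?n)"
    proof -
      have "(8 * pi\<^sup>2 / l\<^sup>2) ^ ?n * \<bar>l\<bar> ^ (2 * ?n) = (8 * pi\<^sup>2 / l\<^sup>2 * l\<^sup>2) ^ ?n"
        by (simp only: power_mult power2_abs power_mult_distrib)
      also have "\<dots> = (8 * pi\<^sup>2) ^ ?n" using l by simp
      finally show ?thesis by (subst ennreal_mult'[symmetric]) simp_all
    qed
    finally show ?thesis .
  qed
  have "(\<integral>\<^sup>+ a. fourier_energy f a \<partial>fan_mu ?n) = (\<integral>\<^sup>+ a. ennreal (1 / \<bar>fst a\<bar> ^ ?n) * fourier_energy f a \<partial>fan_nu2 ?n)"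
    unfolding fan_mu_def by (rule nn_integral_density) measurable
  also have "\<dots> = ennreal (1 / (2 * pi) ^ (2 * ?n + 1)) *
     (\<integral>\<^sup>+ l. (\<Sum>k. ennreal (1 / (fan_coeff ?n k)\<^sup>2) * (ennreal (1 / \<bar>l\<bar> ^ ?n) * fourier_energy f (l, (2 * real k + real ?n) * \<bar>l\<bar>)))
      * ennreal (\<bar>l\<bar> ^ (2 * ?n)) \<partial>lborel)"
    by (subst nn_integral_fan_nu2) simp_all
  also have "\<dots> \<le> ennreal (1 / (2 * pi) ^ (2 * ?n + 1)) *
     (\<integral>\<^sup>+ l. ennreal ((8 * pi\<^sup>2) ^ ?n) * (\<integral>\<^sup>+ z. ennreal ((cmod (fl l z))\<^sup>2) \<partial>lborel) \<partial>lborel)"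
  proof (intro mult_left_mono nn_integral_mono_AE)
    show "AE l in lborel. (\<Sum>k. ennreal (1 / (fan_coeff ?n k)\<^sup>2) * (ennreal (1 / \<bar>l\<bar> ^ ?n) * fourier_energy f (l, (2 * real k + real ?n) * \<bar>l\<bar>)))
      * ennreal (\<bar>l\<bar> ^ (2 * ?n)) \<le> ennreal ((8 * pi\<^sup>2) ^ ?n) * (\<integral>\<^sup>+ z. ennreal ((cmod (fl l z))\<^sup>2) \<partial>lborel)"
      using AE_lborel_singleton[of "0::real"] by eventually_elim (rule ray)
  qed simp
  also have "\<dots> = ennreal (1 / (2 * pi) ^ (2 * ?n + 1)) * (ennreal ((8 * pi\<^sup>2) ^ ?n) *
     (\<integral>\<^sup>+ l. \<integral>\<^sup>+ z. ennreal ((cmod (fl l z))\<^sup>2) \<partial>lborel \<partial>lborel))"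
    by (subst nn_integral_cmult) (auto simp: case_prod_beta')
  also have "(\<integral>\<^sup>+ l. \<integral>\<^sup>+ z. ennreal ((cmod (fl l z))\<^sup>2) \<partial>lborel \<partial>lborel) = (\<integral>\<^sup>+ z. \<integral>\<^sup>+ l. ennreal ((cmod (fl l z))\<^sup>2) \<partial>lborel \<partial>lborel)"
    by (rule lborel_pair.Fubini') measurable
  finally have energy: "(\<integral>\<^sup>+ a. fourier_energy f a \<partial>fan_mu ?n) \<le> ennreal (1 / (2 * pi) ^ (2 * ?n + 1)) * (ennreal ((8 * pi\<^sup>2) ^ ?n) *
     (\<integral>\<^sup>+ z. \<integral>\<^sup>+ l. ennreal ((cmod (fl l z))\<^sup>2) \<partial>lborel \<partial>lborel))" .
  \<comment> \<open>Almost every slice of an integrable f is integrable in t, so the one-dimensional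
    bound is available for almost every z.\<close>
  have "(\<integral>\<^sup>+ z. \<integral>\<^sup>+ l. ennreal ((cmod (fl l z))\<^sup>2) \<partial>lborel \<partial>lborel) \<le> (\<integral>\<^sup>+ z. ennreal (2 * pi) * (\<integral>\<^sup>+ t. ennreal ((cmod (f (z, t)))\<^sup>2) \<partial>lborel) \<partial>lborel)"
  proof (rule nn_integral_mono_AE)
    have "integrable (lborel \<Otimes>\<^sub>M lborel) f" using f by (simp add: lborel_prod)
    from lborel_pair.AE_integrable_fst'[OF this]
    show "AE z in lborel. (\<integral>\<^sup>+ l. ennreal ((cmod (fl l z))\<^sup>2) \<partial>lborel) \<le> ennreal (2 * pi) * (\<integral>\<^sup>+ t. ennreal ((cmod (f (z, t)))\<^sup>2) \<partial>lborel)"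
      by eventually_elim (unfold fl_def, rule plancherel_le)
  qed
  also have "\<dots> = ennreal (2 * pi) * (\<integral>\<^sup>+ z. \<integral>\<^sup>+ t. ennreal ((cmod (f (z, t)))\<^sup>2) \<partial>lborel \<partial>lborel)"
    by (rule nn_integral_cmult) measurable
  also have "(\<integral>\<^sup>+ z. \<integral>\<^sup>+ t. ennreal ((cmod (f (z, t)))\<^sup>2) \<partial>lborel \<partial>lborel) = (\<integral>\<^sup>+ x. ennreal ((cmod (f x))\<^sup>2) \<partial>lborel)"
  proof -
    have m: "(\<lambda>x. ennreal ((cmod (f x))\<^sup>2)) \<in> borel_measurable (lborel \<Otimes>\<^sub>M lborel)" by measurable
    show ?thesis unfolding lborel.nn_integral_fst[OF m] lborel_prod ..
  qed
  finally have plancherel: "(\<integral>\<^sup>+ z. \<integral>\<^sup>+ l. ennreal ((cmod (fl l z))\<^sup>2) \<partial>lborel \<partial>lborel)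
     \<le> ennreal (2 * pi) * (\<integral>\<^sup>+ x. ennreal ((cmod (f x))\<^sup>2) \<partial>lborel)" .
  note energy
  also have "ennreal (1 / (2 * pi) ^ (2 * ?n + 1)) * (ennreal ((8 * pi\<^sup>2) ^ ?n) * (\<integral>\<^sup>+ z. \<integral>\<^sup>+ l. ennreal ((cmod (fl l z))\<^sup>2) \<partial>lborel \<partial>lborel))
     \<le> ennreal (1 / (2 * pi) ^ (2 * ?n + 1)) * (ennreal ((8 * pi\<^sup>2) ^ ?n) * (ennreal (2 * pi) * (\<integral>\<^sup>+ x. ennreal ((cmod (f x))\<^sup>2) \<partial>lborel)))"
    by (intro mult_left_mono plancherel zero_le)
  also have "\<dots> = (ennreal (1 / (2 * pi) ^ (2 * ?n + 1)) * (ennreal ((8 * pi\<^sup>2) ^ ?n) * ennreal (2 * pi))) * (\<integral>\<^sup>+ x. ennreal ((cmod (f x))\<^sup>2) \<partial>lborel)"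
    by (simp only: mult.assoc)
  also have "ennreal (1 / (2 * pi) ^ (2 * ?n + 1)) * (ennreal ((8 * pi\<^sup>2) ^ ?n) * ennreal (2 * pi)) = ennreal (2 ^ ?n)"
  proof -
    have "8 * pi\<^sup>2 = (2 * pi)\<^sup>2 * 2" by (simp add: power2_eq_square)
    then have e: "(8 * pi\<^sup>2) ^ ?n = (2 * pi) ^ (2 * ?n) * 2 ^ ?n"
      by (simp only: power_mult_distrib power_mult)
    have "ennreal (1 / (2 * pi) ^ (2 * ?n + 1)) * (ennreal ((8 * pi\<^sup>2) ^ ?n) * ennreal (2 * pi))
      = ennreal (1 / (2 * pi) ^ (2 * ?n + 1) * ((8 * pi\<^sup>2) ^ ?n * (2 * pi)))"
      by (subst ennreal_mult', simp, subst ennreal_mult', simp, rule refl)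
    also have "1 / (2 * pi) ^ (2 * ?n + 1) * ((8 * pi\<^sup>2) ^ ?n * (2 * pi)) = 2 ^ ?n"
      unfolding e power_add by simp
    finally show ?thesis .
  qed
  finally show ?thesis .
qed

section \<open>Integrability of Schwartz functions\<close>

lemma integrable_inverse_one_plus_square: "integrable lborel (\<lambda>x::real. inverse (1 + x\<^sup>2))"
  using integrable_inverse_1_plus_square by (simp add: set_integrable_def)

text \<open>The majorant is a constant times the product of 1/(1 + x_b^2), integrable by Fubini.
  Expanding the product of the 1 + x_b^2 over subsets of the basis gives monomials, each controlled
  by a seminorm without derivatives.\<close>

lemma schwartz_integrable:
  fixes f :: "'a::euclidean_space \<Rightarrow> complex"
  assumes f: "schwartz f"
  shows "integrable lborel f"
proof -
  have diff: "f differentiable (at x)" for x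
    using f[unfolded schwartz_def, rule_format, of "[]"] by simp
  then have "continuous_on UNIV f"
    by (intro continuous_at_imp_continuous_on) (simp add: differentiable_imp_continuous_within)
  then have [measurable]: "f \<in> borel_measurable borel" by (rule borel_measurable_continuous_onI)
  have bdd: "\<exists>K. \<forall>x. (\<Prod>b\<in>S. (x \<bullet> b)\<^sup>2) * cmod (f x) \<le> K" if S: "S \<subseteq> Basis" for S
  proof -
    let ?\<alpha> = "\<lambda>b. if b \<in> S then 2 else 0 :: nat"
    have "bounded (range (\<lambda>x. (\<Prod>b\<in>Basis. (x \<bullet> b) ^ ?\<alpha> b) *\<^sub>R partial_derivs [] f x))"
      using f[unfolded schwartz_def, rule_format, of "[]"] by simp
    then obtain K where "\<forall>x. norm ((\<Prod>b\<in>Basis. (x \<bullet> b) ^ ?\<alpha> b) *\<^sub>R f x) \<le> K"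
      unfolding bounded_iff by auto
    moreover have "(\<Prod>b\<in>Basis. (x \<bullet> b) ^ ?\<alpha> b) = (\<Prod>b\<in>S. (x \<bullet> b)\<^sup>2)" for x :: 'a
      using S by (intro prod.mono_neutral_cong_right) auto
    ultimately show ?thesis by (auto simp: abs_prod intro!: exI[of _ K])
  qed
  then have "\<forall>S\<in>Pow Basis. \<exists>K. \<forall>x. (\<Prod>b\<in>S. (x \<bullet> b)\<^sup>2) * cmod (f x) \<le> K" by blast
  from bchoice[OF this] obtain K
    where K: "\<And>S x. S \<subseteq> Basis \<Longrightarrow> (\<Prod>b\<in>S. (x \<bullet> b)\<^sup>2) * cmod (f x) \<le> K S"
    by blast
  define C where "C = (\<Sum>S\<in>Pow Basis. K S)"
  have le: "(\<Prod>b\<in>Basis. 1 + (x \<bullet> b)\<^sup>2) * cmod (f x) \<le> C" for x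
  proof -
    have "(\<Prod>b\<in>Basis. (x \<bullet> b)\<^sup>2 + 1) = (\<Sum>S\<in>Pow Basis. (\<Prod>b\<in>S. (x \<bullet> b)\<^sup>2) * (\<Prod>b\<in>Basis - S. 1))"
      by (rule prod_add) simp
    then have "(\<Prod>b\<in>Basis. 1 + (x \<bullet> b)\<^sup>2) * cmod (f x) = (\<Sum>S\<in>Pow Basis. (\<Prod>b\<in>S. (x \<bullet> b)\<^sup>2) * cmod (f x))"
      by (simp add: sum_distrib_right add.commute)
    also have "\<dots> \<le> C" unfolding C_def by (intro sum_mono K) auto
    finally show ?thesis .
  qed
  let ?g = "\<lambda>x::'a. of_real C * (\<Prod>b\<in>Basis. complex_of_real (inverse (1 + (x \<bullet> b)\<^sup>2)))"
  show ?thesis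
  proof (rule Bochner_Integration.integrable_bound)
    have i: "integrable lborel (\<lambda>x. complex_of_real (inverse (1 + x\<^sup>2)))"
      by (simp only: complex_of_real_integrable_eq integrable_inverse_one_plus_square)
    show "integrable lborel ?g"
      by (intro integrable_mult_right lborel_prod_Basis(1)[of "\<lambda>_ x. complex_of_real (inverse (1 + x\<^sup>2))"] i)
    show "AE x in lborel. norm (f x) \<le> norm (?g x)"
    proof (intro AE_I2)
      fix x :: 'a
      let ?P = "\<Prod>b\<in>Basis. 1 + (x \<bullet> b)\<^sup>2"
      have P: "?P > 0" by (intro prod_pos) (auto intro: add_pos_nonneg)
      have "(\<Prod>b\<in>Basis. inverse (1 + (x \<bullet> b)\<^sup>2)) = inverse ?P"
        using prod_inversef[of "\<lambda>b. 1 + (x \<bullet> b)\<^sup>2" Basis] by (simp add: o_def)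
      then have "?g x = of_real (C * inverse ?P)"
        by (simp only: of_real_prod[symmetric] of_real_mult)
      then have "norm (?g x) = \<bar>C\<bar> * inverse ?P" using P by (simp only: norm_of_real abs_mult abs_inverse abs_of_pos)
      moreover have "cmod (f x) \<le> C * inverse ?P" using le[of x] P by (simp add: field_simps)
      moreover have "C * inverse ?P \<le> \<bar>C\<bar> * inverse ?P" using P by (intro mult_right_mono) auto
      ultimately show "norm (f x) \<le> norm (?g x)" by linarith
    qed
  qed simp
qed

section \<open>Powers of extended reals and assembly of the inequality\<close>

lemma enn_powr_mono: "x \<le> y \<Longrightarrow> r > 0 \<Longrightarrow> enn_powr x r \<le> enn_powr y r"
  by (cases x; cases y) (auto simp: enn_powr_def top_unique intro!: ennreal_leI powr_mono2)

lemma enn_powr_ennreal: "c \<ge> 0 \<Longrightarrow> r \<noteq> 0 \<Longrightarrow> enn_powr (ennreal c) r = ennreal (c powr r)"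
  by (simp add: enn_powr_def)

lemma enn_powr_cmult:
  assumes "c \<ge> 0" "r > 0"
  shows "enn_powr (ennreal c * x) r = ennreal (c powr r) * enn_powr x r"
proof (cases x)
  case (real y)
  then show ?thesis using assms by (simp add: enn_powr_ennreal ennreal_mult'[symmetric] powr_mult)
next
  case top
  then show ?thesis using assms
    by (cases "c = 0") (auto simp: enn_powr_def ennreal_mult_top ennreal_top_mult)
qed

lemma enn_powr_fourier_energy:
  fixes f :: "'n::finite heis \<Rightarrow> complex"
  assumes p: "p > 0"
  shows "enn_powr (fourier_energy f a) (p / 2)
    = enn_powr (\<integral>\<^sup>+ w. ennreal ((cmod (strichartz_fourier f a w))\<^sup>2) \<partial>lborel) (p / 2) * ennreal (\<bar>fst a\<bar> powr (real CARD('n) * p / 2))"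
proof -
  have "(\<bar>fst a\<bar> ^ CARD('n)) powr (p / 2) = \<bar>fst a\<bar> powr (real CARD('n) * p / 2)"
    by (cases "fst a = 0") (auto simp: powr_powr simp flip: powr_realpow)
  then show ?thesis unfolding fourier_energy_def using p by (subst enn_powr_cmult) (simp_all add: mult.commute)
qed

text \<open>Covers the degenerate case of weak norm 0, where \<open>paley_interpolation\<close>,
  which requires w > 0, does not apply.\<close>

lemma space_null_of_weak_L1_zero:
  assumes [measurable]: "\<phi> \<in> borel_measurable M" and pos: "\<And>a. a \<in> space M \<Longrightarrow> (0::real) < \<phi> a"
    and zero: "\<And>s. s > 0 \<Longrightarrow> emeasure M {a \<in> space M. s < \<phi> a} = 0"
  shows "space M \<in> null_sets M"
proof -
  let ?A = "\<lambda>m::nat. {a \<in> space M. 1 / Suc m < \<phi> a}"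
  have "?A m \<in> null_sets M" for m
    using zero[of "1 / Suc m"] by (intro null_setsI) auto
  then have "(\<Union>m. ?A m) \<in> null_sets M" by (rule null_sets_UN)
  moreover have "(\<Union>m. ?A m) = space M"
    by (rule UN_superlevel_sets[OF pos])
  ultimately show ?thesis by simp
qed

text \<open>\<open>paley_interpolation\<close> with A = sqrt((2 pi)^n) from
  \<open>fourier_energy_le_L1\<close> and B = 2^n from
  \<open>fourier_energy_integral_le\<close>.\<close>

lemma fourier_energy_paley:
  fixes f :: "'n::finite heis \<Rightarrow> complex"
  assumes p: "1 < p" "p < 2" and f: "integrable lborel f"
    and \<phi> [measurable]: "\<phi> \<in> borel_measurable (fan_mu CARD('n))" and pos: "\<And>a. a \<in> heis_fan CARD('n) \<Longrightarrow> 0 < \<phi> a"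
    and w: "w \<ge> 0" "weak_L1_norm (fan_mu CARD('n)) \<phi> = ennreal w"
  shows "(\<integral>\<^sup>+ a. enn_powr (fourier_energy f a) (p / 2) * ennreal (\<phi> a powr (2 - p)) \<partial>fan_mu CARD('n))
    \<le> ennreal ((4 * sqrt ((2 * pi) ^ CARD('n)) * p / (p - 1) + 4 * 2 ^ CARD('n) * p / (2 - p)) * w powr (2 - p))
      * (\<integral>\<^sup>+ x. ennreal (cmod (f x) powr p) \<partial>lborel)"
proof -
  let ?M = "fan_mu CARD('n)"
  have pos': "\<And>a. a \<in> space ?M \<Longrightarrow> 0 < \<phi> a" using pos by (simp add: space_fan_mu)
  have weak: "ennreal s * emeasure ?M {a \<in> space ?M. s < \<phi> a} \<le> ennreal w" if s: "s > 0" for s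
  proof -
    have "{a \<in> space ?M. s < \<phi> a} = {a \<in> space ?M. s < \<bar>\<phi> a\<bar>}" using pos' by force
    then show ?thesis
      unfolding w(2)[symmetric] weak_L1_norm_def using s by (auto intro: SUP_upper)
  qed
  show ?thesis
  proof (cases "w = 0")
    case True
    have "emeasure ?M {a \<in> space ?M. s < \<phi> a} = 0" if "s > 0" for s
      using weak[OF that] True that by simp
    then have N: "space ?M \<in> null_sets ?M"
      by (intro space_null_of_weak_L1_zero[OF \<phi> pos'])
    have "(\<integral>\<^sup>+ a. enn_powr (fourier_energy f a) (p / 2) * ennreal (\<phi> a powr (2 - p)) \<partial>?M)
      = (\<integral>\<^sup>+ a. enn_powr (fourier_energy f a) (p / 2) * ennreal (\<phi> a powr (2 - p)) * indicator (space ?M) a \<partial>?M)"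
      by (intro nn_integral_cong) simp
    also have "\<dots> = 0" by (rule nn_integral_null_set[OF N])
    finally show ?thesis by simp
  next
    case False
    show ?thesis
    proof (rule paley_interpolation)
      show "fourier_energy g \<in> borel_measurable ?M" if "integrable lborel g" for g :: "'n heis \<Rightarrow> complex"
        using fourier_energy_measurable[of g] that by (simp cong: measurable_cong_sets add: sets_fan_mu)
      show "sigma_finite_measure (lborel :: 'n heis measure)" by (rule lborel.sigma_finite_measure_axioms)
      show "fourier_energy (\<lambda>x. g x + h x) a \<le> 2 * fourier_energy g a + 2 * fourier_energy h a"
        if "integrable lborel g" "integrable lborel h" for g h :: "'n heis \<Rightarrow> complex" and a
        using that by (rule fourier_energy_add)
      show "fourier_energy g a \<le> ennreal ((sqrt ((2 * pi) ^ CARD('n)) * (LINT x|lborel. cmod (g x)))\<^sup>2)"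
        if "integrable lborel g" for g :: "'n heis \<Rightarrow> complex" and a
        using that by (rule fourier_energy_le_L1)
      show "(\<integral>\<^sup>+ a. fourier_energy g a \<partial>?M) \<le> ennreal (2 ^ CARD('n)) * (\<integral>\<^sup>+ x. ennreal ((cmod (g x))\<^sup>2) \<partial>lborel)"
        if "integrable lborel g" for g :: "'n heis \<Rightarrow> complex"
        using that by (rule fourier_energy_integral_le)
      show "w > 0" using w(1) False by simp
    qed (use p f pos' weak \<phi> in simp_all)
  qed
qed

theorem theorem3p2:
  fixes p :: real
  assumes "1 < p" and "p \<le> 2"
  shows "\<exists>C::real. C > 0 \<and>
    (\<forall>(\<phi> :: real \<times> real \<Rightarrow> real) (f :: 'n::finite heis \<Rightarrow> complex).
       \<phi> \<in> weak_L1 (fan_mu CARD('n)) \<longrightarrow> (\<forall>a\<in>heis_fan CARD('n). \<phi> a > 0) \<longrightarrow> schwartz f \<longrightarrow>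
       enn_powr
         (\<integral>\<^sup>+ a. enn_powr (\<integral>\<^sup>+ w. ennreal ((cmod (strichartz_fourier f a w))\<^sup>2) \<partial>lborel) (p / 2) *
                ennreal (\<bar>fst a\<bar> powr (real CARD('n) * p / 2)) * ennreal (\<phi> a powr (2 - p))
            \<partial>fan_mu CARD('n))
         (1 / p)
       \<le> ennreal C * enn_powr (weak_L1_norm (fan_mu CARD('n)) \<phi>) (2 / p - 1) *
          Lp_norm p lborel f)"
proof (cases "p = 2")
  \<comment> \<open>At p = 2 the weight has exponent 0 and the weak norm enters to the power 0, so
    the claim is the square root of the (2,2) bound.\<close>
  case p2: True
  show ?thesis
  proof (intro exI[of _ "(2 ^ CARD('n)) powr (1 / p)"] conjI allI impI)
    fix \<phi> :: "real \<times> real \<Rightarrow> real" and f :: "'n heis \<Rightarrow> complex"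
    assume pos: "\<forall>a\<in>heis_fan CARD('n). \<phi> a > 0" and f: "schwartz f"
    let ?X = "\<integral>\<^sup>+ x. ennreal (cmod (f x) powr p) \<partial>lborel"
    have "(\<integral>\<^sup>+ a. enn_powr (\<integral>\<^sup>+ w. ennreal ((cmod (strichartz_fourier f a w))\<^sup>2) \<partial>lborel) (p / 2) *
                ennreal (\<bar>fst a\<bar> powr (real CARD('n) * p / 2)) * ennreal (\<phi> a powr (2 - p)) \<partial>fan_mu CARD('n))
      = (\<integral>\<^sup>+ a. fourier_energy f a \<partial>fan_mu CARD('n))"
    proof (intro nn_integral_cong)
      fix a assume "a \<in> space (fan_mu CARD('n))"
      \<comment> \<open>Positivity matters here, since \<open>0 powr 0\<close> is 0.\<close>
      then have "\<phi> a powr (2 - p) = 1" using pos p2 by (auto simp: space_fan_mu)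
      moreover have "enn_powr x (p / 2) = x" for x
        by (cases x) (simp_all add: p2 enn_powr_def)
      ultimately show "enn_powr (\<integral>\<^sup>+ w. ennreal ((cmod (strichartz_fourier f a w))\<^sup>2) \<partial>lborel) (p / 2) *
                ennreal (\<bar>fst a\<bar> powr (real CARD('n) * p / 2)) * ennreal (\<phi> a powr (2 - p)) = fourier_energy f a"
        using enn_powr_fourier_energy[of p f a] assms by simp
    qed
    also have "\<dots> \<le> ennreal (2 ^ CARD('n)) * ?X"
      using fourier_energy_integral_le[OF schwartz_integrable[OF f]] by (simp add: p2 powr_numeral)
    finally have "enn_powr (\<integral>\<^sup>+ a. enn_powr (\<integral>\<^sup>+ w. ennreal ((cmod (strichartz_fourier f a w))\<^sup>2) \<partial>lborel) (p / 2) *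
                ennreal (\<bar>fst a\<bar> powr (real CARD('n) * p / 2)) * ennreal (\<phi> a powr (2 - p)) \<partial>fan_mu CARD('n)) (1 / p)
      \<le> enn_powr (ennreal (2 ^ CARD('n)) * ?X) (1 / p)"
      using assms by (intro enn_powr_mono) auto
    also have "\<dots> = ennreal ((2 ^ CARD('n)) powr (1 / p)) * Lp_norm p lborel f"
      using assms unfolding Lp_norm_def by (intro enn_powr_cmult) auto
    also have "\<dots> = ennreal ((2 ^ CARD('n)) powr (1 / p)) * enn_powr (weak_L1_norm (fan_mu CARD('n)) \<phi>) (2 / p - 1) * Lp_norm p lborel f"
      by (simp add: enn_powr_def p2)
    finally show "enn_powr (\<integral>\<^sup>+ a. enn_powr (\<integral>\<^sup>+ w. ennreal ((cmod (strichartz_fourier f a w))\<^sup>2) \<partial>lborel) (p / 2) *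
                ennreal (\<bar>fst a\<bar> powr (real CARD('n) * p / 2)) * ennreal (\<phi> a powr (2 - p)) \<partial>fan_mu CARD('n)) (1 / p)
      \<le> ennreal ((2 ^ CARD('n)) powr (1 / p)) * enn_powr (weak_L1_norm (fan_mu CARD('n)) \<phi>) (2 / p - 1) * Lp_norm p lborel f" .
  qed simp
next
  case False
  then have p: "1 < p" "p < 2" using assms by auto
  define K where "K = 4 * sqrt ((2 * pi) ^ CARD('n)) * p / (p - 1) + 4 * 2 ^ CARD('n) * p / (2 - p)"
  have K: "K > 0" unfolding K_def using p by (intro add_pos_pos divide_pos_pos mult_pos_pos) auto
  show ?thesis
  proof (intro exI[of _ "K powr (1 / p)"] conjI allI impI)
    fix \<phi> :: "real \<times> real \<Rightarrow> real" and f :: "'n heis \<Rightarrow> complex"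
    assume \<phi>: "\<phi> \<in> weak_L1 (fan_mu CARD('n))" and pos: "\<forall>a\<in>heis_fan CARD('n). \<phi> a > 0" and f: "schwartz f"
    let ?X = "\<integral>\<^sup>+ x. ennreal (cmod (f x) powr p) \<partial>lborel"
    obtain w where w: "w \<ge> 0" "weak_L1_norm (fan_mu CARD('n)) \<phi> = ennreal w"
      using \<phi> by (cases "weak_L1_norm (fan_mu CARD('n)) \<phi>") (auto simp: weak_L1_def)
    have "(\<integral>\<^sup>+ a. enn_powr (\<integral>\<^sup>+ w. ennreal ((cmod (strichartz_fourier f a w))\<^sup>2) \<partial>lborel) (p / 2) *
                ennreal (\<bar>fst a\<bar> powr (real CARD('n) * p / 2)) * ennreal (\<phi> a powr (2 - p)) \<partial>fan_mu CARD('n))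
      = (\<integral>\<^sup>+ a. enn_powr (fourier_energy f a) (p / 2) * ennreal (\<phi> a powr (2 - p)) \<partial>fan_mu CARD('n))"
      using p by (simp add: enn_powr_fourier_energy)
    also have "\<dots> \<le> ennreal (K * w powr (2 - p)) * ?X"
      unfolding K_def using \<phi> pos by (intro fourier_energy_paley p w schwartz_integrable f) (auto simp: weak_L1_def)
    finally have "enn_powr (\<integral>\<^sup>+ a. enn_powr (\<integral>\<^sup>+ w. ennreal ((cmod (strichartz_fourier f a w))\<^sup>2) \<partial>lborel) (p / 2) *
                ennreal (\<bar>fst a\<bar> powr (real CARD('n) * p / 2)) * ennreal (\<phi> a powr (2 - p)) \<partial>fan_mu CARD('n)) (1 / p)
      \<le> enn_powr (ennreal (K * w powr (2 - p)) * ?X) (1 / p)"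
      using p by (intro enn_powr_mono) auto
    also have "\<dots> = ennreal ((K * w powr (2 - p)) powr (1 / p)) * Lp_norm p lborel f"
      using p K unfolding Lp_norm_def by (intro enn_powr_cmult) auto
    also have "(K * w powr (2 - p)) powr (1 / p) = K powr (1 / p) * w powr (2 / p - 1)"
    proof -
      \<comment> \<open>The p-th root of w^(2-p) is the stated power of the weak norm.\<close>
      have "(2 - p) * (1 / p) = 2 / p - 1" using p by (simp add: field_simps)
      then show ?thesis using K by (simp only: powr_mult powr_powr)
    qed
    also have "ennreal (K powr (1 / p) * w powr (2 / p - 1)) = ennreal (K powr (1 / p)) * enn_powr (weak_L1_norm (fan_mu CARD('n)) \<phi>) (2 / p - 1)"
      using p w by (simp add: enn_powr_ennreal ennreal_mult')
    finally show "enn_powr (\<integral>\<^sup>+ a. enn_powr (\<integral>\<^sup>+ w. ennreal ((cmod (strichartz_fourier f a w))\<^sup>2) \<partial>lborel) (p / 2) *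
                ennreal (\<bar>fst a\<bar> powr (real CARD('n) * p / 2)) * ennreal (\<phi> a powr (2 - p)) \<partial>fan_mu CARD('n)) (1 / p)
      \<le> ennreal (K powr (1 / p)) * enn_powr (weak_L1_norm (fan_mu CARD('n)) \<phi>) (2 / p - 1) * Lp_norm p lborel f" .
  qed (use K in simp)
qed

end
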